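(* Let $T$ be an isotropic and stationary Gaussian $\mathrm{SPHAR}(1)$ process on $\mathbb{S}^2\times\mathbb{Z}$ (with continuous autoregressive kernel, see the context) whose autoregressive operator has eigenvalues $\phi_\ell=G_0\ell^{-\alpha_0}$, $\ell\in\{1,2,\dots\}$, with $0<|G_0|<1$ and $a_1\le\alpha_0\le a_2$, $1<a_1<a_2<\infty$, and whose driving spherical white noise has angular power spectrum $C_{\ell;Z}=H\ell^{-\gamma}$, with $H>0$, $\gamma>2$. Let the truncation multipoles $L_N$ satisfy $L_N\to\infty$ and $(\log L_N)^2/\sqrt N\to0$ as $N\to\infty$. Let $(\widehat G_N,\widehat\alpha_N)$ be the nonlinear least squares estimator of $(G_0,\alpha_0)$ defined in the context. Then, as $N\to\infty$, $$\widehat\alpha_N\overset{p}{\to}\alpha_0,\qquad \widehat G_N\overset{p}{\to}G_0 .$$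
   Context: Multipoles are indexed by $\ell\in\mathbb{N}=\{1,2,\dots\}$. Let $\{Y_{\ell,m}\}_{\ell\in\mathbb N,\,-\ell\le m\le\ell}$ be the real spherical harmonics, orthonormal in $L^2(\mathbb{S}^2)$. The field $\{T(x,t):(x,t)\in\mathbb{S}^2\times\mathbb{Z}\}$ is real-valued, centered, mean-square continuous, Gaussian, isotropic in space and stationary in time (i.e. $T(R\,\cdot,\cdot+\tau)\overset{d}{=}T(\cdot,\cdot)$ for all $R\in SO(3)$, $\tau\in\mathbb{Z}$). It is $\mathrm{SPHAR}(1)$: $T(x,t)=(\Phi T(\cdot,t-1))(x)+Z(x,t)$, where $(\Phi f)(x)=\int_{\mathbb{S}^2}k(\langle x,y\rangle)f(y)\,dy$, $f\in L^2(\mathbb{S}^2)$, for some continuous $k:[-1,1]\to\mathbb{R}$ (the autoregressive kernel), with $k(\langle x,y\rangle)=\sum_{\ell\in\mathbb N}\phi_\ell\frac{2\ell+1}{4\pi}P_\ell(\langle x,y\rangle)$ in the $L^2$ sense ($P_\ell$ the Legendre polynomials), so that the $\phi_\ell$ are the eigenvalues of $\Phi$; and $Z$ is a Gaussian spherical white noise: the fields $Z(\cdot,t)$, $t\in\mathbb{Z}$, are i.i.d. centered isotropic Gaussian, $Z(\cdot,t)$ is independent of $\{T(\cdot,s):s<t\}$, with angular power spectrum $C_{\ell;Z}=\mathbb{E}|a_{\ell,m;Z}(t)|^2$, where $a_{\ell,m;Z}(t)=\int_{\mathbb{S}^2}Z(x,t)Y_{\ell,m}(x)\,dx$. Put $a_{\ell,m}(t)=\int_{\mathbb{S}^2}T(x,t)Y_{\ell,m}(x)\,dx$;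 then $a_{\ell,m}(t)=\phi_\ell a_{\ell,m}(t-1)+a_{\ell,m;Z}(t)$. Let $A=[a_1,a_2]$ and $\Theta=\left((-1,1)\setminus\{0\}\right)\times A$. For $N>1$ the estimator is $$(\widehat G_N,\widehat\alpha_N)=\underset{(G,\alpha)\in\Theta}{\mathrm{argmin}}\ R_N(G,\alpha),\qquad R_N(G,\alpha)=\frac1N\sum_{t=1}^N\sum_{\ell=1}^{L_N}\sum_{m=-\ell}^{\ell}\left(a_{\ell,m}(t)-G\ell^{-\alpha}a_{\ell,m}(t-1)\right)^2 .$$ By first minimizing in $G$, the minimization problem is rewritten as $\widehat\alpha_N=\mathrm{argmax}_{\alpha\in A}\widehat U_N(\alpha)^2/\widehat D_N(\alpha)$, $\widehat G_N=\widehat U_N(\widehat\alpha_N)/\widehat D_N(\widehat\alpha_N)$, where $\widehat U_N(\alpha)=\frac1N\sum_{t=1}^N\sum_{\ell=1}^{L_N}\sum_{m=-\ell}^{\ell}a_{\ell,m}(t)a_{\ell,m}(t-1)\ell^{-\alpha}$ and $\widehat D_N(\alpha)=\frac1N\sum_{t=1}^N\sum_{\ell=1}^{L_N}\sum_{m=-\ell}^{\ell}a_{\ell,m}(t-1)^2\ell^{-2\alpha}$. Here $\overset{p}{\to}$ is convergence in probability. *)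

theory Defs
  imports "HOL-Probability.Probability" "HOL-Computational_Algebra.Polynomial"
begin

section \<open>The unit sphere and real spherical harmonics\<close>

abbreviation S2 :: "(real ^ 3) set" where
  "S2 \<equiv> sphere 0 1"

definition sphere_point :: "real \<Rightarrow> real \<Rightarrow> real ^ 3" where
  "sphere_point \<theta> \<phi> = vector [sin \<theta> * cos \<phi>, sin \<theta> * sin \<phi>, cos \<theta>]"

text \<open>Surface area \<open>sin \<theta> d\<theta> d\<phi>\<close> (total mass \<open>4\<pi>\<close>), as a measure whose space is \<^term>\<open>S2\<close>.\<close>

definition sphere_measure :: "(real ^ 3) measure" where
  "sphere_measure =
     distr (density (restrict_space lborel ({0..pi} \<times> {0..2 * pi})) (\<lambda>(\<theta>, \<phi>). ennreal (sin \<theta>)))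
       (restrict_space borel S2) (\<lambda>(\<theta>, \<phi>). sphere_point \<theta> \<phi>)"

text \<open>Legendre polynomials, by Rodrigues' formula.\<close>

definition legendre :: "nat \<Rightarrow> real poly" where
  "legendre l = smult (1 / (2 ^ l * fact l)) ((pderiv ^^ l) ([:-1, 0, 1:] ^ l))"

text \<open>
  In spherical coordinates, with \<open>k = |m|\<close>, the function below is
  \<open>N * (sin \<theta>)^k * P_l^(k)(cos \<theta>)\<close> times \<open>1\<close>, \<open>sqrt 2 * cos (k \<phi>)\<close> or \<open>sqrt 2 * sin (k \<phi>)\<close> according to
  the sign of \<open>m\<close>, where \<open>P_l^(k)\<close> is the \<open>k\<close>-th derivative of \<open>P_l\<close>. The factor \<open>(sin \<theta>)^k exp (i k \<phi>)\<close>
  is written as \<open>(x_1 + i x_2)^k\<close>. The Condon-Shortley sign is omitted.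
\<close>

definition real_sph_harm :: "nat \<Rightarrow> int \<Rightarrow> real ^ 3 \<Rightarrow> real" where
  "real_sph_harm l m x =
     (let k = nat \<bar>m\<bar>; w = Complex (x $ 1) (x $ 2) in
      sqrt ((2 * real l + 1) / (4 * pi) * fact (l - k) / fact (l + k)) *
      poly ((pderiv ^^ k) (legendre l)) (x $ 3) *
      (if m = 0 then 1 else if m > 0 then sqrt 2 * Re (w ^ k) else sqrt 2 * Im (w ^ k)))"

section \<open>Random fields\<close>

text \<open>Degenerate normal laws (\<open>\<sigma> = 0\<close>) are allowed.\<close>

definition gaussian_rv :: "'w measure \<Rightarrow> ('w \<Rightarrow> real) \<Rightarrow> bool" where
  "gaussian_rv M X \<longleftrightarrow> X \<in> borel_measurable M \<and>
     (\<exists>\<mu> \<sigma>. distr M borel X =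
        distr (density lborel (\<lambda>x. ennreal (std_normal_density x))) borel (\<lambda>z. \<mu> + \<sigma> * z))"

definition gaussian_field :: "'w measure \<Rightarrow> 'i set \<Rightarrow> ('i \<Rightarrow> 'w \<Rightarrow> real) \<Rightarrow> bool" where
  "gaussian_field M I X \<longleftrightarrow>
     (\<forall>F c. finite F \<and> F \<subseteq> I \<longrightarrow> gaussian_rv M (\<lambda>\<omega>. \<Sum>i\<in>F. c i * X i \<omega>))"

definition centered_field :: "'w measure \<Rightarrow> 'i set \<Rightarrow> ('i \<Rightarrow> 'w \<Rightarrow> real) \<Rightarrow> bool" where
  "centered_field M I X \<longleftrightarrow> (\<forall>i\<in>I. integrable M (X i) \<and> (\<integral>\<omega>. X i \<omega> \<partial>M) = 0)"

text \<open>The law on the product sigma-algebra, i.e. the collection of finite-dimensional distributions.\<close>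

definition field_law :: "'w measure \<Rightarrow> 'i set \<Rightarrow> ('i \<Rightarrow> 'w \<Rightarrow> real) \<Rightarrow> ('i \<Rightarrow> real) measure" where
  "field_law M I X = distr M (PiM I (\<lambda>_. borel)) (\<lambda>\<omega>. \<lambda>i\<in>I. X i \<omega>)"

text \<open>
  Joint measurability in the space variable and the sample point is part of the notion of a random
  field on the sphere; it makes the pathwise integrals over the sphere below meaningful.
\<close>

definition spherical_random_field :: "'w measure \<Rightarrow> (real ^ 3 \<Rightarrow> 'w \<Rightarrow> real) \<Rightarrow> bool" where
  "spherical_random_field M X \<longleftrightarrow>
     (\<lambda>(x, \<omega>). X x \<omega>) \<in> borel_measurable (restrict_space borel S2 \<Otimes>\<^sub>M M)"

definition mean_square_continuous :: "'w measure \<Rightarrow> (real ^ 3 \<Rightarrow> 'w \<Rightarrow> real) \<Rightarrow> bool" where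
  "mean_square_continuous M X \<longleftrightarrow>
     (\<forall>x\<in>S2. ((\<lambda>y. \<integral>\<omega>. (X y \<omega> - X x \<omega>)\<^sup>2 \<partial>M) \<longlongrightarrow> 0) (at x within S2))"

definition isotropic :: "'w measure \<Rightarrow> (real ^ 3 \<Rightarrow> 'w \<Rightarrow> real) \<Rightarrow> bool" where
  "isotropic M X \<longleftrightarrow>
     (\<forall>R. rotation_matrix R \<longrightarrow> field_law M S2 (\<lambda>x. X (R *v x)) = field_law M S2 X)"

definition isotropic_stationary :: "'w measure \<Rightarrow> (real ^ 3 \<Rightarrow> int \<Rightarrow> 'w \<Rightarrow> real) \<Rightarrow> bool" where
  "isotropic_stationary M T \<longleftrightarrow>
     (\<forall>R \<tau>. rotation_matrix R \<longrightarrow>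
        field_law M (S2 \<times> UNIV) (\<lambda>(x, t). T (R *v x) (t + \<tau>)) =
        field_law M (S2 \<times> UNIV) (\<lambda>(x, t). T x t))"

definition iso_stat_gaussian_field :: "'w measure \<Rightarrow> (real ^ 3 \<Rightarrow> int \<Rightarrow> 'w \<Rightarrow> real) \<Rightarrow> bool" where
  "iso_stat_gaussian_field M T \<longleftrightarrow>
     (\<forall>t. spherical_random_field M (\<lambda>x. T x t)) \<and>
     (\<forall>t. mean_square_continuous M (\<lambda>x. T x t)) \<and>
     centered_field M (S2 \<times> UNIV) (\<lambda>(x, t). T x t) \<and>
     gaussian_field M (S2 \<times> UNIV) (\<lambda>(x, t). T x t) \<and>
     isotropic_stationary M T"

definition gaussian_spherical_white_noise ::
  "'w measure \<Rightarrow> (real ^ 3 \<Rightarrow> int \<Rightarrow> 'w \<Rightarrow> real) \<Rightarrow> bool" where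
  "gaussian_spherical_white_noise M Z \<longleftrightarrow>
     (\<forall>t. spherical_random_field M (\<lambda>x. Z x t)) \<and>
     (\<forall>t. centered_field M S2 (\<lambda>x. Z x t)) \<and>
     (\<forall>t. gaussian_field M S2 (\<lambda>x. Z x t)) \<and>
     (\<forall>t. isotropic M (\<lambda>x. Z x t)) \<and>
     (\<forall>s t. field_law M S2 (\<lambda>x. Z x s) = field_law M S2 (\<lambda>x. Z x t)) \<and>
     prob_space.indep_vars M (\<lambda>_. PiM S2 (\<lambda>_. borel)) (\<lambda>t \<omega>. \<lambda>x\<in>S2. Z x t \<omega>) UNIV"

text \<open>
  The innovation at time \<open>t\<close> is indexed by \<open>S2 \<times> {t}\<close> because \<open>indep_var\<close> asks for two random
  variables with values in the same type.
\<close>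

definition independent_of_past ::
  "'w measure \<Rightarrow> (real ^ 3 \<Rightarrow> int \<Rightarrow> 'w \<Rightarrow> real) \<Rightarrow> (real ^ 3 \<Rightarrow> int \<Rightarrow> 'w \<Rightarrow> real) \<Rightarrow> bool" where
  "independent_of_past M Z T \<longleftrightarrow>
     (\<forall>t. prob_space.indep_var M
        (PiM (S2 \<times> {t}) (\<lambda>_. borel)) (\<lambda>\<omega>. \<lambda>(x, s)\<in>S2 \<times> {t}. Z x s \<omega>)
        (PiM (S2 \<times> {..<t}) (\<lambda>_. borel)) (\<lambda>\<omega>. \<lambda>(x, s)\<in>S2 \<times> {..<t}. T x s \<omega>))"

text \<open>Only the values of the kernel \<open>k\<close> on \<open>[-1, 1]\<close> matter.\<close>

definition autoreg_operator :: "(real \<Rightarrow> real) \<Rightarrow> (real ^ 3 \<Rightarrow> real) \<Rightarrow> real ^ 3 \<Rightarrow> real" where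
  "autoreg_operator k f x = (\<integral>y. k (x \<bullet> y) * f y \<partial>sphere_measure)"

text \<open>
  \<open>\<phi>\<close> is the sequence of eigenvalues of the operator with kernel \<open>k (x \<bullet> y)\<close>: the Legendre series
  below converges to the kernel in \<open>L\<^sup>2\<close> of the product of the sphere with itself.
\<close>

definition autoreg_eigenvalues :: "(real \<Rightarrow> real) \<Rightarrow> (nat \<Rightarrow> real) \<Rightarrow> bool" where
  "autoreg_eigenvalues k \<phi> \<longleftrightarrow>
     (\<lambda>n. \<integral>(x, y). (k (x \<bullet> y) -
            (\<Sum>l=1..n. \<phi> l * ((2 * real l + 1) / (4 * pi)) * poly (legendre l) (x \<bullet> y)))\<^sup>2
          \<partial>(sphere_measure \<Otimes>\<^sub>M sphere_measure)) \<longlonglongrightarrow> 0"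

definition sphar1 :: "'w measure \<Rightarrow> (real \<Rightarrow> real) \<Rightarrow>
    (real ^ 3 \<Rightarrow> int \<Rightarrow> 'w \<Rightarrow> real) \<Rightarrow> (real ^ 3 \<Rightarrow> int \<Rightarrow> 'w \<Rightarrow> real) \<Rightarrow> bool" where
  "sphar1 M k T Z \<longleftrightarrow>
     continuous_on {-1..1} k \<and>
     gaussian_spherical_white_noise M Z \<and>
     independent_of_past M Z T \<and>
     (\<forall>x\<in>S2. \<forall>t. AE \<omega> in M. T x t \<omega> = autoreg_operator k (\<lambda>y. T y (t - 1) \<omega>) x + Z x t \<omega>)"

definition harm_coeff :: "(real ^ 3 \<Rightarrow> int \<Rightarrow> 'w \<Rightarrow> real) \<Rightarrow> 'w \<Rightarrow> nat \<Rightarrow> int \<Rightarrow> int \<Rightarrow> real" where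
  "harm_coeff T \<omega> l m t = (\<integral>x. T x t \<omega> * real_sph_harm l m x \<partial>sphere_measure)"

definition angular_power_spectrum ::
  "'w measure \<Rightarrow> (real ^ 3 \<Rightarrow> int \<Rightarrow> 'w \<Rightarrow> real) \<Rightarrow> (nat \<Rightarrow> real) \<Rightarrow> bool" where
  "angular_power_spectrum M Z C \<longleftrightarrow>
     (\<forall>l\<ge>1. \<forall>m\<in>{- int l..int l}. \<forall>t.
        integrable M (\<lambda>\<omega>. (harm_coeff Z \<omega> l m t)\<^sup>2) \<and>
        (\<integral>\<omega>. (harm_coeff Z \<omega> l m t)\<^sup>2 \<partial>M) = C l)"

section \<open>Nonlinear least squares\<close>

text \<open>Here \<open>a l m t\<close> is an array of observed harmonic coefficients and \<open>L\<close> the truncation multipole.\<close>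

definition lsq_risk :: "(nat \<Rightarrow> int \<Rightarrow> int \<Rightarrow> real) \<Rightarrow> nat \<Rightarrow> nat \<Rightarrow> real \<times> real \<Rightarrow> real" where
  "lsq_risk a L N = (\<lambda>(G, \<alpha>). 1 / real N * (\<Sum>t=1..N. \<Sum>l=1..L. \<Sum>m\<in>{- int l..int l}.
     (a l m (int t) - G * real l powr (- \<alpha>) * a l m (int t - 1))\<^sup>2))"

definition U_hat :: "(nat \<Rightarrow> int \<Rightarrow> int \<Rightarrow> real) \<Rightarrow> nat \<Rightarrow> nat \<Rightarrow> real \<Rightarrow> real" where
  "U_hat a L N \<alpha> = 1 / real N * (\<Sum>t=1..N. \<Sum>l=1..L. \<Sum>m\<in>{- int l..int l}.
     a l m (int t) * a l m (int t - 1) * real l powr (- \<alpha>))"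

definition D_hat :: "(nat \<Rightarrow> int \<Rightarrow> int \<Rightarrow> real) \<Rightarrow> nat \<Rightarrow> nat \<Rightarrow> real \<Rightarrow> real" where
  "D_hat a L N \<alpha> = 1 / real N * (\<Sum>t=1..N. \<Sum>l=1..L. \<Sum>m\<in>{- int l..int l}.
     (a l m (int t - 1))\<^sup>2 * real l powr (- 2 * \<alpha>))"

definition param_space :: "real set \<Rightarrow> (real \<times> real) set" where
  "param_space A = ({-1<..<1} - {0}) \<times> A"

text \<open>
  Since \<^term>\<open>param_space A\<close> is not compact, for finite \<open>N\<close> the infimum of the risk may fail to be
  attained with positive probability. The first definition requires the estimate to be a minimizer
  over \<^term>\<open>param_space A\<close> at every sample point at which one exists and leaves its value free elsewhere.
  The second one is the formulation obtained by first minimizing in \<open>G\<close> over the whole real line.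
\<close>

definition nlls_estimator :: "'w measure \<Rightarrow> ('w \<Rightarrow> nat \<Rightarrow> int \<Rightarrow> int \<Rightarrow> real) \<Rightarrow> real set \<Rightarrow>
    nat \<Rightarrow> nat \<Rightarrow> ('w \<Rightarrow> real) \<Rightarrow> ('w \<Rightarrow> real) \<Rightarrow> bool" where
  "nlls_estimator M a A L N Gh \<alpha>h \<longleftrightarrow>
     (AE \<omega> in M. (\<exists>p. is_arg_min (lsq_risk (a \<omega>) L N) (\<lambda>p. p \<in> param_space A) p) \<longrightarrow>
        is_arg_min (lsq_risk (a \<omega>) L N) (\<lambda>p. p \<in> param_space A) (Gh \<omega>, \<alpha>h \<omega>))"

definition profile_nlls_estimator :: "'w measure \<Rightarrow> ('w \<Rightarrow> nat \<Rightarrow> int \<Rightarrow> int \<Rightarrow> real) \<Rightarrow> real set \<Rightarrow>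
    nat \<Rightarrow> nat \<Rightarrow> ('w \<Rightarrow> real) \<Rightarrow> ('w \<Rightarrow> real) \<Rightarrow> bool" where
  "profile_nlls_estimator M a A L N Gh \<alpha>h \<longleftrightarrow>
     (AE \<omega> in M.
        is_arg_max (\<lambda>\<alpha>. (U_hat (a \<omega>) L N \<alpha>)\<^sup>2 / D_hat (a \<omega>) L N \<alpha>) (\<lambda>\<alpha>. \<alpha> \<in> A) (\<alpha>h \<omega>) \<and>
        Gh \<omega> = U_hat (a \<omega>) L N (\<alpha>h \<omega>) / D_hat (a \<omega>) L N (\<alpha>h \<omega>))"

definition converges_in_prob :: "'w measure \<Rightarrow> (nat \<Rightarrow> 'w \<Rightarrow> real) \<Rightarrow> real \<Rightarrow> bool" where
  "converges_in_prob M X c \<longleftrightarrow>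
     (\<forall>\<epsilon>>0. (\<lambda>n. measure M {\<omega> \<in> space M. \<bar>X n \<omega> - c\<bar> > \<epsilon>}) \<longlonglongrightarrow> 0)"

end

theory Submission
  imports Defs
begin

text \<open>
  By a Funk--Hecke identity for the explicit real spherical harmonics, each sequence of harmonic
  coefficients is a scalar AR(1) process with coefficient \<open>\<phi>_l = G\<^sub>0 l^(-\<alpha>\<^sub>0)\<close> and innovations independent
  of the past, so its empirical second and lag-one moments converge in mean to \<open>C_l\<close> and \<open>\<phi>_l C_l\<close>.
  Since \<open>C_l\<close> decays like \<open>l^(-\<gamma>)\<close> with \<open>\<gamma> > 2\<close>, Tannery's theorem makes the total deviation over
  \<open>l \<le> L_N\<close> tend to 0 in mean. It dominates the distance between the risk and its limit up to the
  factor \<open>G\<^sup>2 + 2 \<bar>G\<bar>\<close>, uniformly in \<open>\<alpha>\<close>. The excess of the limit at \<open>(G, \<alpha>)\<close> over its minimum is a sum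
  of squares whose terms for \<open>l = 1, 2\<close> control \<open>G - G\<^sub>0\<close> and \<open>G 2^(-\<alpha>) - G\<^sub>0 2^(-\<alpha>\<^sub>0)\<close>, hence both
  parameters.
\<close>

section \<open>Legendre polynomials\<close>

text \<open>Three obstacles shape the proof. The kernel is known only through a Legendre series
  converging in the L2 sense, so the series cannot be evaluated pointwise; its remainder is
  integrated against a fixed harmonic and estimated in L1, which gives the eigenvalue relation at
  almost every point. The independence of noise and past concerns the sigma-algebras generated by
  the values of the fields, for which a pathwise integral over the sphere need not be measurable;
  each coefficient is therefore replaced by an almost surely equal conditional expectation. Finally,
  the parameter set is not compact: it omits G = 0 and |G| = 1, so a minimizer need not exist, and
  the profile estimate of G ranges over the whole line. Hence the separation estimate is proved for
  every real G, and on the event of small deviation a minimizer over the compact closure is shown to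
  lie in the parameter set itself.\<close>

lemma higher_pderiv_pcompose_translate:
  fixes p :: "real poly"
  shows "(pderiv ^^ j) (pcompose p [:a, 1:]) = pcompose ((pderiv ^^ j) p) [:a, 1:]"
  by (induction j) (simp_all add: pderiv_pcompose pderiv_pCons)

text \<open>Reading Taylor coefficients off a translated polynomial turns orders of vanishing and
  values at the endpoints, as well as Taylor's formula, into statements about coefficients.\<close>

lemma coeff_pcompose_translate:
  fixes p :: "real poly"
  shows "coeff (pcompose p [:a, 1:]) j = poly ((pderiv ^^ j) p) a / fact j"
proof -
  have "poly ((pderiv ^^ j) p) a = poly ((pderiv ^^ j) (pcompose p [:a, 1:])) 0"
    by (simp add: higher_pderiv_pcompose_translate poly_pcompose)
  also have "\<dots> = fact j * coeff (pcompose p [:a, 1:]) j"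
    by (simp add: poly_0_coeff_0 coeff_higher_pderiv pochhammer_fact)
  finally show ?thesis by simp
qed

lemma poly_altdef_le:
  fixes p :: "'a :: comm_semiring_1 poly"
  assumes "degree p \<le> n"
  shows "poly p x = (\<Sum>i\<le>n. coeff p i * x ^ i)"
  unfolding poly_altdef using assms
  by (intro sum.mono_neutral_left) (auto simp: coeff_eq_0)

lemma poly_taylor_sum:
  fixes p :: "real poly"
  assumes "degree p \<le> n"
  shows "poly p (a + h) = (\<Sum>j\<le>n. poly ((pderiv ^^ j) p) a / fact j * h ^ j)"
proof -
  have "poly p (a + h) = poly (pcompose p [:a, 1:]) h"
    by (simp add: poly_pcompose)
  also have "\<dots> = (\<Sum>j\<le>n. coeff (pcompose p [:a, 1:]) j * h ^ j)"
    using assms degree_pcompose_le[of p "[:a, 1:]"] by (intro poly_altdef_le) auto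
  finally show ?thesis by (simp add: coeff_pcompose_translate)
qed

section \<open>Rodrigues' formula, Legendre's equation and endpoint values\<close>

definition legendre_base :: "nat \<Rightarrow> real poly" where
  "legendre_base n = [:-1, 0, 1:] ^ n"

abbreviation legendre_d :: "nat \<Rightarrow> nat \<Rightarrow> real poly" where
  "legendre_d k n \<equiv> (pderiv ^^ k) (legendre n)"

lemma legendre_deriv:
  "legendre_d k n = smult (1 / (2 ^ n * fact n)) ((pderiv ^^ (k + n)) (legendre_base n))"
  by (simp add: legendre_def legendre_base_def higher_pderiv_smult funpow_add)

lemma legendre_base_ode0:
  "[:-1, 0, 1:] * pderiv (legendre_base n) = smult (2 * real n) ([:0, 1:] * legendre_base n)"
proof (cases n)
  case 0
  then show ?thesis by (simp add: legendre_base_def)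
next
  case (Suc m)
  have "pderiv (legendre_base n) = smult (2 * real n) ([:0, 1:] * [:-1, 0, 1:] ^ m)"
    unfolding legendre_base_def Suc pderiv_power_Suc by (simp add: pderiv_pCons mult.commute)
  then have "[:-1, 0, 1:] * pderiv (legendre_base n) = [:-1, 0, 1:] * smult (2 * real n) ([:0, 1:] * [:-1, 0, 1:] ^ m)"
    by simp
  also have "\<dots> = smult (2 * real n) ([:0, 1:] * legendre_base n)"
    unfolding legendre_base_def Suc power_Suc by (simp only: mult_smult_right mult.left_commute)
  finally show ?thesis .
qed

text \<open>This is the first-order equation \<open>legendre_base_ode0\<close> of
  \<open>(x^2 - 1)^n\<close>, differentiated \<open>j + 1\<close> times. With
  \<open>j = k + n\<close> and Rodrigues' formula it becomes the equation of the k-th derivative of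
  the Legendre polynomial.\<close>

lemma poly_legendre_base_ode:
  fixes n j :: nat and x :: real
  defines "W i \<equiv> poly ((pderiv ^^ i) (legendre_base n)) x"
  shows "(x^2 - 1) * W (j + 2) + 2 * (real j + 1) * x * W (j + 1) + real j * (real j + 1) * W j
    = 2 * real n * (x * W (j + 1) + (real j + 1) * W j)"
proof -
  define q t :: "real poly" where "q = [:-1, 0, 1:]" and "t = [:0, 1:]"
  have q: "pderiv q = smult 2 t" "pderiv t = 1" "poly q x = x^2 - 1" "poly t x = x" for x
    by (simp_all add: q_def t_def pderiv_pCons power2_eq_square algebra_simps)
  have "q * (pderiv ^^ (j + 2)) (legendre_base n)
     + smult (2 * (real j + 1)) (t * (pderiv ^^ (j + 1)) (legendre_base n))
     + smult (real j * (real j + 1)) ((pderiv ^^ j) (legendre_base n))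
    = smult (2 * real n) (t * (pderiv ^^ (j + 1)) (legendre_base n) + smult (real j + 1) ((pderiv ^^ j) (legendre_base n)))"
    (is "?L j = ?R j")
  proof (induction j)
    case 0
    have "pderiv (q * pderiv (legendre_base n)) = pderiv (smult (2 * real n) (t * legendre_base n))"
      by (simp only: legendre_base_ode0 q_def t_def)
    then show ?case
      by (simp add: pderiv_mult pderiv_smult q poly_eq_poly_eq_iff[symmetric] fun_eq_iff algebra_simps)
  next
    case (Suc j)
    have "pderiv (?L j) = pderiv (?R j)" using Suc.IH by simp
    then show ?case
      by (simp add: pderiv_mult pderiv_add pderiv_smult q poly_eq_poly_eq_iff[symmetric] fun_eq_iff algebra_simps)
  qed
  from arg_cong[OF this, of "\<lambda>p. poly p x"] show ?thesis
    by (simp add: W_def q algebra_simps)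
qed

lemma legendre_ode:
  fixes n k :: nat and x :: real
  defines "P i \<equiv> poly (legendre_d i n) x"
  shows "(1 - x^2) * P (k + 2) = 2 * (real k + 1) * x * P (k + 1)
           - (real n * (real n + 1) - real k * (real k + 1)) * P k"
proof -
  define c where "c = 1 / (2 ^ n * fact n :: real)"
  define w where "w j = poly ((pderiv ^^ j) (legendre_base n)) x" for j
  have P: "P j = c * w (j + n)" for j by (simp add: P_def legendre_deriv c_def w_def)
  have "(x^2 - 1) * w (k+n+2) + 2 * (real (k+n) + 1) * x * w (k+n+1) + real (k+n) * (real (k+n) + 1) * w (k+n)
    = 2 * real n * (x * w (k+n+1) + (real (k+n) + 1) * w (k+n))"
    unfolding w_def by (rule poly_legendre_base_ode)
  then have "(1 - x^2) * w (k+n+2) = 2 * (real k + 1) * x * w (k+n+1) - (real n * (real n + 1) - real k * (real k + 1)) * w (k+n)"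
    by (simp add: algebra_simps)
  from arg_cong[OF this, of "\<lambda>z. c * z"] show ?thesis by (simp add: P algebra_simps)
qed

text \<open>For c = 1 or c = -1 one has \<open>(X + c)^2 - 1 = X * (X + 2 * c)\<close>, so the base
  has a zero of order n at both endpoints. The zero removes the boundary terms in integrations by
  parts; the cofactor gives the endpoint values.\<close>

lemma legendre_base_translate:
  fixes c :: real
  assumes "c^2 = 1"
  shows "pcompose (legendre_base n) [:c, 1:] = monom 1 n * [:2 * c, 1:] ^ n"
proof -
  have cc: "c * c = 1" using assms by (simp add: power2_eq_square)
  have "pcompose (q ^ n) r = (pcompose q r) ^ n" for q r :: "real poly"
    by (induction n) (simp_all add: pcompose_mult pcompose_1)
  then have "pcompose (legendre_base n) [:c, 1:] = (pcompose [:-1, 0, 1:] [:c, 1:]) ^ n"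
    unfolding legendre_base_def by blast
  also have "pcompose [:-1, 0, 1:] [:c, 1:] = monom 1 1 * [:2 * c, 1:]"
    using cc by (simp add: pcompose_pCons monom_altdef)
  also have "\<dots> ^ n = monom 1 n * [:2 * c, 1:] ^ n"
    by (simp only: power_mult_distrib monom_power) simp
  finally show ?thesis .
qed

lemma poly_legendre_pm1:
  fixes c :: real
  assumes "c^2 = 1"
  shows "poly (legendre n) c = c ^ n"
proof -
  have "coeff (pcompose (legendre_base n) [:c, 1:]) n = coeff ([:2 * c, 1:] ^ n) 0"
    by (simp add: legendre_base_translate[OF assms] coeff_monom_mult)
  also have "\<dots> = (2 * c) ^ n" by (simp add: poly_0_coeff_0[symmetric] poly_power)
  finally show ?thesis using legendre_deriv[of 0 n]
    by (simp add: coeff_pcompose_translate field_simps power_mult_distrib)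
qed

lemma degree_legendre_le: "degree (legendre n) \<le> n"
proof -
  have "degree (legendre_base n) \<le> degree [:-1, 0, 1::real:] * n"
    unfolding legendre_base_def by (rule degree_power_le)
  then have "degree (legendre_base n) \<le> 2 * n" by simp
  then show ?thesis using legendre_deriv[of 0 n]
    by (auto simp: degree_higher_pderiv intro: order.trans[OF degree_smult_le])
qed

lemma legendre_deriv_eq_0:
  assumes "n < k" shows "legendre_d k n = 0"
proof -
  have "degree (legendre_d (k - 1) n) = 0"
    using degree_legendre_le[of n] assms by (simp add: degree_higher_pderiv)
  then have "pderiv (legendre_d (k - 1) n) = 0" by (simp add: pderiv_eq_0_iff)
  then show ?thesis using assms by (cases k) auto
qed

lemma legendre_deriv_at_1:
  "2 * (real k + 1) * poly (legendre_d (k + 1) n) 1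
     = (real n * (real n + 1) - real k * (real k + 1)) * poly (legendre_d k n) 1"
  using legendre_ode[of 1 k n] by simp

text \<open>At 1 the second-order term of \<open>legendre_ode\<close> drops out, which leaves a
  recursion in \<open>k\<close> with a positive factor as long as \<open>k < n\<close>. Positivity
  later allows division by this value.\<close>

lemma legendre_deriv_at_1_pos:
  "k \<le> n \<Longrightarrow> poly (legendre_d k n) 1 > 0"
proof (induction k)
  case 0 then show ?case by (simp add: poly_legendre_pm1)
next
  case (Suc k)
  have "real k * (real k + 1) < real n * (real n + 1)"
    using Suc.prems by (intro mult_strict_mono) auto
  then have "(real n * (real n + 1) - real k * (real k + 1)) * poly (legendre_d k n) 1 > 0"
    using Suc by (intro mult_pos_pos) auto
  then have "0 < 2 * (real k + 1) * poly (legendre_d (k + 1) n) 1"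
    by (simp only: legendre_deriv_at_1)
  then show ?case by (simp add: zero_less_mult_iff)
qed

text \<open>The integral over \<open>[-1, 1]\<close>, as a functional on polynomials.\<close>

definition poly_int :: "real poly \<Rightarrow> real" where
  "poly_int p = (\<Sum>i\<le>degree p. coeff p i * (1 - (-1) ^ (i + 1)) / (real i + 1))"

lemma poly_int_eq:
  assumes "degree p \<le> n"
  shows "poly_int p = (\<Sum>i\<le>n. coeff p i * (1 - (-1) ^ (i + 1)) / (real i + 1))"
  unfolding poly_int_def using assms
  by (intro sum.mono_neutral_left) (auto simp: coeff_eq_0)

lemma poly_int_add: "poly_int (p + q) = poly_int p + poly_int q"
proof -
  let ?n = "max (degree p) (degree q)"
  have "poly_int (p + q) = (\<Sum>i\<le>?n. coeff (p + q) i * (1 - (-1) ^ (i + 1)) / (real i + 1))"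
    by (intro poly_int_eq degree_add_le) auto
  also have "\<dots> = poly_int p + poly_int q"
    by (subst (1 2) poly_int_eq[of _ ?n]) (auto simp: sum.distrib[symmetric] algebra_simps add_divide_distrib diff_divide_distrib)
  finally show ?thesis .
qed

lemma poly_int_smult: "poly_int (smult c p) = c * poly_int p"
  using poly_int_eq[of "smult c p" "degree p"]
  by (simp add: poly_int_def sum_distrib_left algebra_simps)

lemma poly_int_pderiv: "poly_int (pderiv p) = poly p 1 - poly p (-1)"
proof -
  have "poly_int (pderiv p) = (\<Sum>i\<le>degree p. coeff (pderiv p) i * (1 - (-1) ^ (i + 1)) / (real i + 1))"
    by (rule poly_int_eq) (simp add: degree_pderiv)
  also have "\<dots> = (\<Sum>i\<le>degree p. coeff p (Suc i) * (1 - (-1) ^ Suc i))"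
    by (intro sum.cong refl) (simp add: coeff_pderiv field_simps)
  also have "\<dots> = (\<Sum>i\<le>Suc (degree p). coeff p i * (1 - (-1) ^ i))"
    by (subst sum.atMost_Suc_shift) simp
  also have "\<dots> = poly p 1 - poly p (-1)"
    by (subst (1 2) poly_altdef_le[of p "Suc (degree p)"]) (simp_all add: algebra_simps sum_subtractf)
  finally show ?thesis .
qed

section \<open>Orthogonality and norms of the derivatives of Legendre polynomials\<close>

lemma poly_int_by_parts:
  assumes "poly (p * q) 1 = poly (p * q) (-1)"
  shows "poly_int (pderiv p * q) = - poly_int (p * pderiv q)"
  using poly_int_pderiv[of "p * q"] assms by (simp add: pderiv_mult poly_int_add mult.commute)

lemma legendre_base_deriv_pm1:
  assumes "j < n" "c^2 = 1"
  shows "poly ((pderiv ^^ j) (legendre_base n)) c = 0"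
proof -
  have "coeff (pcompose (legendre_base n) [:c, 1:]) j = 0"
    using assms by (simp add: legendre_base_translate coeff_monom_mult)
  then show ?thesis by (simp add: coeff_pcompose_translate)
qed

text \<open>Integrating by parts n times moves all derivatives of Rodrigues' formula onto
  \<open>q\<close>, whose n-th derivative is zero; the boundary terms vanish because the base has
  zeros of order n at both endpoints.\<close>

lemma poly_int_legendre_orthogonal:
  assumes "degree q < n"
  shows "poly_int (legendre n * q) = 0"
proof -
  have *: "poly_int ((pderiv ^^ j) (legendre_base n) * r) = (-1) ^ j * poly_int (legendre_base n * (pderiv ^^ j) r)"
    if "j \<le> n" for j r
    using that
  proof (induction j arbitrary: r)
    case (Suc j)
    have "poly_int (pderiv ((pderiv ^^ j) (legendre_base n)) * r) = - poly_int ((pderiv ^^ j) (legendre_base n) * pderiv r)"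
      using Suc.prems by (intro poly_int_by_parts) (simp add: legendre_base_deriv_pm1)
    then show ?case using Suc.IH[of "pderiv r"] Suc.prems by (simp add: funpow_swap1)
  qed simp
  have "degree ((pderiv ^^ (n - 1)) q) = 0" using assms by (simp add: degree_higher_pderiv)
  then have "pderiv ((pderiv ^^ (n - 1)) q) = 0" by (simp add: pderiv_eq_0_iff)
  then have "(pderiv ^^ n) q = 0" using assms by (cases n) auto
  then have "poly_int ((pderiv ^^ n) (legendre_base n) * q) = 0"
    using *[of n q] by (simp add: poly_int_def)
  then show ?thesis using legendre_deriv[of 0 n] by (simp add: poly_int_smult)
qed

text \<open>The leading terms cancel in \<open>r = x P' - n P\<close>, so \<open>r\<close> has
  degree below n and is orthogonal to P. Integrating \<open>(x P^2)' = (2 n + 1) P^2 + 2 P r\<close>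
  then leaves the boundary value 2, since P is 1 or -1 at the endpoints.\<close>

lemma poly_int_legendre_sq: "poly_int (legendre n * legendre n) = 2 / (2 * real n + 1)"
proof -
  let ?P = "legendre n"
  define r where "r = [:0, 1:] * pderiv ?P - smult (real n) ?P"
  have r: "poly_int (?P * r) = 0"
  proof (cases "n = 0")
    case True
    then show ?thesis by (simp add: r_def legendre_def poly_int_def)
  next
    case False
    have "degree r < n"
    proof (rule degree_lessI)
      show "\<forall>k\<ge>n. coeff r k = 0"
      proof safe
        fix k assume "n \<le> k"
        then have "coeff ?P k = 0 \<or> k = n" using degree_legendre_le[of n] by (auto simp: coeff_eq_0)
        then show "coeff r k = 0"
          using False \<open>n \<le> k\<close> by (cases k) (auto simp: r_def coeff_pderiv)
      qed
    qed (use False in auto)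
    then show ?thesis by (rule poly_int_legendre_orthogonal)
  qed
  have "poly_int (pderiv ([:0, 1:] * (?P * ?P))) = 2"
    by (subst poly_int_pderiv) (simp add: poly_legendre_pm1 flip: power_mult_distrib)
  moreover have "pderiv ([:0, 1:] * (?P * ?P)) = smult (2 * real n + 1) (?P * ?P) + smult 2 (?P * r)"
    by (simp add: r_def pderiv_mult pderiv_pCons poly_eq_poly_eq_iff[symmetric] fun_eq_iff algebra_simps)
  ultimately show ?thesis using r by (simp add: poly_int_add poly_int_smult field_simps)
qed

text \<open>In self-adjoint form \<open>legendre_ode\<close> says that the derivative of
  \<open>(1 - x^2)^(k+1) P_l^(k+1)\<close> is a constant multiple of
  \<open>(1 - x^2)^k P_l^(k)\<close>; one integration by parts, with the weight vanishing at both
  endpoints, does the rest.\<close>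

lemma poly_int_assoc_legendre_Suc:
  "poly_int ([:1, 0, -1:] ^ Suc k * (pderiv ^^ Suc k) (legendre l) * (pderiv ^^ Suc k) (legendre n))
    = (real l * (real l + 1) - real k * (real k + 1)) *
      poly_int ([:1, 0, -1:] ^ k * legendre_d k l * legendre_d k n)"
proof -
  let ?D = "\<lambda>j n. legendre_d j n"
  let ?c = "real l * (real l + 1) - real k * (real k + 1)"
  define q t :: "real poly" where "q = [:1, 0, -1:]" and "t = [:0, 1:]"
  have q: "pderiv q = smult (-2) t" "poly q x = 1 - x^2" "poly t x = x" for x
    by (simp_all add: q_def t_def pderiv_pCons power2_eq_square algebra_simps)
  have "pderiv (q ^ Suc k * ?D (Suc k) l) = smult (- ?c) (q ^ k * ?D k l)"
  proof (rule poly_eq_poly_eq_iff[THEN iffD1], rule ext)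
    fix x :: real
    have "poly (pderiv (q ^ Suc k * ?D (Suc k) l)) x =
       (1 - x^2) ^ k * ((1 - x^2) * poly (?D (k + 2) l) x - 2 * (real k + 1) * x * poly (?D (k + 1) l) x)"
      unfolding pderiv_mult pderiv_power_Suc by (simp add: q algebra_simps)
    also have "\<dots> = poly (smult (- ?c) (q ^ k * ?D k l)) x"
      unfolding legendre_ode by (simp add: q algebra_simps)
    finally show "poly (pderiv (q ^ Suc k * ?D (Suc k) l)) x = poly (smult (- ?c) (q ^ k * ?D k l)) x" .
  qed
  then have "poly_int (pderiv (q ^ Suc k * ?D (Suc k) l) * ?D k n) = - ?c * poly_int (q ^ k * ?D k l * ?D k n)"
    by (simp only: mult_smult_left poly_int_smult)
  moreover have "poly_int (pderiv (q ^ Suc k * ?D (Suc k) l) * ?D k n)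
     = - poly_int (q ^ Suc k * ?D (Suc k) l * pderiv (?D k n))"
    by (rule poly_int_by_parts) (simp add: q(2))
  ultimately show ?thesis unfolding q_def[symmetric] by (simp add: algebra_simps)
qed

lemma poly_int_assoc_legendre_neq:
  assumes "l \<noteq> n"
  shows "poly_int ([:1, 0, -1:] ^ k * legendre_d k l * legendre_d k n) = 0"
proof (induction k)
  case 0
  consider "degree (legendre l) < n" | "degree (legendre n) < l"
    using assms degree_legendre_le[of n] degree_legendre_le[of l] by linarith
  then show ?case
    using poly_int_legendre_orthogonal[of "legendre l" n] poly_int_legendre_orthogonal[of "legendre n" l]
    by cases (simp_all add: mult.commute)
next
  case (Suc k)
  then show ?case by (simp only: poly_int_assoc_legendre_Suc mult_zero_right)
qed

text \<open>The factor gained in passing from k to k + 1 is the one in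
  \<open>legendre_deriv_at_1\<close>, so the norm can be expressed by the value at 1 instead of a
  quotient of factorials. That value cancels in \<open>poly_int_legendre_avg\<close>.\<close>

lemma poly_int_assoc_legendre_sq:
  "poly_int ([:1, 0, -1:] ^ k * legendre_d k n * legendre_d k n)
    = 2 / (2 * real n + 1) * (2 ^ k * fact k) * poly (legendre_d k n) 1"
proof (induction k)
  case 0
  show ?case by (simp add: poly_int_legendre_sq poly_legendre_pm1)
next
  case (Suc k)
  have "2 / (2 * real n + 1) * (2 ^ Suc k * fact (Suc k)) * poly ((pderiv ^^ Suc k) (legendre n)) 1
    = 2 / (2 * real n + 1) * (2 ^ k * fact k) * (2 * (real k + 1) * poly (legendre_d (k + 1) n) 1)"
    by (simp add: algebra_simps)
  then show ?case unfolding poly_int_assoc_legendre_Suc Suc legendre_deriv_at_1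
    by (simp only: mult.assoc mult.left_commute)
qed

section \<open>The Funk--Hecke identity\<close>

text \<open>
  The Fourier coefficient of order \<open>k\<close> of \<open>P_n (u v + w cos x)\<close>, where
  \<open>w\<^sup>2 = (1 - u\<^sup>2) (1 - v\<^sup>2)\<close>, is obtained from Taylor's formula around \<open>u v\<close>; up to the factor
  \<open>w^k\<close> it is the polynomial in \<open>u\<close> below. It solves the Gegenbauer equation of \<open>P_n^(k)\<close>,
  whose polynomial solutions are determined by their value at 1; this replaces the addition theorem.
\<close>

definition legendre_avg :: "nat \<Rightarrow> nat \<Rightarrow> real \<Rightarrow> real poly" where
  "legendre_avg k n v = (\<Sum>i\<le>n. smult ((1 - v^2) ^ i / (4 ^ i * fact i * fact (k + i)))
     (pcompose (legendre_d (k + 2 * i) n) [:0, v:] * [:1, 0, -1:] ^ i))"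

lemma poly_legendre_avg:
  "poly (legendre_avg k n v) u = (\<Sum>i\<le>n. poly (legendre_d (k + 2 * i) n) (u * v)
      * ((1 - u^2) * (1 - v^2)) ^ i / (4 ^ i * fact i * fact (k + i)))"
  unfolding legendre_avg_def poly_sum
  by (intro sum.cong refl) (simp add: poly_pcompose power2_eq_square power_mult_distrib mult_ac)

section \<open>Gegenbauer's equation and the averaged Legendre polynomial\<close>

definition gegenbauer_op :: "nat \<Rightarrow> nat \<Rightarrow> real poly \<Rightarrow> real poly" where
  "gegenbauer_op k n f = [:1, 0, -1:] * pderiv (pderiv f) - smult (2 * (real k + 1)) ([:0, 1:] * pderiv f)
     + smult (real n * (real n + 1) - real k * (real k + 1)) f"

lemma gegenbauer_op_add: "gegenbauer_op k n (f + g) = gegenbauer_op k n f + gegenbauer_op k n g"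
  unfolding gegenbauer_op_def pderiv_add distrib_left smult_add_right by (simp only: algebra_simps)

lemma gegenbauer_op_smult: "gegenbauer_op k n (smult c f) = smult c (gegenbauer_op k n f)"
  unfolding gegenbauer_op_def pderiv_smult mult_smult_right smult_add_right smult_diff_right
  by (simp only: smult_smult mult.commute)

lemma gegenbauer_op_0: "gegenbauer_op k n 0 = 0"
  by (simp add: gegenbauer_op_def)

lemma gegenbauer_op_sum: "gegenbauer_op k n (\<Sum>i\<in>A. f i) = (\<Sum>i\<in>A. gegenbauer_op k n (f i))"
  by (induction A rule: infinite_finite_induct) (simp_all add: gegenbauer_op_add gegenbauer_op_0)

lemma gegenbauer_op_legendre: "gegenbauer_op k n (legendre_d k n) = 0"
proof (rule poly_eq_poly_eq_iff[THEN iffD1], rule ext)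
  fix x :: real
  show "poly (gegenbauer_op k n (legendre_d k n)) x = poly 0 x"
    using legendre_ode[of x k n] by (simp add: gegenbauer_op_def power2_eq_square algebra_simps)
qed

text \<open>The algebra behind the case \<open>i \<ge> 2\<close> of the next lemma: \<open>a\<close>
  is \<open>1 - u^2\<close>, \<open>S\<close> is its power of exponent i - 2, and
  \<open>g0, g1, g2\<close> are consecutive derivatives of the Legendre polynomial at
  \<open>u * v\<close>. The last bracket on the right is the Gegenbauer equation of order k + 2i at
  \<open>u * v\<close>, which vanishes in the application.\<close>

lemma gegenbauer_identity:
  fixes a u v S g0 g1 g2 i k n :: real
  assumes "u^2 = 1 - a"
  shows "a * (v * (v * (g2 * (a^2 * S)) - 2 * i * (g1 * (a * S * u)))
          - 2 * i * (v * (g1 * (a * S * u)) + g0 * (a * S - 2 * (i - 1) * (S * (u * u)))))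
   - 2 * (k+1) * u * (v * (g1 * (a^2 * S)) - 2 * i * (g0 * (a * S * u))) + (n*(n+1) - k * (k+1)) * (g0 * (a^2 * S))
 = 4 * i * (i + k) * g0 * (a * S) - (1 - v^2) * g2 * (a^2 * S) + ((1 - u^2 * v^2) * g2 - 2 * (k + 2 * i + 1) * (u * v) * g1
           + (n*(n+1) - (k + 2 * i) * (k + 2 * i + 1)) * g0) * (a^2*S)"
proof -
  have a: "a = 1 - u^2" using assms by simp
  show ?thesis unfolding a by algebra
qed

text \<open>The two parts of the right-hand side have the same shape for neighbouring values of
  \<open>i\<close>; this makes the sum defining \<open>legendre_avg\<close> telescope under the
  operator.\<close>

lemma gegenbauer_op_term:
  fixes k n i :: nat and u v :: real
  defines "R \<equiv> \<lambda>j. legendre_d (k + j) n"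
  shows "poly (gegenbauer_op k n (pcompose (R (2 * i)) [:0, v:] * [:1, 0, -1:] ^ i)) u
    = 4 * real i * (real i + real k) * poly (R (2 * i)) (u * v) * (1 - u^2) ^ (i - 1)
      - (1 - v^2) * poly (R (2 * i + 2)) (u * v) * (1 - u^2) ^ i"
proof -
  define s t :: "real poly" where "s = [:1, 0, -1:]" and "t = [:0, 1:]"
  define G where "G j = pcompose (R j) [:0, v:]" for j
  have s: "pderiv s = smult (-2) t" "pderiv t = 1" "poly s x = 1 - x^2" "poly t x = x" for x
    by (simp_all add: s_def t_def pderiv_pCons power2_eq_square algebra_simps)
  have dG: "pderiv (G j) = smult v (G (Suc j))" for j
    by (simp add: G_def R_def pderiv_pcompose pderiv_pCons)
  have pG: "poly (G j) u = poly (R j) (u * v)" for j by (simp add: G_def poly_pcompose mult.commute)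
  define g0 g1 g2 where "g0 = poly (R (2 * i)) (u * v)" and "g1 = poly (R (2 * i + 1)) (u * v)"
    and "g2 = poly (R (2 * i + 2)) (u * v)"
  have ode: "(1 - u^2 * v^2) * g2 = 2 * (real k + 2 * real i + 1) * (u * v) * g1
           - (real n * (real n + 1) - (real k + 2 * real i) * (real k + 2 * real i + 1)) * g0"
    using legendre_ode[of "u * v" "k + 2 * i" n] unfolding g0_def g1_def g2_def R_def
    by (simp add: power_mult_distrib algebra_simps)
  \<comment> \<open>\<open>X\<close> is zero by the differential equation, but keeping it as a
    symbol makes the claim with the correction term \<open>X\<close> a plain polynomial
    identity.\<close>
  define X where "X = (1 - u^2 * v^2) * g2 - 2 * (real k + 2 * real i + 1) * (u * v) * g1
           + (real n * (real n + 1) - (real k + 2 * real i) * (real k + 2 * real i + 1)) * g0"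
  have X: "X = 0" using ode by (simp add: X_def)
  have op: "poly (gegenbauer_op k n f) u = (1 - u^2) * poly (pderiv (pderiv f)) u
     - 2 * (real k + 1) * u * poly (pderiv f) u + (real n * (real n + 1) - real k * (real k + 1)) * poly f u" for f
    unfolding gegenbauer_op_def s_def[symmetric] t_def[symmetric] by (simp add: s)
  have "poly (gegenbauer_op k n (G (2 * i) * s ^ i)) u
    = 4 * real i * (real i + real k) * g0 * (1 - u^2) ^ (i - 1) - (1 - v^2) * g2 * (1 - u^2) ^ i"
    (is "?lhs = ?rhs")
  proof -
    let ?with_X = "?lhs = ?rhs + X * (1 - u^2) ^ i"
    \<comment> \<open>Two differentiations of \<open>s ^ i\<close> lower the exponent by 2, so the
      two values with truncated exponents are treated apart.\<close>
    consider "i = 0" | "i = 1" | m where "i = Suc (Suc m)" by (metis One_nat_def nat.exhaust)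
    then show ?thesis
    proof cases
      case 1
      have "poly (gegenbauer_op k n (G (2 * i) * s ^ i)) u =
        4 * real i * (real i + real k) * g0 * (1 - u^2) ^ (i - 1) - (1 - v^2) * g2 * (1 - u^2) ^ i + X"
        unfolding op X_def
        by (simp add: 1 g0_def g1_def g2_def dG pG pderiv_smult numeral_2_eq_2 algebra_simps)
      then show ?thesis by (simp add: X)
    next
      case 2
      have si: "s ^ i = s" by (simp add: 2)
      have d1: "pderiv (G (2 * i) * s) = smult v (G (2 * i + 1) * s) + smult (- 2) (G (2 * i) * t)"
        unfolding pderiv_mult s(1) dG by (simp add: mult.commute)
      have pd: "poly (pderiv (G (2 * i) * s ^ i)) u = v * (g1 * (1 - u^2)) - 2 * (g0 * u)"
        unfolding si d1 by (simp add: pG s g0_def g1_def)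
      have pdd: "poly (pderiv (pderiv (G (2 * i) * s ^ i))) u
        = v * (v * (g2 * (1 - u^2)) - 2 * (g1 * u)) - 2 * (v * (g1 * u) + g0)"
        unfolding si d1 pderiv_add pderiv_smult pderiv_mult dG s(1,2)
        by (simp add: pG s g0_def g1_def g2_def algebra_simps)
      have p0: "poly (G (2 * i) * s ^ i) u = g0 * (1 - u^2)" "real i = 1" "(1 - u^2) ^ i = 1 - u^2" "(1 - u^2) ^ (i - 1) = 1"
        by (simp_all add: pG s g0_def 2)
      have ?with_X
        unfolding op pd pdd X_def p0 by algebra
      then show ?thesis by (simp add: X)
    next
      case 3
      define S a where "S = (1 - u^2) ^ m" and "a = 1 - u^2"
      have a: "u * u = 1 - a" by (simp add: a_def power2_eq_square)
      have ds: "pderiv (s ^ i) = smult (- 2 * real i) (s ^ Suc m * t)"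
        unfolding 3 pderiv_power_Suc[of s "Suc m"] s
        by (simp add: poly_eq_poly_eq_iff[symmetric] fun_eq_iff algebra_simps)
      have dsm: "pderiv (s ^ Suc m) = smult (- 2 * (real i - 1)) (s ^ m * t)"
        unfolding 3 pderiv_power_Suc[of s m] s
        by (simp add: poly_eq_poly_eq_iff[symmetric] fun_eq_iff algebra_simps)
      have d1: "pderiv (G (2 * i) * s ^ i) = smult v (G (2 * i + 1) * s ^ i) + smult (- 2 * real i) (G (2 * i) * (s ^ Suc m * t))"
        unfolding pderiv_mult ds dG by (simp add: mult.commute)
      have pd: "poly (pderiv (G (2 * i) * s ^ i)) u = v * (g1 * (a^2 * S)) - 2 * real i * (g0 * (a * S * u))"
        unfolding d1 by (simp add: pG s g0_def g1_def S_def a_def 3 power2_eq_square algebra_simps)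
      have pdd: "poly (pderiv (pderiv (G (2 * i) * s ^ i))) u
        = v * (v * (g2 * (a^2 * S)) - 2 * real i * (g1 * (a * S * u)))
          - 2 * real i * (v * (g1 * (a * S * u)) + g0 * (a * S - 2 * (real i - 1) * (S * (u * u))))"
        unfolding d1 pderiv_add pderiv_smult pderiv_mult ds dsm dG s(2)
        by (simp add: pG s g0_def g1_def g2_def S_def a_def 3 power2_eq_square algebra_simps)
      have p0: "poly (G (2 * i) * s ^ i) u = g0 * (a^2 * S)" "a ^ i = a^2 * S" "a ^ (i - 1) = a * S"
        by (simp_all add: pG s g0_def S_def a_def 3 power2_eq_square)
      have ?with_X
        unfolding op pd pdd X_def a_def[symmetric] p0 by (rule gegenbauer_identity) (simp add: a_def)
      then show ?thesis by (simp add: X)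
    qed
  qed
  then show ?thesis unfolding G_def s_def g0_def g2_def .
qed

lemma gegenbauer_op_legendre_avg: "gegenbauer_op k n (legendre_avg k n v) = 0"
proof (rule poly_eq_poly_eq_iff[THEN iffD1], rule ext)
  fix u :: real
  define R where "R j = legendre_d (k + j) n" for j
  \<comment> \<open>\<open>h i\<close> is the second part of the image of the i-th summand. The
    factor \<open>4 i (i + k)\<close> in the first part is the ratio of successive denominators
    \<open>4^i i! (k+i)!\<close>, so that part is \<open>h (i - 1)\<close>, and it is zero for
    \<open>i = 0\<close>.\<close>
  define h where "h i = (1 - v^2) ^ (i + 1) / (4 ^ i * fact i * fact (k + i)) * poly (R (2 * i + 2)) (u * v) * (1 - u^2) ^ i" for i
  have "poly (gegenbauer_op k n (legendre_avg k n v)) u =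
     (\<Sum>i\<le>n. (1 - v^2) ^ i / (4 ^ i * fact i * fact (k + i)) *
        (4 * real i * (real i + real k) * poly (R (2 * i)) (u * v) * (1 - u^2) ^ (i - 1)
      - (1 - v^2) * poly (R (2 * i + 2)) (u * v) * (1 - u^2) ^ i))"
    unfolding legendre_avg_def gegenbauer_op_sum gegenbauer_op_smult poly_sum poly_smult gegenbauer_op_term R_def ..
  also have "\<dots> = (\<Sum>i\<le>n. (if i = 0 then 0 else h (i - 1)) - h i)"
  proof (intro sum.cong refl, goal_cases)
    case (1 i)
    show ?case
    proof (cases i)
      case 0
      then show ?thesis by (simp add: h_def numeral_2_eq_2)
    next
      case (Suc m)
      define a c P S where "a = real i" and "c = real i + real k"
        and "P = poly (R (2 * m + 2)) (u * v)" and "S = (1 - u^2) ^ m"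
      have pos: "a > 0" "c > 0" by (simp_all add: a_def c_def Suc)
      have f: "fact (k + i) = c * fact (k + m)" "fact i = a * fact m"
        by (simp_all add: a_def c_def Suc)
      have "(1 - v^2) ^ i / (4 ^ i * fact i * fact (k + i)) * (4 * a * c * P * S)
        = (1 - v^2) ^ (m + 1) / (4 ^ m * fact m * fact (k + m)) * P * S"
        unfolding f using pos by (simp add: Suc)
      then have "(1 - v^2) ^ i / (4 ^ i * fact i * fact (k + i)) *
        (4 * real i * (real i + real k) * poly (R (2 * i)) (u * v) * (1 - u^2) ^ (i - 1)) = h m"
        unfolding h_def a_def c_def P_def S_def by (simp add: Suc)
      then show ?thesis by (simp add: Suc h_def right_diff_distrib)
    qed
  qed
  also have "\<dots> = - h n"
  proof (induction n)
    case (Suc n) then show ?case by simp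
  qed simp
  also have "h n = 0" unfolding h_def R_def by (subst legendre_deriv_eq_0) simp_all
  finally show "poly (gegenbauer_op k n (legendre_avg k n v)) u = poly 0 u" by simp
qed

text \<open>The point 1 is singular for the equation: there its j-th derivative loses the top term
  and expresses the derivative of order j + 1 through the one of order j, the factor
  \<open>k + j + 1\<close> being nonzero. So all Taylor coefficients at 1 vanish; the constant
  \<open>c\<close> changes with j, but only its existence matters.\<close>

lemma gegenbauer_op_unique:
  assumes "gegenbauer_op k n f = 0" and "poly f 1 = 0"
  shows "f = 0"
proof -
  define s t :: "real poly" where "s = [:1, 0, -1:]" and "t = [:0, 1:]"
  have s: "pderiv s = smult (-2) t" "pderiv t = 1" "poly s x = 1 - x^2" "poly t x = x" for x
    by (simp_all add: s_def t_def pderiv_pCons power2_eq_square algebra_simps)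
  have ode: "\<exists>c. s * (pderiv ^^ (j + 2)) f - smult (2 * (real k + real j + 1)) (t * (pderiv ^^ (j + 1)) f) + smult c ((pderiv ^^ j) f) = 0" for j
  proof (induction j)
    case 0
    show ?case using assms(1) unfolding gegenbauer_op_def s_def[symmetric] t_def[symmetric] by auto
  next
    case (Suc j)
    then obtain c where c: "s * (pderiv ^^ (j + 2)) f - smult (2 * (real k + real j + 1)) (t * (pderiv ^^ (j + 1)) f) + smult c ((pderiv ^^ j) f) = 0"
      by blast
    from arg_cong[OF this, of pderiv]
    have "s * (pderiv ^^ (Suc j + 2)) f - smult (2 * (real k + real (Suc j) + 1)) (t * (pderiv ^^ (Suc j + 1)) f)
       + smult (c - 2 * (real k + real j + 1)) ((pderiv ^^ Suc j) f) = 0"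
      by (simp add: pderiv_mult pderiv_add pderiv_diff pderiv_smult s poly_eq_poly_eq_iff[symmetric] fun_eq_iff algebra_simps)
    then show ?case by blast
  qed
  have "poly ((pderiv ^^ j) f) 1 = 0" for j
  proof (induction j)
    case 0 show ?case using assms by simp
  next
    case (Suc j)
    obtain c where "s * (pderiv ^^ (j + 2)) f - smult (2 * (real k + real j + 1)) (t * (pderiv ^^ (j + 1)) f) + smult c ((pderiv ^^ j) f) = 0"
      using ode by blast
    from arg_cong[OF this, of "\<lambda>p. poly p 1"] Suc
    have "(real k + real j + 1) * poly ((pderiv ^^ (j + 1)) f) 1 = 0" by (simp add: s)
    then show ?case by (simp add: add_nonneg_eq_0_iff)
  qed
  then have "poly f (1 + h) = 0" for h
    using poly_taylor_sum[of f "degree f" 1 h] by simp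
  from this[of "x - 1" for x] have "poly f x = 0" for x by simp
  then show ?thesis by (simp add: poly_eq_poly_eq_iff[symmetric] fun_eq_iff)
qed

text \<open>Both sides solve the Gegenbauer equation and agree at 1, where the powers of
  \<open>1 - u^2\<close> kill all summands except \<open>i = 0\<close>. Multiplying by
  \<open>P_n^(k)(1)\<close> instead of dividing keeps the identity valid when this value is
  zero.\<close>

lemma legendre_avg_eq:
  "smult (poly (legendre_d k n) 1) (legendre_avg k n v)
     = smult (poly (legendre_d k n) v / fact k) (legendre_d k n)"
proof -
  let ?D = "legendre_d k n"
  have "poly (legendre_avg k n v) 1 = (\<Sum>i\<in>{0}. poly (legendre_d (k + 2 * i) n) (1 * v)
      * ((1 - 1^2) * (1 - v^2)) ^ i / (4 ^ i * fact i * fact (k + i)))"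
    unfolding poly_legendre_avg by (intro sum.mono_neutral_right) auto
  then have "poly (legendre_avg k n v) 1 = poly ?D v / fact k" by simp
  then have "poly (smult (poly ?D 1) (legendre_avg k n v) + smult (- (poly ?D v / fact k)) ?D) 1 = 0"
    unfolding poly_add poly_smult by (metis add.right_inverse mult.commute mult_minus_left)
  moreover have "gegenbauer_op k n (smult (poly ?D 1) (legendre_avg k n v) + smult (- (poly ?D v / fact k)) ?D) = 0"
    unfolding gegenbauer_op_add gegenbauer_op_smult gegenbauer_op_legendre_avg gegenbauer_op_legendre by simp
  ultimately have "smult (poly ?D 1) (legendre_avg k n v) + smult (- (poly ?D v / fact k)) ?D = 0"
    by (rule gegenbauer_op_unique[rotated])
  then have "smult (poly ?D 1) (legendre_avg k n v) = - smult (- (poly ?D v / fact k)) ?D"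
    by (rule eq_neg_iff_add_eq_0[THEN iffD2])
  then show ?thesis by (simp only: smult_minus_left minus_minus)
qed

lemma poly_int_legendre_avg:
  assumes "k \<le> l"
  shows "poly_int ([:1, 0, -1:] ^ k * legendre_d k l * legendre_avg k n v)
    = (if n = l then 2 ^ (k + 1) / (2 * real l + 1) * poly (legendre_d k l) v else 0)"
proof (cases "k \<le> n")
  case False
  \<comment> \<open>For \<open>k > n\<close> the value at 1 is zero and cannot be cancelled, but the
    average itself vanishes.\<close>
  then have "legendre_avg k n v = 0" by (simp add: legendre_avg_def legendre_deriv_eq_0)
  then show ?thesis using False assms by (simp add: poly_int_def)
next
  case True
  let ?D = "\<lambda>n. legendre_d k n"
  let ?I = "poly_int ([:1, 0, -1:] ^ k * ?D l * ?D n)"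
  have pos: "poly (?D n) 1 > 0" using True by (rule legendre_deriv_at_1_pos)
  have "poly (?D n) 1 * poly_int ([:1, 0, -1:] ^ k * ?D l * legendre_avg k n v)
      = poly_int ([:1, 0, -1:] ^ k * ?D l * smult (poly (?D n) 1) (legendre_avg k n v))"
    by (simp only: mult_smult_right poly_int_smult)
  also have "\<dots> = poly (?D n) v / fact k * ?I"
    by (simp only: legendre_avg_eq mult_smult_right poly_int_smult)
  also have "?I = (if n = l then 2 / (2 * real n + 1) * (2 ^ k * fact k) * poly (?D n) 1 else 0)"
    using poly_int_assoc_legendre_neq[of l n k] poly_int_assoc_legendre_sq[of k n] by auto
  also have "poly (?D n) v / fact k * (if n = l then 2 / (2 * real n + 1) * (2 ^ k * fact k) * poly (?D n) 1 else 0)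
     = poly (?D n) 1 * (if n = l then 2 ^ (k + 1) / (2 * real l + 1) * poly (?D l) v else 0)"
    by (auto simp: field_simps)
  finally show ?thesis using pos by (subst (asm) mult_left_cancel) auto
qed

section \<open>Fourier coefficients in the longitude\<close>

lemma cis_integral:
  fixes n :: int
  shows "(LINT x:{0..2*pi}|lborel. cis (of_int n * x)) = (if n = 0 then of_real (2 * pi) else 0)"
proof (cases "n = 0")
  case True
  then show ?thesis by (simp add: set_lebesgue_integral_def of_real_def)
next
  case False
  define F where "F x = cis (of_int n * x) / (\<i> * of_int n)" for x
  have "((\<lambda>z. exp (\<i> * of_int n * z) / (\<i> * of_int n)) has_field_derivative exp (\<i> * of_int n * z)) (at z within A)" for z A
    using False by (auto intro!: derivative_eq_intros)
  from has_vector_derivative_real_field[OF this]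
  have "(F has_vector_derivative cis (of_int n * x)) (at x within {0..2*pi})" for x
    by (simp add: F_def[abs_def] cis_conv_exp mult.assoc)
  then have "(LINT x:{0..2*pi}|lborel. cis (of_int n * x)) = F (2 * pi) - F 0"
    unfolding set_lebesgue_integral_def
    by (intro integral_FTC_Icc) (auto intro!: continuous_intros)
  also have "cis (of_int n * (2 * pi)) = 1"
    by (metis cis_multiple_2pi Ints_of_int mult.commute)
  then have "F (2 * pi) - F 0 = 0" by (simp add: F_def)
  finally show ?thesis using False by simp
qed

lemma cos_power_eq_cis_sum:
  "of_real (cos x) ^ j = (\<Sum>r\<le>j. of_nat (j choose r) * cis ((2 * real r - real j) * x)) / (2::complex) ^ j"
proof -
  have "of_real (cos x) = (cis x + cis (- x)) / 2"
    by (simp add: complex_eq_iff)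
  then have "of_real (cos x) ^ j = (cis x + cis (- x)) ^ j / 2 ^ j"
    by (simp only: power_divide)
  also have "(cis x + cis (- x)) ^ j = (\<Sum>r\<le>j. of_nat (j choose r) * cis x ^ r * cis (- x) ^ (j - r))"
    by (rule binomial_ring)
  also have "\<dots> = (\<Sum>r\<le>j. of_nat (j choose r) * cis ((2 * real r - real j) * x))"
  proof (intro sum.cong refl, goal_cases)
    case (1 r)
    then have *: "real r * x + real (j - r) * - x = (2 * real r - real j) * x"
      by (simp add: of_nat_diff algebra_simps)
    have "cis x ^ r * cis (- x) ^ (j - r) = cis (real r * x) * cis (real (j - r) * - x)"
      using Complex.DeMoivre[of x r] Complex.DeMoivre[of "- x" "j - r"] by presburger
    also have "\<dots> = cis (real r * x + real (j - r) * - x)"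
      by (rule cis_mult)
    also have "\<dots> = cis ((2 * real r - real j) * x)"
      using * by presburger
    finally have "cis x ^ r * cis (- x) ^ (j - r) = cis ((2 * real r - real j) * x)" .
    then show ?case by (simp only: mult.assoc)
  qed
  finally show ?thesis .
qed

lemma set_integrable_continuous_Icc:
  fixes f :: "real \<Rightarrow> 'b :: {banach, second_countable_topology}"
  assumes "continuous_on {a..b} f"
  shows "set_integrable lborel {a..b} f"
  unfolding set_integrable_def using borel_integrable_compact[OF _ assms] by simp

text \<open>Among the frequencies \<open>2 r - j\<close> of the j-th power of the cosine, only
  \<open>-k\<close> survives integration against \<open>cis (k x)\<close>; the shift
  \<open>y\<close> contributes just the phase \<open>cis (k y)\<close>.\<close>

lemma cos_power_cis_integral:
  "(LINT x:{0..2*pi}|lborel. of_real (cos (x - y)) ^ j * cis (real k * x))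
    = (\<Sum>r\<le>j. if 2 * r + k = j then of_nat (j choose r) * of_real (2 * pi) * cis (real k * y) / 2 ^ j else 0)"
proof -
  define c where "c r = of_nat (j choose r) * cis (- ((2 * real r - real j) * y)) / (2::complex) ^ j" for r
  have "of_real (cos (x - y)) ^ j * cis (real k * x)
      = (\<Sum>r\<le>j. c r * cis (of_int (2 * int r - int j + int k) * x))" for x
    unfolding cos_power_eq_cis_sum sum_divide_distrib sum_distrib_right c_def
    by (intro sum.cong refl) (simp add: cis_mult algebra_simps)
  then have "(LINT x:{0..2*pi}|lborel. of_real (cos (x - y)) ^ j * cis (real k * x))
     = (LINT x:{0..2*pi}|lborel. (\<Sum>r\<le>j. c r * cis (of_int (2 * int r - int j + int k) * x)))"
    by simp
  also have "\<dots> = (\<Sum>r\<le>j. LINT x:{0..2*pi}|lborel. c r * cis (of_int (2 * int r - int j + int k) * x))"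
    unfolding set_lebesgue_integral_def scaleR_sum_right
    by (intro Bochner_Integration.integral_sum set_integrable_continuous_Icc[unfolded set_integrable_def] continuous_intros)
  also have "\<dots> = (\<Sum>r\<le>j. c r * (if 2 * int r - int j + int k = 0 then of_real (2 * pi) else 0))"
    by (simp only: set_integral_mult_right cis_integral)
  also have "\<dots> = (\<Sum>r\<le>j. if 2 * r + k = j then of_nat (j choose r) * of_real (2 * pi) * cis (real k * y) / 2 ^ j else 0)"
  proof (intro sum.cong refl, goal_cases)
    case (1 r)
    show ?case
    proof (cases "2 * r + k = j")
      case True
      then have "- ((2 * real r - real j) * y) = real k * y" by (simp add: algebra_simps flip: True)
      then show ?thesis using True by (simp add: c_def)
    qed auto
  qed
  finally show ?thesis .
qed

text \<open>Only the Taylor terms of order \<open>j = k + 2 r\<close> have a Fourier coefficient of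
  order k. Their binomial factors combine with \<open>j!\<close> into the denominators of
  \<open>legendre_avg\<close>, which is where its coefficients come from.\<close>

lemma legendre_phi_integral:
  assumes w: "w^2 = (1 - u^2) * (1 - v^2)"
  shows "(LINT x:{0..2*pi}|lborel. of_real (poly (legendre n) (u * v + w * cos (x - y))) * cis (real k * x))
    = of_real (2 * pi / 2 ^ k * w ^ k * poly (legendre_avg k n v) u) * cis (real k * y)"
proof -
  define D where "D j = poly (legendre_d j n) (u * v)" for j
  \<comment> \<open>This Taylor order is at least the degree, and it makes
    \<open>2 r + k \<le> N\<close> equivalent to \<open>r \<le> n\<close>, the range of summation in
    \<open>legendre_avg\<close>.\<close>
  define N where "N = k + 2 * n"
  let ?E = "of_real (2 * pi) * cis (real k * y)"
  have pt: "poly (legendre n) (u * v + w * cos (x - y)) = (\<Sum>j\<le>N. D j / fact j * (w * cos (x - y)) ^ j)" for x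
    unfolding D_def N_def by (rule poly_taylor_sum) (use degree_legendre_le[of n] in linarith)
  have "of_real (poly (legendre n) (u * v + w * cos (x - y))) * cis (real k * x)
      = (\<Sum>j\<le>N. of_real (D j / fact j * w ^ j) * (of_real (cos (x - y)) ^ j * cis (real k * x)))" for x
    unfolding pt of_real_sum sum_distrib_right by (intro sum.cong refl) (simp add: power_mult_distrib)
  then have "(LINT x:{0..2*pi}|lborel. of_real (poly (legendre n) (u * v + w * cos (x - y))) * cis (real k * x))
    = (LINT x:{0..2*pi}|lborel. (\<Sum>j\<le>N. of_real (D j / fact j * w ^ j) * (of_real (cos (x - y)) ^ j * cis (real k * x))))"
    by simp
  also have "\<dots> = (\<Sum>j\<le>N. LINT x:{0..2*pi}|lborel. of_real (D j / fact j * w ^ j) * (of_real (cos (x - y)) ^ j * cis (real k * x)))"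
    unfolding set_lebesgue_integral_def scaleR_sum_right
    by (intro Bochner_Integration.integral_sum set_integrable_continuous_Icc[unfolded set_integrable_def] continuous_intros)
  also have "\<dots> = (\<Sum>j\<le>N. \<Sum>r\<le>j. if 2 * r + k = j then of_real (D j / fact j * w ^ j) * (of_nat (j choose r) / 2 ^ j * ?E) else 0)"
    unfolding set_integral_mult_right cos_power_cis_integral sum_distrib_left
    by (intro sum.cong refl) (auto simp: mult_ac)
  also have "\<dots> = (\<Sum>j\<le>N. \<Sum>r\<le>N. if 2 * r + k = j then of_real (D j / fact j * w ^ j) * (of_nat (j choose r) / 2 ^ j * ?E) else 0)"
    by (intro sum.cong refl sum.mono_neutral_left) auto
  also have "\<dots> = (\<Sum>r\<le>N. \<Sum>j\<le>N. if 2 * r + k = j then of_real (D j / fact j * w ^ j) * (of_nat (j choose r) / 2 ^ j * ?E) else 0)"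
    by (rule sum.swap)
  also have "\<dots> = (\<Sum>r\<le>N. if 2 * r + k \<le> N then of_real (D (k + 2 * r) / fact (k + 2 * r) * w ^ (k + 2 * r)) * (of_nat ((k + 2 * r) choose r) / 2 ^ (k + 2 * r) * ?E) else 0)"
    by (intro sum.cong refl) (simp add: add.commute mult_ac)
  also have "\<dots> = (\<Sum>r\<le>n. of_real (D (k + 2 * r) / fact (k + 2 * r) * w ^ (k + 2 * r)) * (of_nat ((k + 2 * r) choose r) / 2 ^ (k + 2 * r) * ?E))"
    by (intro sum.mono_neutral_cong_right) (auto simp: N_def)
  also have "\<dots> = (\<Sum>r\<le>n. of_real (w ^ k / 2 ^ k) * ?E * of_real (D (k + 2 * r) * ((1 - u^2) * (1 - v^2)) ^ r / (4 ^ r * fact r * fact (k + r))))"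
  proof (intro sum.cong refl, goal_cases)
    case (1 r)
    have "real ((k + 2 * r) choose r) = fact (k + 2 * r) / (fact r * fact (k + r))"
      by (subst binomial_fact) (simp_all add: mult_2)
    moreover have "w ^ (k + 2 * r) = w ^ k * ((1 - u^2) * (1 - v^2)) ^ r" "(2::real) ^ (k + 2 * r) = 2 ^ k * 4 ^ r"
      by (simp_all only: power_add power_mult w) simp_all
    ultimately have *: "D (k + 2 * r) / fact (k + 2 * r) * w ^ (k + 2 * r) * (real ((k + 2 * r) choose r) / 2 ^ (k + 2 * r))
      = w ^ k / 2 ^ k * (D (k + 2 * r) * ((1 - u^2) * (1 - v^2)) ^ r / (4 ^ r * fact r * fact (k + r)))"
      by (simp only:) (simp add: ac_simps)
    have "of_real (D (k + 2 * r) / fact (k + 2 * r) * w ^ (k + 2 * r)) * (of_nat ((k + 2 * r) choose r) / 2 ^ (k + 2 * r) * ?E)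
      = of_real (D (k + 2 * r) / fact (k + 2 * r) * w ^ (k + 2 * r) * (real ((k + 2 * r) choose r) / 2 ^ (k + 2 * r))) * ?E"
      by simp
    then show ?case unfolding * by simp
  qed
  also have "\<dots> = of_real (w ^ k / 2 ^ k) * ?E * of_real (poly (legendre_avg k n v) u)"
    unfolding poly_legendre_avg of_real_sum sum_distrib_left D_def ..
  finally show ?thesis by simp
qed

text \<open>The substitution t = cos x, carried out with an explicit polynomial antiderivative
  \<open>A\<close>; it links the algebraic functional \<open>poly_int\<close> to an actual
  integral.\<close>

lemma sin_poly_cos_integral:
  "(LINT x:{0..pi}|lborel. sin x * poly p (cos x)) = poly_int p"
proof -
  define A where "A = (\<Sum>i\<le>degree p. monom (coeff p i / (real i + 1)) (Suc i))"
  have pderiv_sum: "pderiv (sum f B) = (\<Sum>i\<in>B. pderiv (f i))" for f :: "nat \<Rightarrow> real poly" and B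
    using higher_pderiv_sum[of 1 f B] by simp
  have A: "pderiv A = p"
  proof -
    have "pderiv (monom (coeff p i / (real i + 1)) (Suc i)) = monom (coeff p i) i" for i
      by (simp add: pderiv_monom field_simps add_nonneg_eq_0_iff)
    then show ?thesis by (simp add: A_def pderiv_sum poly_as_sum_of_monoms)
  qed
  have "((\<lambda>x. - poly A (cos x)) has_vector_derivative sin x * poly p (cos x)) (at x within {0..pi})" for x
    unfolding has_real_derivative_iff_has_vector_derivative[symmetric]
    by (rule derivative_eq_intros refl DERIV_chain'[where g = "poly A"] poly_DERIV | simp add: A)+
  then have "(LINT x:{0..pi}|lborel. sin x * poly p (cos x)) = - poly A (cos pi) - (- poly A (cos 0))"
    unfolding set_lebesgue_integral_def
    by (intro integral_FTC_Icc) (auto intro!: continuous_intros)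
  then show ?thesis using poly_int_pderiv[of A] A by simp
qed

section \<open>Spherical coordinates and integration over the sphere\<close>

lemma sphere_point_eq: "sphere_point a b = (sin a * cos b) *\<^sub>R axis 1 1 + (sin a * sin b) *\<^sub>R axis 2 1 + cos a *\<^sub>R axis 3 1"
  by (simp add: sphere_point_def vec_eq_iff forall_3 axis_def)

lemma sphere_point_nth [simp]:
  "sphere_point a b $ 1 = sin a * cos b" "sphere_point a b $ 2 = sin a * sin b" "sphere_point a b $ 3 = cos a"
  by (simp_all add: sphere_point_def)

lemma inner_real3: "(x :: real ^ 3) \<bullet> y = x $ 1 * y $ 1 + x $ 2 * y $ 2 + x $ 3 * y $ 3"
  by (simp add: inner_vec_def sum_3)

lemma mem_S2_iff: "x \<in> S2 \<longleftrightarrow> (x $ 1)\<^sup>2 + (x $ 2)\<^sup>2 + (x $ 3)\<^sup>2 = 1"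
  by (simp add: norm_eq_1 inner_real3 power2_eq_square)

lemma sphere_point_in_S2 [simp]: "norm (sphere_point a b) = 1"
proof -
  have "(sin a * cos b)\<^sup>2 + (sin a * sin b)\<^sup>2 + (cos a)\<^sup>2 = (sin a)\<^sup>2 * ((cos b)\<^sup>2 + (sin b)\<^sup>2) + (cos a)\<^sup>2"
    by (simp only: power_mult_distrib distrib_left)
  then show ?thesis using mem_S2_iff[of "sphere_point a b"] by simp
qed

text \<open>The longitude \<open>b\<close> carries no range, because it enters the later integrals
  only as a phase.\<close>

lemma sphere_point_surj:
  assumes "y \<in> S2"
  obtains a b where "0 \<le> a" "a \<le> pi" "y = sphere_point a b"
proof -
  define a where "a = arccos (y $ 3)"
  have y: "(y $ 1)\<^sup>2 + (y $ 2)\<^sup>2 + (y $ 3)\<^sup>2 = 1" using assms by (simp only: mem_S2_iff)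
  have "(y $ 3)\<^sup>2 \<le> 1" using y zero_le_power2[of "y $ 1"] zero_le_power2[of "y $ 2"] by linarith
  then have b3: "\<bar>y $ 3\<bar> \<le> 1" by (simp add: abs_square_le_1)
  then have ca: "cos a = y $ 3" and a: "0 \<le> a" "a \<le> pi" by (auto simp: a_def arccos_lbound arccos_ubound)
  have s: "sin a \<ge> 0" using a by (simp add: sin_ge_zero)
  have "(sin a)\<^sup>2 = (y $ 1)\<^sup>2 + (y $ 2)\<^sup>2" using y by (simp add: sin_squared_eq ca)
  then have "cmod (Complex (y $ 1) (y $ 2)) = sin a"
    using s by (simp add: cmod_def real_sqrt_unique flip: \<open>(sin a)\<^sup>2 = _\<close>)
  moreover obtain b where "Complex (y $ 1) (y $ 2) = of_real (cmod (Complex (y $ 1) (y $ 2))) * cis b"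
    by (metis rcis_cmod_Arg rcis_def)
  ultimately have "Complex (y $ 1) (y $ 2) = of_real (sin a) * cis b" by simp
  then have "y $ 1 = sin a * cos b" "y $ 2 = sin a * sin b" by (simp_all add: complex_eq_iff)
  then have "y = sphere_point a b" by (simp add: vec_eq_iff forall_3 ca)
  then show ?thesis using that a by blast
qed

lemma continuous_sphere_point: "continuous_on A (\<lambda>p. sphere_point (fst p) (snd p))"
  unfolding sphere_point_eq by (intro continuous_intros)

lemma sets_sphere_measure [measurable_cong]: "sets sphere_measure = sets (restrict_space borel S2)"
  and space_sphere_measure [simp]: "space sphere_measure = S2"
  by (simp_all add: sphere_measure_def space_restrict_space)

lemma measurable_sphere_point:
  "(\<lambda>(a, b). sphere_point a b) \<in> density (restrict_space lborel ({0..pi} \<times> {0..2 * pi})) (\<lambda>(a, b). ennreal (sin a)) \<rightarrow>\<^sub>M restrict_space borel S2"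
proof -
  have "(\<lambda>(a, b). sphere_point a b) \<in> borel_measurable borel"
    using borel_measurable_continuous_onI[OF continuous_sphere_point] by (simp add: case_prod_beta')
  then have "(\<lambda>(a, b). sphere_point a b) \<in> restrict_space lborel ({0..pi} \<times> {0..2 * pi}) \<rightarrow>\<^sub>M restrict_space borel S2"
    by (intro measurable_restrict_space1 measurable_restrict_space2) auto
  then show ?thesis by (simp cong: measurable_cong_sets)
qed

lemma finite_measure_sphere: "finite_measure sphere_measure"
proof
  let ?B = "{0..pi} \<times> {0..2 * pi}"
  have S2: "S2 \<in> sets (restrict_space borel S2)"
    using sets.top[of "restrict_space borel S2"] by (simp add: space_restrict_space)
  have "emeasure sphere_measure (space sphere_measure) = emeasure (density (restrict_space lborel ?B) (\<lambda>(a, b). ennreal (sin a)))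
      (space (density (restrict_space lborel ?B) (\<lambda>(a, b). ennreal (sin a))))"
    unfolding sphere_measure_def
    by (subst emeasure_distr[OF measurable_sphere_point]) (auto simp: space_restrict_space S2 intro!: arg_cong2[where f = emeasure])
  also have "\<dots> = (\<integral>\<^sup>+ x. (case x of (a, b) \<Rightarrow> ennreal (sin a)) \<partial>restrict_space lborel ?B)"
    by (subst emeasure_density) (auto simp: case_prod_beta' intro!: nn_integral_cong measurable_restrict_space1 borel_measurable_continuous_onI continuous_intros measurable_compose[OF _ measurable_ennreal] split: split_indicator)
  also have "\<dots> \<le> (\<integral>\<^sup>+ x. 1 \<partial>restrict_space lborel ?B)"
    by (intro nn_integral_mono) auto
  also have "\<dots> = emeasure lborel ?B"
  proof -
    have B: "?B \<in> sets lborel" by (auto intro!: borel_closed closed_Times)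
    then have "emeasure (restrict_space lborel ?B) ?B = emeasure lborel ?B"
      by (intro emeasure_restrict_space) auto
    then show ?thesis by (simp add: space_restrict_space)
  qed
  also have "\<dots> < \<infinity>"
    by (intro emeasure_bounded_finite bounded_Times) auto
  finally show "emeasure sphere_measure (space sphere_measure) \<noteq> \<infinity>" by auto
qed

lemma sphere_measurable_continuous:
  fixes f :: "real ^ 3 \<Rightarrow> 'b :: topological_space"
  assumes "continuous_on S2 f"
  shows "f \<in> borel_measurable sphere_measure"
  using borel_measurable_continuous_on_restrict[OF assms] by (simp cong: measurable_cong_sets add: sets_sphere_measure)

lemma sphere_integrable_continuous:
  fixes f :: "real ^ 3 \<Rightarrow> 'b :: {banach, second_countable_topology}"
  assumes "continuous_on S2 f"
  shows "integrable sphere_measure f"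
proof -
  interpret finite_measure sphere_measure by (rule finite_measure_sphere)
  have "bounded (f ` S2)"
    using assms by (intro compact_imp_bounded compact_continuous_image) auto
  then obtain B where "\<forall>y\<in>f ` S2. norm y \<le> B" unfolding bounded_iff by blast
  then show ?thesis
    by (intro integrable_const_bound[of _ B] AE_I2 sphere_measurable_continuous assms) auto
qed

lemma sphere_integral_continuous:
  fixes f :: "real ^ 3 \<Rightarrow> 'b :: {banach, second_countable_topology}"
  assumes f: "continuous_on S2 f"
  shows "(\<integral>x. f x \<partial>sphere_measure) = (LINT a:{0..pi}|lborel. LINT b:{0..2*pi}|lborel. sin a *\<^sub>R f (sphere_point a b))"
proof -
  let ?B = "{0..pi} \<times> {0..2 * pi}"
  let ?g = "\<lambda>p. sin (fst p) *\<^sub>R f (sphere_point (fst p) (snd p))"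
  have cont: "continuous_on A ?g" for A
    by (intro continuous_intros continuous_on_compose2[OF f continuous_sphere_point]) auto
  have fm: "f \<in> borel_measurable (restrict_space borel S2)"
    by (rule borel_measurable_continuous_on_restrict[OF f])
  have "(\<integral>x. f x \<partial>sphere_measure) = (\<integral>p. f (sphere_point (fst p) (snd p))
      \<partial>density (restrict_space lborel ?B) (\<lambda>p. ennreal (sin (fst p))))"
    unfolding sphere_measure_def using integral_distr[OF measurable_sphere_point fm]
    by (simp add: case_prod_beta')
  also have "\<dots> = (\<integral>p. ?g p \<partial>restrict_space lborel ?B)"
    by (intro integral_density measurable_restrict_space1 borel_measurable_continuous_onI continuous_intros
          AE_I2)
       (auto simp: space_restrict_space sin_ge_zero
         intro!: borel_measurable_continuous_onI continuous_on_compose2[OF f continuous_sphere_point] continuous_intros)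
  also have "\<dots> = (\<integral>p. indicator ?B p *\<^sub>R ?g p \<partial>lborel)"
    by (subst integral_restrict_space) (auto intro!: borel_closed closed_Times)
  also have "\<dots> = (\<integral>p. indicator ?B p *\<^sub>R ?g p \<partial>(lborel \<Otimes>\<^sub>M lborel))"
    by (simp only: lborel_prod)
  also have "\<dots> = (\<integral>a. \<integral>b. indicator ?B (a, b) *\<^sub>R ?g (a, b) \<partial>lborel \<partial>lborel)"
  proof (rule lborel_pair.integral_fst'[symmetric])
    have "integrable lborel (\<lambda>p. indicator ?B p *\<^sub>R ?g p)"
      by (rule borel_integrable_compact[OF compact_Times cont]) auto
    then show "integrable (lborel \<Otimes>\<^sub>M lborel) (\<lambda>p. indicator ?B p *\<^sub>R ?g p)"
      by (simp only: lborel_prod)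
  qed
  also have "\<dots> = (LINT a:{0..pi}|lborel. LINT b:{0..2*pi}|lborel. sin a *\<^sub>R f (sphere_point a b))"
    unfolding set_lebesgue_integral_def
    by (simp add: indicator_times mult.commute flip: scaleR_scaleR)
  finally show ?thesis .
qed

section \<open>Harmonics as eigenfunctions of Legendre kernels\<close>

definition complex_sph_harm :: "nat \<Rightarrow> nat \<Rightarrow> real ^ 3 \<Rightarrow> complex" where
  "complex_sph_harm l k x = of_real (poly (legendre_d k l) (x $ 3)) * Complex (x $ 1) (x $ 2) ^ k"

lemma continuous_complex_sph_harm: "continuous_on A (complex_sph_harm l k)"
  unfolding complex_sph_harm_def[abs_def] Complex_eq by (intro continuous_intros)

text \<open>In coordinates \<open>x \<bullet> y\<close> has the form
  \<open>u v + w cos (b - d)\<close> with \<open>w = sin a * sin c\<close>, so the longitude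
  integral is \<open>legendre_phi_integral\<close> and the latitude integral is
  \<open>poly_int_legendre_avg\<close>. The power of \<open>sin c\<close> and the phase in
  \<open>d\<close> reassemble the harmonic at \<open>y\<close>.\<close>

lemma legendre_funk_hecke_complex:
  assumes "k \<le> l" and y: "y \<in> S2"
  shows "(\<integral>x. of_real (poly (legendre n) (x \<bullet> y)) * complex_sph_harm l k x \<partial>sphere_measure)
    = (if n = l then of_real (4 * pi / (2 * real l + 1)) * complex_sph_harm l k y else 0)"
proof -
  obtain c d where c: "0 \<le> c" "c \<le> pi" and yc: "y = sphere_point c d" using sphere_point_surj[OF y] by blast
  let ?D = "legendre_d k l"
  let ?q = "[:1, 0, -1:] :: real poly"
  have cont: "continuous_on S2 (\<lambda>x. of_real (poly (legendre n) (x \<bullet> y)) * complex_sph_harm l k x)"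
    by (intro continuous_intros continuous_complex_sph_harm)
  have harm: "complex_sph_harm l k (sphere_point a b) = of_real (poly ?D (cos a) * sin a ^ k) * cis (real k * b)" for a b
  proof -
    have "Complex (sin a * cos b) (sin a * sin b) = of_real (sin a) * cis b" by (simp add: complex_eq_iff)
    then show ?thesis by (simp add: complex_sph_harm_def power_mult_distrib Complex.DeMoivre)
  qed
  have inner: "sphere_point a b \<bullet> y = cos a * cos c + (sin a * sin c) * cos (b - d)" for a b
    by (simp add: yc inner_real3 cos_diff algebra_simps)
  have phi: "(LINT b:{0..2*pi}|lborel. sin a *\<^sub>R (of_real (poly (legendre n) (sphere_point a b \<bullet> y)) * complex_sph_harm l k (sphere_point a b)))
    = of_real (sin a * poly (?q ^ k * ?D * legendre_avg k n (cos c)) (cos a)) * (of_real (2 * pi / 2 ^ k * sin c ^ k) * cis (real k * d))" for a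
  proof -
    have sq: "(sin a * sin c)\<^sup>2 = (1 - (cos a)\<^sup>2) * (1 - (cos c)\<^sup>2)"
      by (simp add: power_mult_distrib sin_squared_eq)
    \<comment> \<open>One factor \<open>sin a ^ k\<close> stems from the harmonic and one from
      \<open>w ^ k\<close>; together they form the weight under which the derivatives of Legendre
      polynomials are orthogonal.\<close>
    have qk: "poly (?q ^ k) (cos a) = sin a ^ k * sin a ^ k"
    proof -
      have "poly ?q (cos a) = sin a * sin a"
        using sin_squared_eq[of a] by (simp add: power2_eq_square)
      then show ?thesis by (simp only: poly_power power_mult_distrib)
    qed
    have "(LINT b:{0..2*pi}|lborel. sin a *\<^sub>R (of_real (poly (legendre n) (sphere_point a b \<bullet> y)) * complex_sph_harm l k (sphere_point a b)))
      = (LINT b:{0..2*pi}|lborel. of_real (sin a * poly ?D (cos a) * sin a ^ k) *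
           (of_real (poly (legendre n) (cos a * cos c + (sin a * sin c) * cos (b - d))) * cis (real k * b)))"
      unfolding harm inner by (simp add: scaleR_conv_of_real mult_ac)
    also have "\<dots> = of_real (sin a * poly ?D (cos a) * sin a ^ k) *
       (of_real (2 * pi / 2 ^ k * (sin a * sin c) ^ k * poly (legendre_avg k n (cos c)) (cos a)) * cis (real k * d))"
      unfolding set_integral_mult_right legendre_phi_integral[OF sq] ..
    finally show ?thesis unfolding poly_mult qk by (simp add: power_mult_distrib mult_ac)
  qed
  have "(\<integral>x. of_real (poly (legendre n) (x \<bullet> y)) * complex_sph_harm l k x \<partial>sphere_measure)
    = (LINT a:{0..pi}|lborel. of_real (sin a * poly (?q ^ k * ?D * legendre_avg k n (cos c)) (cos a)) * (of_real (2 * pi / 2 ^ k * sin c ^ k) * cis (real k * d)))"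
    unfolding sphere_integral_continuous[OF cont] phi ..
  also have "\<dots> = of_real (LINT a:{0..pi}|lborel. sin a * poly (?q ^ k * ?D * legendre_avg k n (cos c)) (cos a)) * (of_real (2 * pi / 2 ^ k * sin c ^ k) * cis (real k * d))"
    by (simp only: set_integral_mult_left set_integral_complex_of_real)
  also have "\<dots> = of_real (poly_int (?q ^ k * ?D * legendre_avg k n (cos c))) * (of_real (2 * pi / 2 ^ k * sin c ^ k) * cis (real k * d))"
    unfolding sin_poly_cos_integral ..
  also have "\<dots> = (if n = l then of_real (4 * pi / (2 * real l + 1)) * complex_sph_harm l k y else 0)"
    unfolding poly_int_legendre_avg[OF assms(1)] yc harm by (simp add: mult_ac)
  finally show ?thesis .
qed

lemma real_sph_harm_eq:
  obtains c where "\<And>x. real_sph_harm l m x =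
    c * (if m \<ge> 0 then Re (complex_sph_harm l (nat \<bar>m\<bar>) x) else Im (complex_sph_harm l (nat \<bar>m\<bar>) x))"
proof
  let ?k = "nat \<bar>m\<bar>"
  show "real_sph_harm l m x = (sqrt ((2 * real l + 1) / (4 * pi) * fact (l - ?k) / fact (l + ?k)) * (if m = 0 then 1 else sqrt 2))
    * (if m \<ge> 0 then Re (complex_sph_harm l ?k x) else Im (complex_sph_harm l ?k x))" for x
    by (auto simp: real_sph_harm_def complex_sph_harm_def Let_def)
qed

lemma continuous_real_sph_harm: "continuous_on A (real_sph_harm l m)"
proof -
  obtain c where "\<And>x. real_sph_harm l m x =
    c * (if m \<ge> 0 then Re (complex_sph_harm l (nat \<bar>m\<bar>) x) else Im (complex_sph_harm l (nat \<bar>m\<bar>) x))"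
    using real_sph_harm_eq by blast
  then have "real_sph_harm l m = (\<lambda>x. c * (if m \<ge> 0 then Re (complex_sph_harm l (nat \<bar>m\<bar>) x) else Im (complex_sph_harm l (nat \<bar>m\<bar>) x)))"
    by auto
  then show ?thesis
    by (cases "m \<ge> 0") (auto intro!: continuous_intros continuous_complex_sph_harm)
qed

lemma legendre_funk_hecke:
  assumes m: "m \<in> {- int l..int l}" and y: "y \<in> S2"
  shows "(\<integral>x. poly (legendre n) (x \<bullet> y) * real_sph_harm l m x \<partial>sphere_measure)
    = (if n = l then 4 * pi / (2 * real l + 1) * real_sph_harm l m y else 0)"
proof -
  obtain c where c: "\<And>x. real_sph_harm l m x =
    c * (if m \<ge> 0 then Re (complex_sph_harm l (nat \<bar>m\<bar>) x) else Im (complex_sph_harm l (nat \<bar>m\<bar>) x))"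
    using real_sph_harm_eq by blast
  let ?k = "nat \<bar>m\<bar>"
  let ?f = "\<lambda>x. of_real (poly (legendre n) (x \<bullet> y)) * complex_sph_harm l ?k x"
  have k: "?k \<le> l" using m by auto
  have int: "integrable sphere_measure ?f"
    by (intro sphere_integrable_continuous continuous_intros continuous_complex_sph_harm)
  have re: "(\<integral>x. Re (?f x) \<partial>sphere_measure) = Re (\<integral>x. ?f x \<partial>sphere_measure)"
    and im: "(\<integral>x. Im (?f x) \<partial>sphere_measure) = Im (\<integral>x. ?f x \<partial>sphere_measure)"
    using integral_Re[OF int] integral_Im[OF int] by simp_all
  show ?thesis
  proof (cases "m \<ge> 0")
    case True
    have "(\<integral>x. poly (legendre n) (x \<bullet> y) * real_sph_harm l m x \<partial>sphere_measure) = (\<integral>x. c * Re (?f x) \<partial>sphere_measure)"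
      using True by (simp add: c mult_ac)
    also have "\<dots> = c * Re (\<integral>x. ?f x \<partial>sphere_measure)"
      by (simp only: integral_mult_right_zero re)
    finally show ?thesis unfolding legendre_funk_hecke_complex[OF k y] using True by (simp add: c)
  next
    case False
    have "(\<integral>x. poly (legendre n) (x \<bullet> y) * real_sph_harm l m x \<partial>sphere_measure) = (\<integral>x. c * Im (?f x) \<partial>sphere_measure)"
      using False by (simp add: c mult_ac)
    also have "\<dots> = c * Im (\<integral>x. ?f x \<partial>sphere_measure)"
      by (simp only: integral_mult_right_zero im)
    finally show ?thesis unfolding legendre_funk_hecke_complex[OF k y] using False by (simp add: c)
  qed
qed

section \<open>Eigenfunctions of the autoregressive kernel\<close>

text \<open>The kernel is only assumed continuous on \<open>[-1, 1]\<close>; clamping its argument makes it measurable.\<close>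

abbreviation (input) "clamp1 t \<equiv> max (-1) (min 1 (t::real))"

lemma inner_S2_bounds:
  assumes "x \<in> S2" "y \<in> S2"
  shows "-1 \<le> x \<bullet> y" "x \<bullet> y \<le> 1"
  using Cauchy_Schwarz_ineq2[of x y] assms by auto

lemma id_measurable_sphere [measurable]: "(\<lambda>x. x) \<in> borel_measurable sphere_measure"
  by (intro sphere_measurable_continuous continuous_intros)

lemma kernel_clamp_measurable:
  assumes "continuous_on {-1..1} k"
  shows "(\<lambda>t. k (clamp1 t)) \<in> borel_measurable borel"
  by (intro borel_measurable_continuous_onI continuous_on_compose2[OF assms]) (auto intro!: continuous_intros)

lemma kernel_bounded:
  fixes k :: "real \<Rightarrow> real"
  assumes "continuous_on {-1..1} k"
  obtains B where "B > 0" "\<And>t. t \<in> {-1..1} \<Longrightarrow> \<bar>k t\<bar> \<le> B"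
proof -
  have "compact (k ` {-1..1})" using assms by (intro compact_continuous_image) auto
  then obtain B where "B > 0" "\<forall>y\<in>k ` {-1..1}. norm y \<le> B"
    using compact_imp_bounded bounded_pos by blast
  then show ?thesis using that by auto
qed

lemma real_sph_harm_bounded:
  obtains B where "B > 0" "\<And>x. x \<in> S2 \<Longrightarrow> \<bar>real_sph_harm l m x\<bar> \<le> B"
proof -
  have "compact (real_sph_harm l m ` S2)"
    by (intro compact_continuous_image continuous_real_sph_harm) auto
  then obtain B where "B > 0" "\<forall>y\<in>real_sph_harm l m ` S2. norm y \<le> B"
    using compact_imp_bounded bounded_pos by blast
  then show ?thesis using that by auto
qed

lemma real_sph_harm_measurable [measurable]: "real_sph_harm l m \<in> borel_measurable sphere_measure"
  by (intro sphere_measurable_continuous continuous_real_sph_harm)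

text \<open>A linear form of Cauchy--Schwarz with a free scale \<open>e\<close>: it bounds a first
  moment by a second moment. The scale is arbitrarily small for the kernel remainder and
  \<open>sqrt N\<close> for the martingales.\<close>

lemma abs_le_eps_square:
  fixes x e :: real
  assumes "e > 0"
  shows "\<bar>x\<bar> \<le> e + x\<^sup>2 / e"
proof (cases "\<bar>x\<bar> \<le> e")
  case False
  then have "\<bar>x\<bar> * e \<le> \<bar>x\<bar> * \<bar>x\<bar>" by (intro mult_left_mono) auto
  then have "\<bar>x\<bar> * e \<le> x\<^sup>2" by (simp add: power2_eq_square)
  then have "\<bar>x\<bar> \<le> x\<^sup>2 / e" using assms by (simp add: pos_le_divide_eq)
  then show ?thesis using assms by simp
qed (use assms in \<open>simp add: add_increasing2\<close>)

text \<open>The defect \<open>h\<close> of the eigenvalue relation does not depend on the truncation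
  \<open>n\<close>, yet for all large \<open>n\<close> its L1 norm is at most a constant times the
  L1 norm of the kernel remainder \<open>F n\<close>, which tends to 0. Convergence in the mean
  yields the relation almost everywhere, which suffices under a further integral.\<close>

lemma autoreg_kernel_eigenfunction:
  assumes k: "continuous_on {-1..1} k" and eig: "autoreg_eigenvalues k \<phi>"
    and l: "l \<ge> 1" and m: "m \<in> {- int l..int l}"
  shows "AE y in sphere_measure. (\<integral>x. k (x \<bullet> y) * real_sph_harm l m x \<partial>sphere_measure) = \<phi> l * real_sph_harm l m y"
proof -
  interpret S: finite_measure sphere_measure by (rule finite_measure_sphere)
  interpret SS: pair_sigma_finite sphere_measure sphere_measure ..
  interpret SS: finite_measure "sphere_measure \<Otimes>\<^sub>M sphere_measure"
    by (rule finite_measure_pair_measure) (rule finite_measure_sphere)+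
  let ?S = "sphere_measure" and ?Y = "real_sph_harm l m"
  define kc where "kc t = k (clamp1 t)" for t
  have [measurable]: "kc \<in> borel_measurable borel"
    using kernel_clamp_measurable[OF k] by (simp add: kc_def[abs_def])
  have kc: "k (x \<bullet> y) = kc (x \<bullet> y)" if "x \<in> S2" "y \<in> S2" for x y
    using inner_S2_bounds[OF that] by (simp add: kc_def)
  define p where "p n = (\<Sum>l=1..n. smult (\<phi> l * ((2 * real l + 1) / (4 * pi))) (legendre l))" for n
  define F where "F n x y = kc (x \<bullet> y) - poly (p n) (x \<bullet> y)" for n and x y :: "real ^ 3"
  have [measurable]: "poly q \<in> borel_measurable borel" for q :: "real poly"
    by (intro borel_measurable_continuous_onI continuous_intros)
  have Fm: "case_prod (F n) \<in> borel_measurable (?S \<Otimes>\<^sub>M ?S)" for n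
    unfolding F_def by measurable
  have Fb: "\<exists>B\<ge>0. \<forall>x\<in>S2. \<forall>y\<in>S2. \<bar>F n x y\<bar> \<le> B" for n
  proof -
    have "continuous_on {-1..1} (\<lambda>t. k t - poly (p n) t)"
      by (intro continuous_intros k)
    from kernel_bounded[OF this] obtain B where B: "B > 0" "\<And>t. t \<in> {-1..1} \<Longrightarrow> \<bar>k t - poly (p n) t\<bar> \<le> B"
      by blast
    then have "\<bar>F n x y\<bar> \<le> B" if "x \<in> S2" "y \<in> S2" for x y
      using inner_S2_bounds[OF that] by (simp add: F_def kc[OF that, symmetric])
    then show ?thesis using B(1) by (intro exI[of _ B]) auto
  qed
  define I where "I n = (\<integral>z. (F n (fst z) (snd z))\<^sup>2 \<partial>(?S \<Otimes>\<^sub>M ?S))" for n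
  have I: "I \<longlonglongrightarrow> 0"
  proof -
    have "I n = (\<integral>(x, y). (k (x \<bullet> y) - (\<Sum>l=1..n. \<phi> l * ((2 * real l + 1) / (4 * pi)) * poly (legendre l) (x \<bullet> y)))\<^sup>2 \<partial>(?S \<Otimes>\<^sub>M ?S))" for n
      unfolding I_def
      by (intro Bochner_Integration.integral_cong refl) (auto simp: space_pair_measure F_def kc p_def poly_sum)
    then show ?thesis using eig unfolding autoreg_eigenvalues_def by presburger
  qed
  obtain B where B: "B > 0" "\<And>x. x \<in> S2 \<Longrightarrow> \<bar>?Y x\<bar> \<le> B" using real_sph_harm_bounded by blast
  define h where "h y = (\<integral>x. kc (x \<bullet> y) * ?Y x \<partial>?S) - \<phi> l * ?Y y" for y
  let ?I = "\<integral>y. \<bar>h y\<bar> \<partial>?S"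
  have Fint: "integrable ?S (\<lambda>x. F n x y * ?Y x)" if y: "y \<in> S2" for n y
  proof -
    obtain C where C: "C \<ge> 0" "\<forall>x\<in>S2. \<forall>y\<in>S2. \<bar>F n x y\<bar> \<le> C" using Fb by blast
    have "(\<lambda>x. F n x y) \<in> borel_measurable ?S" unfolding F_def by measurable
    then show ?thesis using C B y
      by (intro S.integrable_const_bound[of _ "C * B"] AE_I2) (auto simp: abs_mult intro!: mult_mono)
  qed
  have pint: "integrable ?S (\<lambda>x. poly q (x \<bullet> y) * ?Y x)" for q :: "real poly" and y
    by (intro sphere_integrable_continuous continuous_intros continuous_real_sph_harm)
  \<comment> \<open>From \<open>n = l\<close> on, the partial sum reproduces
    \<open>\<phi> l * Y\<close> exactly: the factor \<open>4 pi / (2 l + 1)\<close> of the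
    Funk--Hecke identity cancels the weight of the series.\<close>
  have h: "h y = (\<integral>x. F n x y * ?Y x \<partial>?S)" if y: "y \<in> S2" and n: "n \<ge> l" for n y
  proof -
    have "(\<integral>x. poly (p n) (x \<bullet> y) * ?Y x \<partial>?S)
      = (\<integral>x. (\<Sum>j=1..n. \<phi> j * ((2 * real j + 1) / (4 * pi)) * (poly (legendre j) (x \<bullet> y) * ?Y x)) \<partial>?S)"
      unfolding p_def poly_sum sum_distrib_right by (simp add: mult.assoc)
    also have "\<dots> = (\<Sum>j=1..n. \<phi> j * ((2 * real j + 1) / (4 * pi)) * (\<integral>x. poly (legendre j) (x \<bullet> y) * ?Y x \<partial>?S))"
      using pint by (subst Bochner_Integration.integral_sum) auto
    also have "\<dots> = (\<Sum>j=1..n. if j = l then \<phi> l * ((2 * real l + 1) / (4 * pi)) * (4 * pi / (2 * real l + 1) * ?Y y) else 0)"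
      unfolding legendre_funk_hecke[OF m y] by (intro sum.cong refl) auto
    also have "\<dots> = \<phi> l * ?Y y"
      using n l by (simp add: sum.delta)
    finally have pY: "(\<integral>x. poly (p n) (x \<bullet> y) * ?Y x \<partial>?S) = \<phi> l * ?Y y" .
    have "(\<integral>x. F n x y * ?Y x \<partial>?S) + (\<integral>x. poly (p n) (x \<bullet> y) * ?Y x \<partial>?S) = (\<integral>x. kc (x \<bullet> y) * ?Y x \<partial>?S)"
      by (subst Bochner_Integration.integral_add[OF Fint[OF y] pint, symmetric]) (simp add: F_def algebra_simps)
    then show ?thesis by (simp add: h_def pY)
  qed
  have [measurable]: "h \<in> borel_measurable ?S"
    unfolding h_def by measurable
  define \<mu> where "\<mu> = measure (?S \<Otimes>\<^sub>M ?S) (space (?S \<Otimes>\<^sub>M ?S))"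
  have F2int: "integrable (?S \<Otimes>\<^sub>M ?S) (\<lambda>z. (F n (fst z) (snd z))\<^sup>2)"
    and F1int: "integrable (?S \<Otimes>\<^sub>M ?S) (\<lambda>z. \<bar>F n (fst z) (snd z)\<bar>)" for n
  proof -
    obtain C where C: "C \<ge> 0" "\<forall>x\<in>S2. \<forall>y\<in>S2. \<bar>F n x y\<bar> \<le> C" using Fb by blast
    have C2: "(F n x y)\<^sup>2 \<le> C\<^sup>2" if "x \<in> S2" "y \<in> S2" for x y
      using C that by (intro abs_le_square_iff[THEN iffD1]) force
    show "integrable (?S \<Otimes>\<^sub>M ?S) (\<lambda>z. (F n (fst z) (snd z))\<^sup>2)"
      using C2 Fm[of n] by (intro SS.integrable_const_bound[of _ "C\<^sup>2"] AE_I2) (auto simp: space_pair_measure case_prod_beta')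
    show "integrable (?S \<Otimes>\<^sub>M ?S) (\<lambda>z. \<bar>F n (fst z) (snd z)\<bar>)"
      using C Fm[of n] by (intro SS.integrable_const_bound[of _ "C"] AE_I2) (auto simp: space_pair_measure case_prod_beta')
  qed
  have hint: "integrable ?S (\<lambda>y. \<bar>h y\<bar>)"
  proof -
    obtain C where C: "C \<ge> 0" "\<forall>x\<in>S2. \<forall>y\<in>S2. \<bar>F l x y\<bar> \<le> C" using Fb by blast
    have "\<bar>h y\<bar> \<le> measure ?S S2 * (C * B)" if "y \<in> S2" for y
    proof -
      have "\<bar>h y\<bar> \<le> (\<integral>x. \<bar>F l x y * ?Y x\<bar> \<partial>?S)"
        unfolding h[OF that order.refl] by (rule integral_abs_bound)
      also have "\<dots> \<le> (\<integral>x. C * B \<partial>?S)"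
      proof (rule integral_mono)
        show "integrable ?S (\<lambda>x. \<bar>F l x y * ?Y x\<bar>)" by (rule integrable_abs[OF Fint[OF that]])
      qed (use B C that in \<open>auto simp: abs_mult intro!: mult_mono\<close>)
      finally show ?thesis by simp
    qed
    then show ?thesis by (intro S.integrable_const_bound[of _ "measure ?S S2 * (C * B)"] AE_I2) auto
  qed
  have bound: "?I \<le> B * (e * \<mu> + I n / e)" if e: "e > 0" and n: "n \<ge> l" for e n
  proof -
    have hb: "\<bar>h y\<bar> \<le> B * (\<integral>x. \<bar>F n x y\<bar> \<partial>?S)" if y: "y \<in> S2" for y
    proof -
      obtain C where C: "C \<ge> 0" "\<forall>x\<in>S2. \<forall>y\<in>S2. \<bar>F n x y\<bar> \<le> C" using Fb by blast
      have [measurable]: "(\<lambda>x. F n x y) \<in> borel_measurable ?S" unfolding F_def by measurable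
      have int: "integrable ?S (\<lambda>x. \<bar>F n x y\<bar>)"
        using C y by (intro S.integrable_const_bound[of _ C] AE_I2) auto
      have "\<bar>h y\<bar> \<le> (\<integral>x. \<bar>F n x y * ?Y x\<bar> \<partial>?S)"
        unfolding h[OF y n] by (rule integral_abs_bound)
      also have "\<dots> \<le> (\<integral>x. B * \<bar>F n x y\<bar> \<partial>?S)"
      proof (rule integral_mono)
        show "integrable ?S (\<lambda>x. \<bar>F n x y * ?Y x\<bar>)" by (rule integrable_abs[OF Fint[OF y]])
        show "integrable ?S (\<lambda>x. B * \<bar>F n x y\<bar>)" using int by (rule integrable_mult_right)
      qed (use B in \<open>auto simp: abs_mult mult.commute intro!: mult_mono\<close>)
      finally show ?thesis by simp
    qed
    have Fi: "integrable ?S (\<lambda>y. \<integral>x. \<bar>F n x y\<bar> \<partial>?S)"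
      using SS.integrable_snd[of "\<lambda>x y. \<bar>F n x y\<bar>"] F1int[of n] by (simp add: case_prod_beta')
    have "?I \<le> (\<integral>y. B * (\<integral>x. \<bar>F n x y\<bar> \<partial>?S) \<partial>?S)"
      using hb Fi by (intro integral_mono hint integrable_mult_right) auto
    also have "\<dots> = B * (\<integral>z. \<bar>F n (fst z) (snd z)\<bar> \<partial>(?S \<Otimes>\<^sub>M ?S))"
      using SS.integral_snd[of "\<lambda>x y. \<bar>F n x y\<bar>"] F1int[of n] by (simp add: case_prod_beta')
    also have "\<dots> \<le> B * (\<integral>z. e + (F n (fst z) (snd z))\<^sup>2 / e \<partial>(?S \<Otimes>\<^sub>M ?S))"
      using B F1int F2int e by (intro mult_left_mono integral_mono) (auto intro: abs_le_eps_square)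
    also have "\<dots> = B * (e * \<mu> + I n / e)"
      using F2int by (simp add: I_def \<mu>_def)
    finally show ?thesis .
  qed
  have *: "?I \<le> B * (e * \<mu>)" if e: "e > 0" for e
  proof (rule tendsto_lowerbound)
    show "(\<lambda>n. B * (e * \<mu> + I n / e)) \<longlonglongrightarrow> B * (e * \<mu>)"
      using e by (auto intro!: tendsto_eq_intros I)
    show "eventually (\<lambda>n. ?I \<le> B * (e * \<mu> + I n / e)) sequentially"
      using bound[OF e] by (auto simp: eventually_sequentially)
  qed simp
  have "?I \<le> 0"
  proof (rule field_le_epsilon)
    fix e :: real assume e: "0 < e"
    have "\<mu> \<ge> 0" by (simp add: \<mu>_def)
    \<comment> \<open>The summand 1 in the denominator avoids deciding whether the total mass is
      positive.\<close>
    have "?I \<le> B * (e / (B * (\<mu> + 1)) * \<mu>)"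
      using e B \<open>\<mu> \<ge> 0\<close> by (intro *) (simp add: add_nonneg_pos)
    also have "\<dots> = e * (\<mu> / (\<mu> + 1))" using B by simp
    also have "\<dots> \<le> e * 1" using e \<open>\<mu> \<ge> 0\<close> by (intro mult_left_mono) auto
    finally show "?I \<le> 0 + e" by simp
  qed
  moreover have "?I \<ge> 0" by simp
  ultimately have h0: "?I = 0" by linarith
  have "AE y in ?S. \<bar>h y\<bar> = 0"
    using integral_nonneg_eq_0_iff_AE[OF hint] h0 by simp
  then show ?thesis
  proof (rule AE_mp, intro AE_I2 impI)
    fix y assume y: "y \<in> space ?S" and 0: "\<bar>h y\<bar> = 0"
    have "(\<integral>x. k (x \<bullet> y) * ?Y x \<partial>?S) = (\<integral>x. kc (x \<bullet> y) * ?Y x \<partial>?S)"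
      using y by (intro Bochner_Integration.integral_cong) (auto simp: kc)
    then show "(\<integral>x. k (x \<bullet> y) * ?Y x \<partial>?S) = \<phi> l * ?Y y" using 0 by (simp add: h_def)
  qed
qed

section \<open>Random fields on the sphere\<close>

text \<open>Cauchy--Schwarz against the constant 1, read off from the nonnegative integral of
  \<open>(\<mu> f - a)^2\<close>; a null measure is separated because the final division by the
  total mass fails there.\<close>

lemma (in finite_measure) integral_square_le:
  fixes f :: "'a \<Rightarrow> real"
  assumes f: "integrable M f" and f2: "integrable M (\<lambda>x. (f x)\<^sup>2)"
  shows "(\<integral>x. f x \<partial>M)\<^sup>2 \<le> measure M (space M) * (\<integral>x. (f x)\<^sup>2 \<partial>M)"
proof -
  define \<mu> a where "\<mu> = measure M (space M)" and "a = (\<integral>x. f x \<partial>M)"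
  show ?thesis
  proof (cases "\<mu> = 0")
    case True
    then have "emeasure M (space M) = 0" by (simp add: \<mu>_def emeasure_eq_measure)
    then have "AE x in M. f x = 0" by (intro AE_I[of _ _ "space M"]) auto
    then have "a = 0" unfolding a_def by (simp add: integral_eq_zero_AE)
    then show ?thesis by (simp add: a_def)
  next
    case False
    then have \<mu>: "\<mu> > 0" by (simp add: \<mu>_def zero_less_measure_iff)
    have "0 \<le> (\<integral>x. (\<mu> * f x - a)\<^sup>2 \<partial>M)" by simp
    also have "\<dots> = (\<integral>x. \<mu>\<^sup>2 * (f x)\<^sup>2 - 2 * \<mu> * a * f x + a\<^sup>2 \<partial>M)"
      by (simp add: power2_diff power_mult_distrib algebra_simps)
    also have "\<dots> = \<mu>\<^sup>2 * (\<integral>x. (f x)\<^sup>2 \<partial>M) - 2 * \<mu> * a * a + a\<^sup>2 * \<mu>"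
      using f f2 by (simp add: a_def \<mu>_def mult.commute)
    also have "\<dots> = \<mu> * (\<mu> * (\<integral>x. (f x)\<^sup>2 \<partial>M) - a\<^sup>2)"
      by (simp add: power2_eq_square algebra_simps)
    finally show ?thesis using \<mu> by (simp add: zero_le_mult_iff a_def \<mu>_def)
  qed
qed

lemma abs_le_1_plus_power4: "\<bar>x\<bar> \<le> 1 + (x::real) ^ 4" and square_le_1_plus_power4: "x\<^sup>2 \<le> 1 + (x::real) ^ 4"
proof -
  have 1: "2 * \<bar>x\<bar> \<le> 1 + x\<^sup>2" using sum_squares_bound[of "\<bar>x\<bar>" 1] by (simp add: power2_eq_square)
  have 2: "2 * x\<^sup>2 \<le> 1 + x ^ 4" using sum_squares_bound[of "x\<^sup>2" 1] by (simp add: power_even_abs_numeral flip: power_mult)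
  have 3: "x\<^sup>2 \<ge> 0" by simp
  have 4: "x ^ 4 \<ge> 0" by simp
  show "\<bar>x\<bar> \<le> 1 + x ^ 4" using 1 2 3 4 by linarith
  show "x\<^sup>2 \<le> 1 + x ^ 4" using 2 3 4 by linarith
qed

lemma (in finite_measure) integrable_of_power4:
  fixes f :: "'a \<Rightarrow> real"
  assumes [measurable]: "f \<in> borel_measurable M" and f: "integrable M (\<lambda>x. f x ^ 4)"
  shows "integrable M f" "integrable M (\<lambda>x. (f x)\<^sup>2)"
proof -
  have i: "integrable M (\<lambda>x. 1 + f x ^ 4)" using f by simp
  show "integrable M f"
    by (rule Bochner_Integration.integrable_bound[OF i]) (use abs_le_1_plus_power4 in \<open>auto intro!: AE_I2 order.trans[OF _ abs_ge_self]\<close>)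
  show "integrable M (\<lambda>x. (f x)\<^sup>2)"
    by (rule Bochner_Integration.integrable_bound[OF i]) (use square_le_1_plus_power4 in \<open>auto intro!: AE_I2 order.trans[OF _ abs_ge_self]\<close>)
qed

text \<open>A fourth moment bound uniform in the point survives integration over the sphere, and the
  resulting fourth moment of a coefficient controls the variance of its square, as the law of large
  numbers below requires.\<close>

locale sphere_field = prob_space M for M :: "'w measure" +
  fixes X :: "real ^ 3 \<Rightarrow> 'w \<Rightarrow> real" and B :: real
  assumes joint [measurable]: "case_prod X \<in> borel_measurable (sphere_measure \<Otimes>\<^sub>M M)"
    and fourth_integrable: "x \<in> S2 \<Longrightarrow> integrable M (\<lambda>\<omega>. X x \<omega> ^ 4)"
    and fourth_bound: "x \<in> S2 \<Longrightarrow> (\<integral>\<omega>. X x \<omega> ^ 4 \<partial>M) \<le> B"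
begin

sublocale S: finite_measure sphere_measure by (rule finite_measure_sphere)
sublocale P: pair_sigma_finite sphere_measure M ..
sublocale P: finite_measure "sphere_measure \<Otimes>\<^sub>M M"
  by (rule finite_measure_pair_measure) unfold_locales

lemma slice_measurable: "x \<in> S2 \<Longrightarrow> X x \<in> borel_measurable M"
  using measurable_Pair2[OF joint, of x] by simp

lemma path_measurable: "\<omega> \<in> space M \<Longrightarrow> (\<lambda>x. X x \<omega>) \<in> borel_measurable sphere_measure"
  using measurable_Pair1[OF joint, of \<omega>] by simp

lemma pair_integrable_4: "integrable (sphere_measure \<Otimes>\<^sub>M M) (\<lambda>z. X (fst z) (snd z) ^ 4)"
proof -
  have "integrable (sphere_measure \<Otimes>\<^sub>M M) (\<lambda>(x, \<omega>). X x \<omega> ^ 4)"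
  proof (rule P.Fubini_integrable)
    show "integrable sphere_measure (\<lambda>x. \<integral>\<omega>. norm (case (x, \<omega>) of (x, \<omega>) \<Rightarrow> X x \<omega> ^ 4) \<partial>M)"
    proof (rule S.integrable_const_bound[of _ B])
      show "AE x in sphere_measure. norm (\<integral>\<omega>. norm (case (x, \<omega>) of (x, \<omega>) \<Rightarrow> X x \<omega> ^ 4) \<partial>M) \<le> B"
        using fourth_bound by (intro AE_I2) simp
    qed measurable
    show "AE x in sphere_measure. integrable M (\<lambda>\<omega>. case (x, \<omega>) of (x, \<omega>) \<Rightarrow> X x \<omega> ^ 4)"
      using fourth_integrable by (intro AE_I2) simp
  qed measurable
  then show ?thesis by (simp add: case_prod_beta')
qed

lemma pair_integrable: "integrable (sphere_measure \<Otimes>\<^sub>M M) (\<lambda>z. X (fst z) (snd z))"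
  by (rule P.integrable_of_power4(1)[OF _ pair_integrable_4]) (use joint in \<open>simp add: case_prod_beta'\<close>)

lemma AE_path_integrable_4: "AE \<omega> in M. integrable sphere_measure (\<lambda>x. X x \<omega> ^ 4)"
  using P.AE_integrable_snd[of "\<lambda>x \<omega>. X x \<omega> ^ 4"] pair_integrable_4 by (simp add: case_prod_beta')

lemma path_integrable_4:
  "integrable M (\<lambda>\<omega>. \<integral>x. X x \<omega> ^ 4 \<partial>sphere_measure)"
  "(\<integral>\<omega>. (\<integral>x. X x \<omega> ^ 4 \<partial>sphere_measure) \<partial>M) \<le> measure sphere_measure S2 * B"
proof -
  have i: "integrable (sphere_measure \<Otimes>\<^sub>M M) (case_prod (\<lambda>x \<omega>. X x \<omega> ^ 4))"
    using pair_integrable_4 by (simp add: case_prod_beta')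
  show "integrable M (\<lambda>\<omega>. \<integral>x. X x \<omega> ^ 4 \<partial>sphere_measure)"
    by (rule P.integrable_snd[OF i])
  have "(\<integral>\<omega>. (\<integral>x. X x \<omega> ^ 4 \<partial>sphere_measure) \<partial>M) = (\<integral>x. (\<integral>\<omega>. X x \<omega> ^ 4 \<partial>M) \<partial>sphere_measure)"
    by (rule P.Fubini_integral[OF i])
  also have "\<dots> \<le> (\<integral>x. B \<partial>sphere_measure)"
    using P.integrable_fst[OF i] fourth_bound by (intro integral_mono) auto
  finally show "(\<integral>\<omega>. (\<integral>x. X x \<omega> ^ 4 \<partial>sphere_measure) \<partial>M) \<le> measure sphere_measure S2 * B" by simp
qed

end

locale sphere_field_coeff = sphere_field M X B for M :: "'w measure" and X B +
  fixes Y :: "real ^ 3 \<Rightarrow> real" and b :: real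
  assumes Y [measurable]: "Y \<in> borel_measurable sphere_measure"
    and Y_bound: "x \<in> S2 \<Longrightarrow> \<bar>Y x\<bar> \<le> b"
begin

definition coeff where "coeff \<omega> = (\<integral>x. X x \<omega> * Y x \<partial>sphere_measure)"

lemma coeff_measurable [measurable]: "coeff \<in> borel_measurable M"
  unfolding coeff_def by measurable

text \<open>The cube of the area comes from applying Cauchy--Schwarz twice on the sphere,
  \<open>b ^ 4\<close> from the weight, and the last factor from integrating the fourth moment bound
  over the sphere.\<close>

definition K4 where "K4 = measure sphere_measure S2 ^ 3 * b ^ 4 * (measure sphere_measure S2 * B)"

lemma coeff_bound_AE:
  "AE \<omega> in M. coeff \<omega> ^ 4 \<le> measure sphere_measure S2 ^ 3 * b ^ 4 * (\<integral>x. X x \<omega> ^ 4 \<partial>sphere_measure)"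
  using AE_path_integrable_4
proof (rule AE_mp, intro AE_I2 impI)
  fix \<omega> assume \<omega>: "\<omega> \<in> space M" and i4: "integrable sphere_measure (\<lambda>x. X x \<omega> ^ 4)"
  let ?\<mu> = "measure sphere_measure S2"
  note [measurable] = path_measurable[OF \<omega>]
  have bnd: "(X x \<omega> * Y x) ^ 4 \<le> b ^ 4 * X x \<omega> ^ 4" if "x \<in> S2" for x
  proof -
    have "\<bar>Y x\<bar> ^ 4 \<le> b ^ 4" using Y_bound[OF that] by (intro power_mono) auto
    then have "Y x ^ 4 \<le> b ^ 4" by simp
    then have "Y x ^ 4 * X x \<omega> ^ 4 \<le> b ^ 4 * X x \<omega> ^ 4" by (intro mult_right_mono) auto
    then show ?thesis by (simp add: power_mult_distrib mult.commute)
  qed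
  have f4: "integrable sphere_measure (\<lambda>x. (X x \<omega> * Y x) ^ 4)"
    by (rule Bochner_Integration.integrable_bound[OF integrable_mult_right[OF i4, of "b ^ 4"]])
       (use bnd in \<open>auto intro!: AE_I2\<close>)
  have f: "integrable sphere_measure (\<lambda>x. X x \<omega> * Y x)" and f2: "integrable sphere_measure (\<lambda>x. (X x \<omega> * Y x)\<^sup>2)"
    using S.integrable_of_power4[OF _ f4] by auto
  have "(coeff \<omega>)\<^sup>2 \<le> ?\<mu> * (\<integral>x. (X x \<omega> * Y x)\<^sup>2 \<partial>sphere_measure)"
    unfolding coeff_def using S.integral_square_le[OF f f2] by simp
  then have "((coeff \<omega>)\<^sup>2)\<^sup>2 \<le> (?\<mu> * (\<integral>x. (X x \<omega> * Y x)\<^sup>2 \<partial>sphere_measure))\<^sup>2"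
    by (intro power_mono) auto
  also have "\<dots> = ?\<mu>\<^sup>2 * (\<integral>x. (X x \<omega> * Y x)\<^sup>2 \<partial>sphere_measure)\<^sup>2"
    by (simp add: power_mult_distrib)
  also have "\<dots> \<le> ?\<mu>\<^sup>2 * (?\<mu> * (\<integral>x. ((X x \<omega> * Y x)\<^sup>2)\<^sup>2 \<partial>sphere_measure))"
    using S.integral_square_le[OF f2] f4 by (intro mult_left_mono) (auto simp flip: power_mult)
  also have "\<dots> = ?\<mu> ^ 3 * (\<integral>x. (X x \<omega> * Y x) ^ 4 \<partial>sphere_measure)"
    by (simp add: power2_eq_square[of ?\<mu>] power3_eq_cube flip: power_mult)
  also have "\<dots> \<le> ?\<mu> ^ 3 * (\<integral>x. b ^ 4 * X x \<omega> ^ 4 \<partial>sphere_measure)"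
    using f4 i4 bnd by (intro mult_left_mono integral_mono integrable_mult_right) auto
  finally show "coeff \<omega> ^ 4 \<le> ?\<mu> ^ 3 * b ^ 4 * (\<integral>x. X x \<omega> ^ 4 \<partial>sphere_measure)"
    by (simp add: mult_ac flip: power_mult)
qed

lemma coeff_integrable_4: "integrable M (\<lambda>\<omega>. coeff \<omega> ^ 4)"
  by (rule Bochner_Integration.integrable_bound[OF integrable_mult_right[OF path_integrable_4(1), of "measure sphere_measure S2 ^ 3 * b ^ 4"]])
     (use coeff_bound_AE in \<open>auto elim!: eventually_mono intro: order.trans[OF _ abs_ge_self]\<close>)

lemma coeff_fourth_bound: "(\<integral>\<omega>. coeff \<omega> ^ 4 \<partial>M) \<le> K4"
proof -
  have "(\<integral>\<omega>. coeff \<omega> ^ 4 \<partial>M) \<le> (\<integral>\<omega>. measure sphere_measure S2 ^ 3 * b ^ 4 * (\<integral>x. X x \<omega> ^ 4 \<partial>sphere_measure) \<partial>M)"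
    by (intro integral_mono_AE coeff_integrable_4 integrable_mult_right path_integrable_4 coeff_bound_AE)
  also have "\<dots> = measure sphere_measure S2 ^ 3 * b ^ 4 * (\<integral>\<omega>. (\<integral>x. X x \<omega> ^ 4 \<partial>sphere_measure) \<partial>M)"
    by simp
  also have "\<dots> \<le> K4" unfolding K4_def
    by (intro mult_left_mono path_integrable_4) auto
  finally show ?thesis .
qed

lemma coeff_integrable: "integrable M coeff" "integrable M (\<lambda>\<omega>. (coeff \<omega>)\<^sup>2)"
  using integrable_of_power4[OF coeff_measurable coeff_integrable_4] by auto

text \<open>Fubini with a bounded random weight: an identity for the means of \<open>X x * g\<close>
  at every point of the sphere passes to the coefficient. The weights used are 1 and an indicator
  minus its conditional expectation.\<close>

lemma coeff_times_expectation:
  assumes g [measurable]: "g \<in> borel_measurable M" and gb: "AE \<omega> in M. \<bar>g \<omega>\<bar> \<le> 1"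
  shows "(\<integral>\<omega>. coeff \<omega> * g \<omega> \<partial>M) = (\<integral>x. Y x * (\<integral>\<omega>. X x \<omega> * g \<omega> \<partial>M) \<partial>sphere_measure)"
proof -
  have "AE x in sphere_measure. AE \<omega> in M. \<bar>g \<omega>\<bar> \<le> 1" using gb by simp
  then have gb': "AE z in sphere_measure \<Otimes>\<^sub>M M. \<bar>g (snd z)\<bar> \<le> 1"
    by (subst P.AE_pair_iff[symmetric]) measurable
  have i: "integrable (sphere_measure \<Otimes>\<^sub>M M) (\<lambda>(x, \<omega>). X x \<omega> * Y x * g \<omega>)"
  proof (rule Bochner_Integration.integrable_bound[OF integrable_mult_right[OF pair_integrable, of b]])
    show "AE z in sphere_measure \<Otimes>\<^sub>M M. norm (case z of (x, \<omega>) \<Rightarrow> X x \<omega> * Y x * g \<omega>) \<le> norm (b * X (fst z) (snd z))"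
      using gb'
    proof (rule AE_mp, intro AE_I2 impI)
      fix z assume z: "z \<in> space (sphere_measure \<Otimes>\<^sub>M M)" and g: "\<bar>g (snd z)\<bar> \<le> 1"
      have Y: "\<bar>Y (fst z)\<bar> \<le> b" using z Y_bound by (auto simp: space_pair_measure)
      have "\<bar>Y (fst z)\<bar> * \<bar>g (snd z)\<bar> \<le> b * 1"
        using Y g by (intro mult_mono) auto
      then have "\<bar>X (fst z) (snd z)\<bar> * (\<bar>Y (fst z)\<bar> * \<bar>g (snd z)\<bar>) \<le> \<bar>X (fst z) (snd z)\<bar> * \<bar>b\<bar>"
        by (intro mult_left_mono) auto
      then show "norm (case z of (x, \<omega>) \<Rightarrow> X x \<omega> * Y x * g \<omega>) \<le> norm (b * X (fst z) (snd z))"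
        by (simp add: case_prod_beta' abs_mult mult_ac)
    qed
  qed measurable
  have "(\<integral>\<omega>. coeff \<omega> * g \<omega> \<partial>M) = (\<integral>\<omega>. (\<integral>x. X x \<omega> * Y x * g \<omega> \<partial>sphere_measure) \<partial>M)"
    by (simp add: coeff_def)
  also have "\<dots> = (\<integral>x. (\<integral>\<omega>. X x \<omega> * Y x * g \<omega> \<partial>M) \<partial>sphere_measure)"
    by (rule P.Fubini_integral[OF i])
  also have "\<dots> = (\<integral>x. Y x * (\<integral>\<omega>. X x \<omega> * g \<omega> \<partial>M) \<partial>sphere_measure)"
    by (simp add: mult_ac flip: integral_mult_right_zero)
  finally show ?thesis .
qed

lemma slice_integrable: "x \<in> S2 \<Longrightarrow> integrable M (X x)"
  by (rule integrable_of_power4(1)[OF slice_measurable fourth_integrable])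

lemma coeff_expectation_0:
  assumes "\<And>x. x \<in> S2 \<Longrightarrow> (\<integral>\<omega>. X x \<omega> \<partial>M) = 0"
  shows "(\<integral>\<omega>. coeff \<omega> \<partial>M) = 0"
proof -
  have "(\<integral>\<omega>. coeff \<omega> \<partial>M) = (\<integral>x. Y x * (\<integral>\<omega>. X x \<omega> \<partial>M) \<partial>sphere_measure)"
    using coeff_times_expectation[of "\<lambda>_. 1"] by simp
  also have "\<dots> = (\<integral>x. 0 \<partial>sphere_measure)"
    by (intro Bochner_Integration.integral_cong) (auto simp: assms)
  finally show ?thesis by simp
qed

text \<open>A pathwise integral over the sphere need not be measurable with respect to the sigma-algebra
  generated by the values of the field, but by Fubini's theorem it is equal, almost surely, to its
  conditional expectation.\<close>

lemma coeff_cond_exp: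
  assumes F: "subalgebra M F" and XF: "\<And>x. x \<in> S2 \<Longrightarrow> X x \<in> borel_measurable F"
  shows "AE \<omega> in M. real_cond_exp M F coeff \<omega> = coeff \<omega>"
proof -
  interpret F: finite_measure_subalgebra M F using F by unfold_locales
  define c where "c = real_cond_exp M F coeff"
  have c: "integrable M c" "c \<in> borel_measurable F" "c \<in> borel_measurable M"
    using F.real_cond_exp_int[OF coeff_integrable(1)] by (auto simp: c_def)
  \<comment> \<open>On an arbitrary event, replace the indicator by its conditional expectation
    \<open>h\<close>. The difference is orthogonal to each \<open>X x\<close>, which is measurable
    for \<open>F\<close>, hence by Fubini to \<open>coeff\<close>. Since \<open>h\<close> is
    measurable for \<open>F\<close>, \<open>coeff\<close> may then be exchanged for
    \<open>c\<close>, and finally \<open>h\<close> for the indicator again.\<close>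
  have eq: "(\<integral>\<omega>\<in>A. coeff \<omega> \<partial>M) = (\<integral>\<omega>\<in>A. c \<omega> \<partial>M)" if A [measurable]: "A \<in> sets M" for A
  proof -
    let ?i = "indicator A :: 'w \<Rightarrow> real"
    define h where "h = real_cond_exp M F ?i"
    have ii: "integrable M ?i" by (simp add: emeasure_eq_measure)
    have h [measurable]: "h \<in> borel_measurable F" "h \<in> borel_measurable M" by (simp_all add: h_def)
    have "AE \<omega> in M. h \<omega> \<ge> 0" "AE \<omega> in M. h \<omega> \<le> 1"
      unfolding h_def by (intro F.real_cond_exp_ge_c F.real_cond_exp_le_c ii AE_I2; simp add: indicator_def)+
    then have hb: "AE \<omega> in M. \<bar>h \<omega>\<bar> \<le> 1" and gb: "AE \<omega> in M. \<bar>?i \<omega> - h \<omega>\<bar> \<le> 1"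
      by (eventually_elim; simp add: indicator_def)+
    have mult: "integrable M (\<lambda>\<omega>. f \<omega> * h \<omega>)" "integrable M (\<lambda>\<omega>. f \<omega> * ?i \<omega>)" if f: "integrable M f" for f
    proof -
      have [measurable]: "f \<in> borel_measurable M" using f by auto
      show "integrable M (\<lambda>\<omega>. f \<omega> * ?i \<omega>)"
        using integrable_mult_indicator[OF A f] by (simp add: mult.commute)
      show "integrable M (\<lambda>\<omega>. f \<omega> * h \<omega>)"
      proof (rule Bochner_Integration.integrable_bound[OF f])
        show "AE \<omega> in M. norm (f \<omega> * h \<omega>) \<le> norm (f \<omega>)"
          using hb by eventually_elim (auto simp: abs_mult intro: mult_left_le)
      qed measurable
    qed
    have X0: "(\<integral>\<omega>. X x \<omega> * (?i \<omega> - h \<omega>) \<partial>M) = 0" if x: "x \<in> S2" for x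
    proof -
      have "(\<integral>\<omega>. X x \<omega> * h \<omega> \<partial>M) = (\<integral>\<omega>. X x \<omega> * ?i \<omega> \<partial>M)"
        unfolding h_def
        by (rule F.real_cond_exp_intg(2)[OF mult(2)[OF slice_integrable[OF x]] XF[OF x]]) simp
      then show ?thesis using mult[OF slice_integrable[OF x]] by (simp add: right_diff_distrib)
    qed
    have "(\<integral>\<omega>. coeff \<omega> * (?i \<omega> - h \<omega>) \<partial>M) = (\<integral>x. Y x * (\<integral>\<omega>. X x \<omega> * (?i \<omega> - h \<omega>) \<partial>M) \<partial>sphere_measure)"
      by (rule coeff_times_expectation[OF _ gb]) measurable
    also have "\<dots> = (\<integral>x. 0 \<partial>sphere_measure)"
      by (intro Bochner_Integration.integral_cong) (auto simp: X0)
    finally have "(\<integral>\<omega>. coeff \<omega> * ?i \<omega> \<partial>M) = (\<integral>\<omega>. coeff \<omega> * h \<omega> \<partial>M)"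
      using mult[OF coeff_integrable(1)] by (simp add: right_diff_distrib)
    also have "\<dots> = (\<integral>\<omega>. h \<omega> * c \<omega> \<partial>M)"
      unfolding c_def using mult(1)[OF coeff_integrable(1)]
      by (subst F.real_cond_exp_intg(2)) (auto simp: mult.commute)
    also have "\<dots> = (\<integral>\<omega>. c \<omega> * ?i \<omega> \<partial>M)"
      using F.real_cond_exp_intg(2)[OF mult(2)[OF c(1)] c(2)] by (simp add: h_def mult.commute)
    finally show ?thesis by (simp add: set_lebesgue_integral_def mult.commute)
  qed
  then have "AE \<omega> in M. coeff \<omega> = c \<omega>"
    using coeff_integrable c by (intro density_unique_real) auto
  then show ?thesis by (auto simp: c_def)
qed

end

section \<open>Law of large numbers for AR(1) processes\<close>

text \<open>\<open>P t\<close> plays the strict past of time t. Independence is stated against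
  single real functions measurable for it, which is the form the martingale computations need.
  Instead of stationarity there is a bound \<open>Ba\<close> on the second moments at all integer
  times, from which constancy is deduced.\<close>

locale ar1_process = prob_space M for M :: "'w measure" +
  fixes \<phi> v Ba Bz :: real and a z :: "int \<Rightarrow> 'w \<Rightarrow> real" and P :: "int \<Rightarrow> 'w measure"
  assumes phi: "\<bar>\<phi>\<bar> < 1"
    and past_subalgebra: "subalgebra M (P t)"
    and a_past: "s < t \<Longrightarrow> a s \<in> borel_measurable (P t)"
    and z_measurable [measurable]: "z t \<in> borel_measurable M"
    and indep: "g \<in> borel_measurable (P t) \<Longrightarrow> indep_var borel (z t) borel g"
    and recursion: "AE \<omega> in M. a t \<omega> = \<phi> * a (t - 1) \<omega> + z t \<omega>"
    and a_square_integrable: "integrable M (\<lambda>\<omega>. (a t \<omega>)\<^sup>2)"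
    and a_square_bound: "(\<integral>\<omega>. (a t \<omega>)\<^sup>2 \<partial>M) \<le> Ba"
    and z_fourth_integrable: "integrable M (\<lambda>\<omega>. z t \<omega> ^ 4)"
    and z_fourth_bound: "(\<integral>\<omega>. z t \<omega> ^ 4 \<partial>M) \<le> Bz"
    and z_mean: "(\<integral>\<omega>. z t \<omega> \<partial>M) = 0"
    and z_variance: "(\<integral>\<omega>. (z t \<omega>)\<^sup>2 \<partial>M) = v"
begin

lemma a_measurable [measurable]: "a t \<in> borel_measurable M"
  using a_past[of t "t + 1"] measurable_from_subalg[OF past_subalgebra] by simp

lemma a_integrable: "integrable M (a t)"
  by (rule square_integrable_imp_integrable[OF a_measurable a_square_integrable])

lemma z_integrable: "integrable M (z t)" "integrable M (\<lambda>\<omega>. (z t \<omega>)\<^sup>2)"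
  using integrable_of_power4[OF z_measurable z_fourth_integrable] by auto

lemma product_integrable:
  fixes f g :: "'w \<Rightarrow> real"
  assumes [measurable]: "f \<in> borel_measurable M" "g \<in> borel_measurable M"
    and "integrable M (\<lambda>x. (f x)\<^sup>2)" "integrable M (\<lambda>x. (g x)\<^sup>2)"
  shows "integrable M (\<lambda>x. f x * g x)"
proof (rule Bochner_Integration.integrable_bound)
  show "integrable M (\<lambda>x. (f x)\<^sup>2 + (g x)\<^sup>2)" using assms by simp
  have "norm (f x * g x) \<le> norm ((f x)\<^sup>2 + (g x)\<^sup>2)" for x
  proof -
    have "2 * \<bar>f x * g x\<bar> \<le> (f x)\<^sup>2 + (g x)\<^sup>2"
      using sum_squares_bound[of "\<bar>f x\<bar>" "\<bar>g x\<bar>"] by (simp add: abs_mult mult.assoc)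
    then show ?thesis by simp
  qed
  then show "AE x in M. norm (f x * g x) \<le> norm ((f x)\<^sup>2 + (g x)\<^sup>2)" by simp
qed measurable

lemma innovation_product:
  fixes g :: "'w \<Rightarrow> real" and f :: "real \<Rightarrow> real"
  assumes g: "g \<in> borel_measurable (P t)" "integrable M g"
    and f [measurable]: "f \<in> borel_measurable borel" and fi: "integrable M (\<lambda>\<omega>. f (z t \<omega>))"
  shows "integrable M (\<lambda>\<omega>. f (z t \<omega>) * g \<omega>)"
    and "(\<integral>\<omega>. f (z t \<omega>) * g \<omega> \<partial>M) = (\<integral>\<omega>. f (z t \<omega>) \<partial>M) * (\<integral>\<omega>. g \<omega> \<partial>M)"
proof -
  have "indep_var borel (f \<circ> z t) borel ((\<lambda>x. x) \<circ> g)"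
    by (rule indep_var_compose[OF indep[OF g(1)]]) auto
  then have i: "indep_var borel (\<lambda>\<omega>. f (z t \<omega>)) borel g" by (simp add: comp_def)
  show "integrable M (\<lambda>\<omega>. f (z t \<omega>) * g \<omega>)" by (rule indep_var_integrable[OF i fi g(2)])
  show "(\<integral>\<omega>. f (z t \<omega>) * g \<omega> \<partial>M) = (\<integral>\<omega>. f (z t \<omega>) \<partial>M) * (\<integral>\<omega>. g \<omega> \<partial>M)"
    by (rule indep_var_lebesgue_integral[OF i fi g(2)])
qed

definition C where "C = v / (1 - \<phi>\<^sup>2)"

lemma phi_square: "\<phi>\<^sup>2 < 1"
  using phi by (simp add: abs_square_less_1)

lemma v_nonneg: "v \<ge> 0"
  using z_variance[of 0] integral_nonneg_AE[of "\<lambda>\<omega>. (z 0 \<omega>)\<^sup>2" M] by simp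

lemma C_nonneg: "C \<ge> 0" and phi_square_C: "\<phi>\<^sup>2 * C = C - v"
  using v_nonneg phi_square by (simp_all add: C_def field_simps)

text \<open>The second moment satisfies \<open>e t = \<phi>\<^sup>2 * e (t - 1) + v\<close> on all of the integers; being
  bounded, it is the constant fixed point.\<close>

lemma a_variance: "(\<integral>\<omega>. (a t \<omega>)\<^sup>2 \<partial>M) = C"
proof -
  define d where "d t = (\<integral>\<omega>. (a t \<omega>)\<^sup>2 \<partial>M) - C" for t
  have step: "d t = \<phi>\<^sup>2 * d (t - 1)" for t
  proof -
    have cross: "integrable M (\<lambda>\<omega>. z t \<omega> * a (t - 1) \<omega>)" "(\<integral>\<omega>. z t \<omega> * a (t - 1) \<omega> \<partial>M) = 0"
      using innovation_product[of "a (t - 1)" t "\<lambda>x. x"] a_past a_integrable z_integrable z_mean by auto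
    have "(\<integral>\<omega>. (a t \<omega>)\<^sup>2 \<partial>M) = (\<integral>\<omega>. \<phi>\<^sup>2 * (a (t - 1) \<omega>)\<^sup>2 + 2 * \<phi> * (z t \<omega> * a (t - 1) \<omega>) + (z t \<omega>)\<^sup>2 \<partial>M)"
    proof (rule integral_cong_AE)
      show "AE \<omega> in M. (a t \<omega>)\<^sup>2 = \<phi>\<^sup>2 * (a (t - 1) \<omega>)\<^sup>2 + 2 * \<phi> * (z t \<omega> * a (t - 1) \<omega>) + (z t \<omega>)\<^sup>2"
        using recursion[of t] by eventually_elim (simp add: power2_eq_square algebra_simps)
    qed measurable
    also have "\<dots> = \<phi>\<^sup>2 * (\<integral>\<omega>. (a (t - 1) \<omega>)\<^sup>2 \<partial>M) + v"
      using cross a_square_integrable z_integrable z_variance by simp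
    finally show ?thesis by (simp add: d_def right_diff_distrib phi_square_C)
  qed
  have "\<bar>d t\<bar> \<le> (\<phi>\<^sup>2) ^ n * (Ba + C)" for n
  proof -
    have "d t = (\<phi>\<^sup>2) ^ n * d (t - int n)"
    proof (induction n)
      case (Suc n)
      have "d t = (\<phi>\<^sup>2) ^ n * (\<phi>\<^sup>2 * d (t - int n - 1))" using Suc step[of "t - int n"] by simp
      also have "t - int n - 1 = t - int (Suc n)" by simp
      finally show ?case by (simp add: mult_ac)
    qed simp
    moreover have "\<bar>d (t - int n)\<bar> \<le> Ba + C"
    proof -
      have "(\<integral>\<omega>. (a (t - int n) \<omega>)\<^sup>2 \<partial>M) \<ge> 0" by simp
      then show ?thesis using a_square_bound[of "t - int n"] C_nonneg unfolding d_def by linarith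
    qed
    ultimately show ?thesis by (simp add: abs_mult mult_left_mono)
  qed
  moreover have "(\<lambda>n. (\<phi>\<^sup>2) ^ n * (Ba + C)) \<longlonglongrightarrow> 0"
    using phi_square by (intro tendsto_mult_left_zero LIMSEQ_power_zero) simp
  ultimately have "\<bar>d t\<bar> \<le> 0"
    by (intro tendsto_lowerbound[of "\<lambda>n. (\<phi>\<^sup>2) ^ n * (Ba + C)" 0 sequentially]) auto
  then show ?thesis by (simp add: d_def)
qed

definition S where "S N \<omega> = (\<Sum>t=1..N. z (int t) \<omega> * a (int t - 1) \<omega>)" for N :: nat
definition W where "W N \<omega> = (\<Sum>t=1..N. (z (int t) \<omega>)\<^sup>2 - v)" for N :: nat

lemma S_measurable [measurable]: "S N \<in> borel_measurable M"
  and W_measurable [measurable]: "W N \<in> borel_measurable M"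
  unfolding S_def[abs_def] W_def[abs_def] by measurable

text \<open>Both sums are martingales: up to null sets the first \<open>N\<close> summands are functions of the past of
  the innovation at time \<open>N + 1\<close>.\<close>

lemma past_versions:
  obtains S' W' where "S' \<in> borel_measurable (P (int N + 1))" "W' \<in> borel_measurable (P (int N + 1))"
    "AE \<omega> in M. S' \<omega> = S N \<omega>" "AE \<omega> in M. W' \<omega> = W N \<omega>"
proof
  \<comment> \<open>Solving the recursion for the innovation gives a function of the observed
    process that is measurable for the past, whereas \<open>z\<close> itself only agrees with it
    almost surely.\<close>
  define z' where "z' t \<omega> = a (int t) \<omega> - \<phi> * a (int t - 1) \<omega>" for t \<omega>
  have zm: "z' t \<in> borel_measurable (P (int N + 1))" if "t \<in> {1..N}" for t
    unfolding z'_def[abs_def] using that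
    by (intro borel_measurable_diff borel_measurable_times borel_measurable_const a_past) auto
  show "(\<lambda>\<omega>. \<Sum>t=1..N. z' t \<omega> * a (int t - 1) \<omega>) \<in> borel_measurable (P (int N + 1))"
    by (intro borel_measurable_sum borel_measurable_times zm a_past) auto
  show "(\<lambda>\<omega>. \<Sum>t=1..N. (z' t \<omega>)\<^sup>2 - v) \<in> borel_measurable (P (int N + 1))"
    by (intro borel_measurable_sum borel_measurable_diff borel_measurable_power borel_measurable_const zm) auto
  have "AE \<omega> in M. \<forall>t\<in>{1..N}. z' t \<omega> = z (int t) \<omega>"
  proof (subst AE_finite_all)
    show "\<forall>t\<in>{1..N}. AE \<omega> in M. z' t \<omega> = z (int t) \<omega>"
    proof
      fix t
      show "AE \<omega> in M. z' t \<omega> = z (int t) \<omega>"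
        using recursion[of "int t"] by eventually_elim (simp add: z'_def)
    qed
  qed simp
  then show "AE \<omega> in M. (\<Sum>t=1..N. z' t \<omega> * a (int t - 1) \<omega>) = S N \<omega>"
    and "AE \<omega> in M. (\<Sum>t=1..N. (z' t \<omega>)\<^sup>2 - v) = W N \<omega>"
    by (eventually_elim; simp add: S_def W_def)+
qed

text \<open>Orthogonality of martingale increments: with the version \<open>S'\<close> in place of
  \<open>S N\<close>, the cross term factors through the zero mean of the new innovation, and the
  diagonal term factors into \<open>v * C\<close>.\<close>

lemma S_second_moment: "integrable M (\<lambda>\<omega>. (S N \<omega>)\<^sup>2) \<and> (\<integral>\<omega>. (S N \<omega>)\<^sup>2 \<partial>M) = real N * (v * C)"
proof (induction N)
  case 0
  show ?case by (simp add: S_def)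
next
  case (Suc N)
  let ?t = "int N + 1"
  obtain S' where S': "S' \<in> borel_measurable (P ?t)" "AE \<omega> in M. S' \<omega> = S N \<omega>"
    using past_versions by blast
  have [measurable]: "S' \<in> borel_measurable M"
    using measurable_from_subalg[OF past_subalgebra S'(1)] .
  have aN: "a (int N) \<in> borel_measurable (P ?t)" by (rule a_past) simp
  have S'2: "integrable M (\<lambda>\<omega>. (S' \<omega>)\<^sup>2)"
    using Suc S'(2) by (subst integrable_cong_AE[of _ _ "\<lambda>\<omega>. (S N \<omega>)\<^sup>2"]) auto
  have g: "(\<lambda>\<omega>. a (int N) \<omega> * S' \<omega>) \<in> borel_measurable (P ?t)"
    by (rule borel_measurable_times[OF aN S'(1)])
  have gi: "integrable M (\<lambda>\<omega>. a (int N) \<omega> * S' \<omega>)"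
    by (rule product_integrable) (auto simp: a_square_integrable S'2)
  have aN2: "(\<lambda>\<omega>. (a (int N) \<omega>)\<^sup>2) \<in> borel_measurable (P ?t)"
    by (rule borel_measurable_power[OF aN])
  have cross: "integrable M (\<lambda>\<omega>. z ?t \<omega> * (a (int N) \<omega> * S' \<omega>))" "(\<integral>\<omega>. z ?t \<omega> * (a (int N) \<omega> * S' \<omega>) \<partial>M) = 0"
    using innovation_product[OF g gi, of "\<lambda>x. x"]
      z_integrable(1)[of ?t] z_mean[of ?t] by simp_all
  have sq: "integrable M (\<lambda>\<omega>. (z ?t \<omega>)\<^sup>2 * (a (int N) \<omega>)\<^sup>2)" "(\<integral>\<omega>. (z ?t \<omega>)\<^sup>2 * (a (int N) \<omega>)\<^sup>2 \<partial>M) = v * C"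
    using innovation_product[OF aN2 a_square_integrable, of "\<lambda>x. x\<^sup>2"]
      z_integrable(2)[of ?t] z_variance[of ?t] a_variance[of "int N"] by simp_all
  have eq: "AE \<omega> in M. (S (Suc N) \<omega>)\<^sup>2 = (S N \<omega>)\<^sup>2 + 2 * (z ?t \<omega> * (a (int N) \<omega> * S' \<omega>)) + (z ?t \<omega>)\<^sup>2 * (a (int N) \<omega>)\<^sup>2"
    using S'(2) by eventually_elim (simp add: S_def power2_eq_square algebra_simps)
  have int: "integrable M (\<lambda>\<omega>. (S N \<omega>)\<^sup>2 + 2 * (z ?t \<omega> * (a (int N) \<omega> * S' \<omega>)) + (z ?t \<omega>)\<^sup>2 * (a (int N) \<omega>)\<^sup>2)"
    using Suc cross sq by simp
  have "integrable M (\<lambda>\<omega>. (S (Suc N) \<omega>)\<^sup>2)"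
    by (subst integrable_cong_AE[OF _ _ eq]) (use int in measurable)
  moreover have "(\<integral>\<omega>. (S (Suc N) \<omega>)\<^sup>2 \<partial>M) = (\<integral>\<omega>. (S N \<omega>)\<^sup>2 \<partial>M) + v * C"
    by (subst integral_cong_AE[OF _ _ eq]) (use Suc cross sq in simp_all)
  ultimately show ?case using Suc by (simp add: algebra_simps)
qed

text \<open>The same orthogonality for centered squares of innovations. The increment has variance
  \<open>E z^4 - v^2\<close>, which is where a fourth moment enters.\<close>

lemma W_second_moment: "integrable M (\<lambda>\<omega>. (W N \<omega>)\<^sup>2) \<and> (\<integral>\<omega>. (W N \<omega>)\<^sup>2 \<partial>M) \<le> real N * (Bz + v\<^sup>2)"
proof (induction N)
  case 0
  show ?case by (simp add: W_def)
next
  case (Suc N)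
  let ?t = "int N + 1"
  obtain W' where W': "W' \<in> borel_measurable (P ?t)" "AE \<omega> in M. W' \<omega> = W N \<omega>"
    using past_versions by blast
  have W'm [measurable]: "W' \<in> borel_measurable M"
    using measurable_from_subalg[OF past_subalgebra W'(1)] .
  have W'2: "integrable M (\<lambda>\<omega>. (W' \<omega>)\<^sup>2)"
    using Suc W'(2) by (subst integrable_cong_AE[of _ _ "\<lambda>\<omega>. (W N \<omega>)\<^sup>2"]) auto
  have W'1: "integrable M W'" by (rule square_integrable_imp_integrable[OF W'm W'2])
  have zv: "integrable M (\<lambda>\<omega>. (z ?t \<omega>)\<^sup>2 - v)" "(\<integral>\<omega>. (z ?t \<omega>)\<^sup>2 - v \<partial>M) = 0"
    using z_integrable z_variance by (simp_all add: prob_space)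
  have cross: "integrable M (\<lambda>\<omega>. ((z ?t \<omega>)\<^sup>2 - v) * W' \<omega>)" "(\<integral>\<omega>. ((z ?t \<omega>)\<^sup>2 - v) * W' \<omega> \<partial>M) = 0"
    using innovation_product[OF W'(1) W'1, of "\<lambda>x. x\<^sup>2 - v"] zv by simp_all
  have zexp: "((z ?t \<omega>)\<^sup>2 - v)\<^sup>2 = z ?t \<omega> ^ 4 - 2 * v * (z ?t \<omega>)\<^sup>2 + v\<^sup>2" for \<omega>
    by (simp add: power2_diff mult_ac flip: power_mult)
  have sq: "integrable M (\<lambda>\<omega>. ((z ?t \<omega>)\<^sup>2 - v)\<^sup>2)" "(\<integral>\<omega>. ((z ?t \<omega>)\<^sup>2 - v)\<^sup>2 \<partial>M) \<le> Bz + v\<^sup>2"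
  proof -
    show "integrable M (\<lambda>\<omega>. ((z ?t \<omega>)\<^sup>2 - v)\<^sup>2)"
      unfolding zexp using z_integrable z_fourth_integrable by simp
    have "(\<integral>\<omega>. ((z ?t \<omega>)\<^sup>2 - v)\<^sup>2 \<partial>M) = (\<integral>\<omega>. z ?t \<omega> ^ 4 \<partial>M) - 2 * v * v + v\<^sup>2"
      unfolding zexp using z_integrable z_fourth_integrable z_variance by (simp add: prob_space)
    then show "(\<integral>\<omega>. ((z ?t \<omega>)\<^sup>2 - v)\<^sup>2 \<partial>M) \<le> Bz + v\<^sup>2"
      using z_fourth_bound[of ?t] v_nonneg mult_nonneg_nonneg[OF v_nonneg v_nonneg] by linarith
  qed
  have eq: "AE \<omega> in M. (W (Suc N) \<omega>)\<^sup>2 = (W N \<omega>)\<^sup>2 + 2 * (((z ?t \<omega>)\<^sup>2 - v) * W' \<omega>) + ((z ?t \<omega>)\<^sup>2 - v)\<^sup>2"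
    using W'(2) by eventually_elim (simp add: W_def power2_eq_square algebra_simps)
  have int: "integrable M (\<lambda>\<omega>. (W N \<omega>)\<^sup>2 + 2 * (((z ?t \<omega>)\<^sup>2 - v) * W' \<omega>) + ((z ?t \<omega>)\<^sup>2 - v)\<^sup>2)"
    using Suc cross sq by simp
  have "integrable M (\<lambda>\<omega>. (W (Suc N) \<omega>)\<^sup>2)"
    by (subst integrable_cong_AE[OF _ _ eq]) (use int in measurable)
  moreover have "(\<integral>\<omega>. (W (Suc N) \<omega>)\<^sup>2 \<partial>M) = (\<integral>\<omega>. (W N \<omega>)\<^sup>2 \<partial>M) + (\<integral>\<omega>. ((z ?t \<omega>)\<^sup>2 - v)\<^sup>2 \<partial>M)"
    by (subst integral_cong_AE[OF _ _ eq]) (use Suc cross sq in simp_all)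
  ultimately show ?case using Suc sq by (simp add: algebra_simps)
qed

text \<open>\<open>abs_le_eps_square\<close> at the scale \<open>sqrt N\<close>: a second moment of
  order N gives a first moment of order \<open>sqrt N\<close>.\<close>

lemma expectation_abs_le_sqrt:
  fixes f :: "'w \<Rightarrow> real"
  assumes [measurable]: "f \<in> borel_measurable M" and i: "integrable M (\<lambda>\<omega>. (f \<omega>)\<^sup>2)"
    and b: "(\<integral>\<omega>. (f \<omega>)\<^sup>2 \<partial>M) \<le> real N * K" and N: "N > 0"
  shows "integrable M f" "(\<integral>\<omega>. \<bar>f \<omega>\<bar> \<partial>M) \<le> sqrt (real N) * (1 + K)"
proof -
  show f: "integrable M f" by (rule square_integrable_imp_integrable[OF assms(1) i])
  have s: "sqrt (real N) > 0" using N by simp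
  have "(\<integral>\<omega>. \<bar>f \<omega>\<bar> \<partial>M) \<le> (\<integral>\<omega>. sqrt (real N) + (f \<omega>)\<^sup>2 / sqrt (real N) \<partial>M)"
    using f i abs_le_eps_square[OF s] by (intro integral_mono) auto
  also have "\<dots> = sqrt (real N) + (\<integral>\<omega>. (f \<omega>)\<^sup>2 \<partial>M) / sqrt (real N)"
    using i by (simp add: prob_space)
  also have "\<dots> \<le> sqrt (real N) + real N * K / sqrt (real N)"
    using b s by (intro add_left_mono divide_right_mono) auto
  also have "\<dots> = sqrt (real N) * (1 + K)"
    using s by (simp add: field_simps flip: power2_eq_square)
  finally show "(\<integral>\<omega>. \<bar>f \<omega>\<bar> \<partial>M) \<le> sqrt (real N) * (1 + K)" .
qed

section \<open>Empirical second and lag-one moments\<close>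

definition s_hat where "s_hat N \<omega> = 1 / real N * (\<Sum>t=1..N. (a (int t - 1) \<omega>)\<^sup>2)" for N :: nat
definition u_hat where "u_hat N \<omega> = 1 / real N * (\<Sum>t=1..N. a (int t) \<omega> * a (int t - 1) \<omega>)" for N :: nat
definition dev where "dev N \<omega> = \<bar>s_hat N \<omega> - C\<bar> + \<bar>u_hat N \<omega> - \<phi> * C\<bar>" for N :: nat

lemma AE_recursion_all: "AE \<omega> in M. \<forall>t. a t \<omega> = \<phi> * a (t - 1) \<omega> + z t \<omega>"
  by (subst AE_all_countable) (use recursion in blast)

text \<open>Squaring the recursion and summing over time makes the squares telescope, leaving two
  boundary terms and the two martingales.\<close>

lemma s_hat_identity:
  assumes N: "N > 0"
  shows "AE \<omega> in M. s_hat N \<omega> - C = ((a 0 \<omega>)\<^sup>2 - (a (int N) \<omega>)\<^sup>2 + 2 * \<phi> * S N \<omega> + W N \<omega>) / (real N * (1 - \<phi>\<^sup>2))"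
  using AE_recursion_all
proof eventually_elim
  case (elim \<omega>)
  have "(1 - \<phi>\<^sup>2) * ((\<Sum>t=1..n. (a (int t - 1) \<omega>)\<^sup>2) - real n * C) = (a 0 \<omega>)\<^sup>2 - (a (int n) \<omega>)\<^sup>2 + 2 * \<phi> * S n \<omega> + W n \<omega>" for n
  proof (induction n)
    case 0 show ?case by (simp add: S_def W_def)
  next
    case (Suc n)
    have r: "a (int n + 1) \<omega> = \<phi> * a (int n) \<omega> + z (int n + 1) \<omega>" using elim[rule_format, of "int n + 1"] by simp
    have "(1 - \<phi>\<^sup>2) * ((\<Sum>t=1..Suc n. (a (int t - 1) \<omega>)\<^sup>2) - real (Suc n) * C)
      = (1 - \<phi>\<^sup>2) * ((\<Sum>t=1..n. (a (int t - 1) \<omega>)\<^sup>2) - real n * C) + (1 - \<phi>\<^sup>2) * (a (int n) \<omega>)\<^sup>2 - v"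
    proof -
      have "(1 - \<phi>\<^sup>2) * ((A + x) - (r + 1) * C) = (1 - \<phi>\<^sup>2) * (A - r * C) + (1 - \<phi>\<^sup>2) * x - (C - \<phi>\<^sup>2 * C)" for A x r :: real
        by (simp add: algebra_simps)
      from this[of "\<Sum>t=1..n. (a (int t - 1) \<omega>)\<^sup>2" "(a (int n) \<omega>)\<^sup>2" "real n"] show ?thesis
        by (simp add: phi_square_C add.commute)
    qed
    also have "\<dots> = (a 0 \<omega>)\<^sup>2 - (a (int n + 1) \<omega>)\<^sup>2 + 2 * \<phi> * (S n \<omega> + z (int n + 1) \<omega> * a (int n) \<omega>) + (W n \<omega> + (z (int n + 1) \<omega>)\<^sup>2 - v)"
      unfolding Suc.IH r by (simp add: power2_eq_square algebra_simps)
    also have "\<dots> = (a 0 \<omega>)\<^sup>2 - (a (int (Suc n)) \<omega>)\<^sup>2 + 2 * \<phi> * S (Suc n) \<omega> + W (Suc n) \<omega>"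
      by (simp add: S_def W_def algebra_simps)
    finally show ?case .
  qed
  note * = this[of N]
  have "s_hat N \<omega> - C = ((\<Sum>t=1..N. (a (int t - 1) \<omega>)\<^sup>2) - real N * C) / real N"
    using N by (simp add: s_hat_def diff_divide_distrib)
  then show ?case unfolding *[symmetric] using phi_square by simp
qed

lemma u_hat_identity:
  "AE \<omega> in M. u_hat N \<omega> = \<phi> * s_hat N \<omega> + S N \<omega> / real N"
  using AE_recursion_all
proof eventually_elim
  case (elim \<omega>)
  have "a (int t) \<omega> * a (int t - 1) \<omega> = \<phi> * (a (int t - 1) \<omega>)\<^sup>2 + z (int t) \<omega> * a (int t - 1) \<omega>" for t
    using elim[rule_format, of "int t"] by (simp add: power2_eq_square algebra_simps)
  then show ?case
    by (simp add: u_hat_def s_hat_def S_def sum.distrib add_divide_distrib flip: sum_distrib_left)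
qed

lemma s_hat_integrable: "integrable M (s_hat N)"
  unfolding s_hat_def[abs_def] using a_square_integrable by simp

lemma u_hat_integrable: "integrable M (u_hat N)"
  unfolding u_hat_def[abs_def]
  by (intro integrable_mult_right Bochner_Integration.integrable_sum product_integrable a_square_integrable a_measurable)

lemma dev_integrable: "integrable M (dev N)"
  unfolding dev_def[abs_def] using s_hat_integrable u_hat_integrable by simp

text \<open>A bound proportional to \<open>C\<close> and uniform in \<open>N\<close> is what the
  summable majorant over multipoles needs. The four copies of \<open>C\<close> are the mean of
  \<open>s_hat\<close>, the bound on \<open>u_hat\<close> by the arithmetic-geometric inequality,
  and the two centering constants.\<close>

lemma dev_bound:
  assumes N: "N > 0"
  shows "(\<integral>\<omega>. dev N \<omega> \<partial>M) \<le> 4 * C"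
proof -
  have s: "(\<integral>\<omega>. s_hat N \<omega> \<partial>M) = C"
    using N a_square_integrable a_variance by (simp add: s_hat_def)
  have int: "integrable M (\<lambda>\<omega>. a (int t) \<omega> * a (int t - 1) \<omega>)" for t
    by (intro product_integrable a_square_integrable a_measurable)
  have u: "(\<integral>\<omega>. \<bar>u_hat N \<omega>\<bar> \<partial>M) \<le> C"
  proof -
    have "(\<integral>\<omega>. \<bar>u_hat N \<omega>\<bar> \<partial>M) \<le> (\<integral>\<omega>. 1 / real N * (\<Sum>t=1..N. ((a (int t) \<omega>)\<^sup>2 + (a (int t - 1) \<omega>)\<^sup>2) / 2) \<partial>M)"
    proof (rule integral_mono)
      fix \<omega>
      have "\<bar>\<Sum>t=1..N. a (int t) \<omega> * a (int t - 1) \<omega>\<bar> \<le> (\<Sum>t=1..N. ((a (int t) \<omega>)\<^sup>2 + (a (int t - 1) \<omega>)\<^sup>2) / 2)"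
      proof (rule order.trans[OF sum_abs sum_mono])
        fix t
        show "\<bar>a (int t) \<omega> * a (int t - 1) \<omega>\<bar> \<le> ((a (int t) \<omega>)\<^sup>2 + (a (int t - 1) \<omega>)\<^sup>2) / 2"
          using sum_squares_bound[of "\<bar>a (int t) \<omega>\<bar>" "\<bar>a (int t - 1) \<omega>\<bar>"] by (simp add: abs_mult)
      qed
      then show "\<bar>u_hat N \<omega>\<bar> \<le> 1 / real N * (\<Sum>t=1..N. ((a (int t) \<omega>)\<^sup>2 + (a (int t - 1) \<omega>)\<^sup>2) / 2)"
        by (simp add: u_hat_def abs_mult divide_right_mono)
    qed (use u_hat_integrable a_square_integrable in auto)
    also have "\<dots> = C" using N a_square_integrable a_variance by simp
    finally show ?thesis .
  qed
  have "dev N \<omega> \<le> (s_hat N \<omega> + C) + (\<bar>u_hat N \<omega>\<bar> + C)" for \<omega>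
  proof -
    have "s_hat N \<omega> \<ge> 0" by (simp add: s_hat_def sum_nonneg)
    moreover have "\<bar>\<phi> * C\<bar> \<le> C" using phi C_nonneg by (simp add: abs_mult mult_left_le_one_le)
    ultimately show ?thesis using C_nonneg unfolding dev_def by linarith
  qed
  then have "(\<integral>\<omega>. dev N \<omega> \<partial>M) \<le> (\<integral>\<omega>. (s_hat N \<omega> + C) + (\<bar>u_hat N \<omega>\<bar> + C) \<partial>M)"
    using dev_integrable s_hat_integrable u_hat_integrable by (intro integral_mono) auto
  also have "\<dots> = C + C + ((\<integral>\<omega>. \<bar>u_hat N \<omega>\<bar> \<partial>M) + C)"
    using s_hat_integrable u_hat_integrable s by (simp add: prob_space)
  finally show ?thesis using u by simp
qed

text \<open>In the two identities the boundary terms have bounded mean and the martingales have mean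
  of order \<open>sqrt N\<close>, so division by N leaves the rate \<open>1 / sqrt N\<close> at each
  fixed multipole.\<close>

lemma dev_tendsto_0: "(\<lambda>N. \<integral>\<omega>. dev N \<omega> \<partial>M) \<longlonglongrightarrow> 0"
proof -
  define q where "q = 1 - \<phi>\<^sup>2"
  have q: "q > 0" using phi_square by (simp add: q_def)
  define K where "K = 2 * (2 * C + 2 * (1 + v * C) + (1 + (Bz + v\<^sup>2))) / q + (1 + v * C)"
  have bound: "(\<integral>\<omega>. dev N \<omega> \<partial>M) \<le> K / sqrt (real N)" if N: "N > 0" for N
  proof -
    note S = expectation_abs_le_sqrt[OF S_measurable S_second_moment[THEN conjunct1] S_second_moment[THEN conjunct2, THEN eq_refl] N]
    note W = expectation_abs_le_sqrt[OF W_measurable W_second_moment[THEN conjunct1] W_second_moment[THEN conjunct2] N]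
    have sN: "sqrt (real N) \<ge> 1" "sqrt (real N) > 0" using N by simp_all
    let ?h = "\<lambda>\<omega>. 2 * (((a 0 \<omega>)\<^sup>2 + (a (int N) \<omega>)\<^sup>2 + 2 * \<bar>S N \<omega>\<bar> + \<bar>W N \<omega>\<bar>) / (real N * q)) + \<bar>S N \<omega>\<bar> / real N"
    have "AE \<omega> in M. dev N \<omega> \<le> ?h \<omega>"
      using s_hat_identity[OF N] u_hat_identity[of N]
    proof eventually_elim
      case (elim \<omega>)
      have "\<bar>s_hat N \<omega> - C\<bar> \<le> ((a 0 \<omega>)\<^sup>2 + (a (int N) \<omega>)\<^sup>2 + 2 * \<bar>S N \<omega>\<bar> + \<bar>W N \<omega>\<bar>) / (real N * q)"
      proof -
        have "\<bar>2 * \<phi> * S N \<omega>\<bar> \<le> 2 * \<bar>S N \<omega>\<bar>" using phi by (simp add: abs_mult mult_left_le_one_le)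
        moreover have "(a 0 \<omega>)\<^sup>2 \<ge> 0" "(a (int N) \<omega>)\<^sup>2 \<ge> 0" by simp_all
        ultimately have "\<bar>(a 0 \<omega>)\<^sup>2 - (a (int N) \<omega>)\<^sup>2 + 2 * \<phi> * S N \<omega> + W N \<omega>\<bar> \<le> (a 0 \<omega>)\<^sup>2 + (a (int N) \<omega>)\<^sup>2 + 2 * \<bar>S N \<omega>\<bar> + \<bar>W N \<omega>\<bar>"
          by linarith
        then show ?thesis using N q by (simp add: elim(1) abs_mult divide_right_mono flip: q_def)
      qed
      moreover have "\<bar>u_hat N \<omega> - \<phi> * C\<bar> \<le> \<bar>s_hat N \<omega> - C\<bar> + \<bar>S N \<omega>\<bar> / real N"
      proof -
        have "u_hat N \<omega> - \<phi> * C = \<phi> * (s_hat N \<omega> - C) + S N \<omega> / real N"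
          by (simp add: elim(2) algebra_simps)
        also have "\<bar>\<dots>\<bar> \<le> \<bar>\<phi>\<bar> * \<bar>s_hat N \<omega> - C\<bar> + \<bar>S N \<omega>\<bar> / real N"
          by (rule order.trans[OF abs_triangle_ineq]) (simp add: abs_mult)
        also have "\<dots> \<le> \<bar>s_hat N \<omega> - C\<bar> + \<bar>S N \<omega>\<bar> / real N"
          using phi by (simp add: mult_left_le_one_le)
        finally show ?thesis .
      qed
      ultimately show ?case unfolding dev_def by linarith
    qed
    then have "(\<integral>\<omega>. dev N \<omega> \<partial>M) \<le> (\<integral>\<omega>. ?h \<omega> \<partial>M)"
      using S W a_square_integrable dev_integrable by (intro integral_mono_AE) auto
    also have "\<dots> = 2 * ((C + C + 2 * (\<integral>\<omega>. \<bar>S N \<omega>\<bar> \<partial>M) + (\<integral>\<omega>. \<bar>W N \<omega>\<bar> \<partial>M)) / (real N * q)) + (\<integral>\<omega>. \<bar>S N \<omega>\<bar> \<partial>M) / real N"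
      using S W a_square_integrable a_variance by simp
    also have "\<dots> \<le> 2 * ((sqrt (real N) * (2 * C) + 2 * (sqrt (real N) * (1 + v * C)) + sqrt (real N) * (1 + (Bz + v\<^sup>2))) / (real N * q))
        + sqrt (real N) * (1 + v * C) / real N"
    proof -
      have "C + C \<le> sqrt (real N) * (2 * C)" using sN C_nonneg mult_right_mono[of 1 "sqrt (real N)" "2 * C"] by simp
      then show ?thesis using S W q by (intro add_mono mult_left_mono divide_right_mono) auto
    qed
    also have "\<dots> = (sqrt (real N) / real N) * K"
      using q N by (simp add: K_def field_simps)
    also have "sqrt (real N) / real N = 1 / sqrt (real N)"
      using N by (simp add: field_simps)
    finally show ?thesis by simp
  qed
  have lim: "(\<lambda>N. K / sqrt (real N)) \<longlonglongrightarrow> 0"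
    by (intro tendsto_divide_0[OF tendsto_const] filterlim_at_top_imp_at_infinity
          filterlim_compose[OF sqrt_at_top] filterlim_real_sequentially)
  show ?thesis
  proof (rule tendsto_sandwich[OF _ _ tendsto_const lim])
    show "eventually (\<lambda>N. 0 \<le> (\<integral>\<omega>. dev N \<omega> \<partial>M)) sequentially" by (simp add: dev_def)
    show "eventually (\<lambda>N. (\<integral>\<omega>. dev N \<omega> \<partial>M) \<le> K / sqrt (real N)) sequentially"
      using eventually_gt_at_top[of 0] by eventually_elim (rule bound)
  qed
qed

end

section \<open>The harmonic coefficients as AR(1) processes\<close>

lemma gaussian_rv_power4:
  assumes "gaussian_rv M X"
  shows "integrable M (\<lambda>\<omega>. X \<omega> ^ 4)"
proof -
  let ?N = "density lborel (\<lambda>x. ennreal (std_normal_density x))"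
  obtain \<mu> \<sigma> where X: "X \<in> borel_measurable M" and d: "distr M borel X = distr ?N borel (\<lambda>z. \<mu> + \<sigma> * z)"
    using assms by (auto simp: gaussian_rv_def)
  have moment: "integrable ?N (\<lambda>z. z ^ k)" for k
    by (subst integrable_density) (auto simp: integrable_std_normal_moment)
  have "(\<mu> + \<sigma> * z) ^ 4 = (\<Sum>k\<le>4. real (4 choose k) * \<mu> ^ k * \<sigma> ^ (4 - k) * z ^ (4 - k))" for z
    by (simp add: binomial_ring power_mult_distrib mult.assoc)
  then have "integrable ?N (\<lambda>z. (\<mu> + \<sigma> * z) ^ 4)"
    using moment by simp
  then have "integrable (distr M borel X) (\<lambda>x. x ^ 4)"
    unfolding d by (subst integrable_distr_eq) auto
  then show ?thesis using X by (subst (asm) integrable_distr_eq) auto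
qed

lemma gaussian_field_component:
  assumes "gaussian_field M I X" "i \<in> I"
  shows "gaussian_rv M (X i)"
  using assms(1)[unfolded gaussian_field_def, rule_format, of "{i}" "\<lambda>_. 1"] assms(2) by simp

lemma field_law_component:
  assumes X: "\<And>i. i \<in> I \<Longrightarrow> X i \<in> borel_measurable M" and X': "\<And>i. i \<in> I \<Longrightarrow> X' i \<in> borel_measurable M"
    and eq: "field_law M I X = field_law M I X'" and i: "i \<in> I"
  shows "distr M borel (X i) = distr M borel (X' i)"
proof -
  have *: "distr (field_law M I W) borel (\<lambda>f. f i) = distr M borel (W i)"
    if "\<And>i. i \<in> I \<Longrightarrow> W i \<in> borel_measurable M" for W :: "'a \<Rightarrow> 'b \<Rightarrow> real"
    unfolding field_law_def using that i
    by (subst distr_distr) (auto simp: comp_def intro!: measurable_restrict)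
  show ?thesis using *[of X] *[of X'] X X' eq by simp
qed

lemma distr_eq_power4:
  fixes X X' :: "'w \<Rightarrow> real"
  assumes [measurable]: "X \<in> borel_measurable M" "X' \<in> borel_measurable M"
    and eq: "distr M borel X = distr M borel X'"
  shows "(\<integral>\<omega>. X \<omega> ^ 4 \<partial>M) = (\<integral>\<omega>. X' \<omega> ^ 4 \<partial>M)"
  using integral_distr[of X M borel "\<lambda>x. x ^ 4"] integral_distr[of X' M borel "\<lambda>x. x ^ 4"] eq by simp

lemma rotation_to:
  fixes x y :: "real ^ 3"
  assumes "x \<in> S2" "y \<in> S2"
  obtains R where "rotation_matrix R" "R *v x = y" "\<And>v. v \<in> S2 \<Longrightarrow> R *v v \<in> S2"
proof -
  obtain f where f: "orthogonal_transformation f" "det (matrix f) = 1" "f x = y"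
    using rotation_exists[of x y] assms by auto
  have lin: "linear f" using f(1) by (simp add: orthogonal_transformation_def)
  have app: "matrix f *v v = f v" for v using matrix_works[OF lin[unfolded linear_matrix_vector_mul_eq[symmetric]]] lin by (simp add: matrix_works)
  have "rotation_matrix (matrix f)"
    using f orthogonal_transformation_matrix[of f] by (simp add: rotation_matrix_def)
  then show ?thesis using that[of "matrix f"] f app by (simp add: orthogonal_transformation_norm)
qed

lemma spherical_random_field_joint:
  "spherical_random_field M X \<longleftrightarrow> case_prod X \<in> borel_measurable (sphere_measure \<Otimes>\<^sub>M M)"
proof -
  have "sets (restrict_space borel S2 \<Otimes>\<^sub>M M) = sets (sphere_measure \<Otimes>\<^sub>M M)"
    by (intro sets_pair_measure_cong) (simp_all add: sets_sphere_measure)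
  then show ?thesis unfolding spherical_random_field_def by (simp cong: measurable_cong_sets)
qed

text \<open>A rotation combined with a time shift carries the law at any point and time to the law
  at \<open>x0\<close> and time 0, so one fourth moment bounds all of them. A single
  \<open>B\<close> for all times is what later bounds the second moments of the coefficients over
  all integers.\<close>

lemma iso_stat_sphere_field:
  assumes M: "prob_space M" and T: "iso_stat_gaussian_field M T"
  obtains B where "\<And>t. sphere_field M (\<lambda>x. T x t) B"
proof -
  define x0 :: "real ^ 3" where "x0 = axis 1 1"
  have x0: "x0 \<in> S2" by (simp add: x0_def)
  have g: "gaussian_rv M (T x t)" if "x \<in> S2" for x t
    using gaussian_field_component[of M "S2 \<times> UNIV" "\<lambda>(x, t). T x t" "(x, t)"] T that
    by (simp add: iso_stat_gaussian_field_def)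
  then have meas: "T x t \<in> borel_measurable M" if "x \<in> S2" for x t
    using that by (simp add: gaussian_rv_def)
  have eq: "(\<integral>\<omega>. T x t \<omega> ^ 4 \<partial>M) = (\<integral>\<omega>. T x0 0 \<omega> ^ 4 \<partial>M)" if x: "x \<in> S2" for x t
  proof -
    obtain R where R: "rotation_matrix R" "R *v x0 = x" "\<And>v. v \<in> S2 \<Longrightarrow> R *v v \<in> S2"
      using rotation_to[OF x0 x] by blast
    have "field_law M (S2 \<times> UNIV) (\<lambda>(x, s). T (R *v x) (s + t)) = field_law M (S2 \<times> UNIV) (\<lambda>(x, s). T x s)"
      using T R(1) by (simp add: iso_stat_gaussian_field_def isotropic_stationary_def)
    then have "distr M borel ((\<lambda>(x, s). T (R *v x) (s + t)) (x0, 0)) = distr M borel ((\<lambda>(x, s). T x s) (x0, 0))"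
      using x0 R(3) meas by (intro field_law_component[of "S2 \<times> UNIV"]) auto
    then show ?thesis using meas[OF x] meas[OF x0] R(2) by (intro distr_eq_power4) simp_all
  qed
  have "sphere_field M (\<lambda>x. T x t) (\<integral>\<omega>. T x0 0 \<omega> ^ 4 \<partial>M)" for t
  proof -
    have "spherical_random_field M (\<lambda>x. T x t)" using T by (simp add: iso_stat_gaussian_field_def)
    then show ?thesis
      using M gaussian_rv_power4[OF g] eq
      by (intro sphere_field.intro sphere_field_axioms.intro) (simp_all add: spherical_random_field_joint)
  qed
  then show ?thesis using that by blast
qed

lemma white_noise_sphere_field:
  assumes M: "prob_space M" and Z: "gaussian_spherical_white_noise M Z"
  obtains B where "\<And>t. sphere_field M (\<lambda>x. Z x t) B"
proof -
  define x0 :: "real ^ 3" where "x0 = axis 1 1"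
  have x0: "x0 \<in> S2" by (simp add: x0_def)
  have g: "gaussian_rv M (Z x t)" if "x \<in> S2" for x t
    using gaussian_field_component[of M S2 "\<lambda>x. Z x t" x] Z that
    by (simp add: gaussian_spherical_white_noise_def)
  then have meas: "Z x t \<in> borel_measurable M" if "x \<in> S2" for x t
    using that by (simp add: gaussian_rv_def)
  have eq: "(\<integral>\<omega>. Z x t \<omega> ^ 4 \<partial>M) = (\<integral>\<omega>. Z x0 0 \<omega> ^ 4 \<partial>M)" if x: "x \<in> S2" for x t
  proof -
    obtain R where R: "rotation_matrix R" "R *v x0 = x" "\<And>v. v \<in> S2 \<Longrightarrow> R *v v \<in> S2"
      using rotation_to[OF x0 x] by blast
    have "field_law M S2 (\<lambda>x. Z (R *v x) t) = field_law M S2 (\<lambda>x. Z x t)"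
      using Z R(1) by (simp add: gaussian_spherical_white_noise_def isotropic_def)
    also have "\<dots> = field_law M S2 (\<lambda>x. Z x 0)"
      using Z unfolding gaussian_spherical_white_noise_def by blast
    finally have "distr M borel (Z (R *v x0) t) = distr M borel (Z x0 0)"
      using x0 R(3) meas by (intro field_law_component[of S2 "\<lambda>x. Z (R *v x) t" M "\<lambda>x. Z x 0"]) auto
    then show ?thesis using meas[OF x] meas[OF x0] R(2) by (intro distr_eq_power4) simp_all
  qed
  have "sphere_field M (\<lambda>x. Z x t) (\<integral>\<omega>. Z x0 0 \<omega> ^ 4 \<partial>M)" for t
  proof -
    have "spherical_random_field M (\<lambda>x. Z x t)" using Z by (simp add: gaussian_spherical_white_noise_def)
    then show ?thesis
      using M gaussian_rv_power4[OF g] eq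
      by (intro sphere_field.intro sphere_field_axioms.intro) (simp_all add: spherical_random_field_joint)
  qed
  then show ?thesis using that by blast
qed

lemma (in sphere_field) AE_path_integrable: "AE \<omega> in M. integrable sphere_measure (\<lambda>x. X x \<omega>)"
  using AE_path_integrable_4
proof (rule AE_mp, intro AE_I2 impI)
  fix \<omega> assume "\<omega> \<in> space M" "integrable sphere_measure (\<lambda>x. X x \<omega> ^ 4)"
  then show "integrable sphere_measure (\<lambda>x. X x \<omega>)"
    by (rule S.integrable_of_power4(1)[OF path_measurable])
qed

section \<open>The autoregressive operator on harmonic coefficients\<close>

lemma sphere_integrable_mult_bounded:
  fixes f g :: "real ^ 3 \<Rightarrow> real"
  assumes f: "integrable sphere_measure f" and [measurable]: "g \<in> borel_measurable sphere_measure"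
    and g: "\<And>x. x \<in> S2 \<Longrightarrow> \<bar>g x\<bar> \<le> b"
  shows "integrable sphere_measure (\<lambda>x. f x * g x)"
proof (rule Bochner_Integration.integrable_bound[OF integrable_mult_right[OF f, of b]])
  have [measurable]: "f \<in> borel_measurable sphere_measure" using f by auto
  show "(\<lambda>x. f x * g x) \<in> borel_measurable sphere_measure" by measurable
  show "AE x in sphere_measure. norm (f x * g x) \<le> norm (b * f x)"
  proof (rule AE_I2)
    fix x assume "x \<in> space sphere_measure"
    then have "\<bar>g x\<bar> \<le> \<bar>b\<bar>" using g[of x] by simp
    then have "\<bar>f x\<bar> * \<bar>g x\<bar> \<le> \<bar>f x\<bar> * \<bar>b\<bar>" by (intro mult_left_mono) auto
    then show "norm (f x * g x) \<le> norm (b * f x)"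
      by (simp add: abs_mult mult.commute)
  qed
qed

text \<open>The kernel is symmetric, so Fubini moves the operator from \<open>f\<close> onto the
  harmonic; there the almost everywhere eigenvalue relation is enough, since it stands under an
  integral.\<close>

lemma autoreg_operator_coeff:
  assumes k: "continuous_on {-1..1} k" and eig: "autoreg_eigenvalues k \<phi>"
    and l: "l \<ge> 1" and m: "m \<in> {- int l..int l}" and f: "integrable sphere_measure f"
  shows "integrable sphere_measure (\<lambda>x. autoreg_operator k f x * real_sph_harm l m x)"
    and "(\<integral>x. autoreg_operator k f x * real_sph_harm l m x \<partial>sphere_measure)
      = \<phi> l * (\<integral>x. f x * real_sph_harm l m x \<partial>sphere_measure)"
proof -
  interpret S: finite_measure sphere_measure by (rule finite_measure_sphere)
  interpret SS: pair_sigma_finite sphere_measure sphere_measure ..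
  let ?S = sphere_measure and ?Y = "real_sph_harm l m"
  define kc where "kc t = k (clamp1 t)" for t
  have [measurable]: "kc \<in> borel_measurable borel"
    using kernel_clamp_measurable[OF k] by (simp add: kc_def[abs_def])
  have [measurable]: "f \<in> borel_measurable ?S" using f by auto
  have kc: "k (x \<bullet> y) = kc (x \<bullet> y)" if "x \<in> S2" "y \<in> S2" for x y
    using inner_S2_bounds[OF that] by (simp add: kc_def)
  obtain Bk where Bk: "Bk > 0" "\<And>t. t \<in> {-1..1} \<Longrightarrow> \<bar>k t\<bar> \<le> Bk" using kernel_bounded[OF k] by blast
  have kcb: "\<bar>kc t\<bar> \<le> Bk" for t unfolding kc_def by (rule Bk) auto
  obtain b where b: "b > 0" "\<And>x. x \<in> S2 \<Longrightarrow> \<bar>?Y x\<bar> \<le> b" using real_sph_harm_bounded by blast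
  have op: "autoreg_operator k f x * ?Y x = (\<integral>y. kc (x \<bullet> y) * f y * ?Y x \<partial>?S)" if "x \<in> S2" for x
  proof -
    have "autoreg_operator k f x = (\<integral>y. kc (x \<bullet> y) * f y \<partial>?S)"
      unfolding autoreg_operator_def using that by (intro Bochner_Integration.integral_cong) (auto simp: kc)
    then show ?thesis by simp
  qed
  have inti: "integrable ?S (\<lambda>y. kc (x \<bullet> y) * f y * ?Y x)" for x
    using sphere_integrable_mult_bounded[OF f, of "\<lambda>y. kc (x \<bullet> y)" Bk] kcb by (simp add: mult.commute)
  let ?g = "\<lambda>(x, y). kc (x \<bullet> y) * f y * ?Y x"
  have i: "integrable (?S \<Otimes>\<^sub>M ?S) ?g"
  proof (rule SS.Fubini_integrable)
    show "integrable ?S (\<lambda>x. \<integral>y. norm (?g (x, y)) \<partial>?S)"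
    proof (rule S.integrable_const_bound[of _ "Bk * b * (\<integral>y. \<bar>f y\<bar> \<partial>?S)"])
      show "AE x in ?S. norm (\<integral>y. norm (?g (x, y)) \<partial>?S) \<le> Bk * b * (\<integral>y. \<bar>f y\<bar> \<partial>?S)"
      proof (rule AE_I2)
        fix x assume x: "x \<in> space ?S"
        have "\<bar>kc (x \<bullet> y) * f y * ?Y x\<bar> \<le> Bk * b * \<bar>f y\<bar>" for y
        proof -
          have "\<bar>kc (x \<bullet> y)\<bar> * \<bar>?Y x\<bar> \<le> Bk * b" using kcb b x Bk by (intro mult_mono) auto
          then have "\<bar>kc (x \<bullet> y)\<bar> * \<bar>?Y x\<bar> * \<bar>f y\<bar> \<le> Bk * b * \<bar>f y\<bar>" by (intro mult_right_mono) auto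
          then show ?thesis by (simp add: abs_mult mult_ac)
        qed
        then have "(\<integral>y. \<bar>kc (x \<bullet> y) * f y * ?Y x\<bar> \<partial>?S) \<le> (\<integral>y. Bk * b * \<bar>f y\<bar> \<partial>?S)"
          using integrable_abs[OF inti] integrable_mult_right[OF integrable_abs[OF f]] by (intro integral_mono)
        then show "norm (\<integral>y. norm (?g (x, y)) \<partial>?S) \<le> Bk * b * (\<integral>y. \<bar>f y\<bar> \<partial>?S)"
          by simp
      qed
    qed measurable
    show "AE x in ?S. integrable ?S (\<lambda>y. ?g (x, y))"
      using inti by simp
  qed measurable
  have "integrable ?S (\<lambda>x. \<integral>y. kc (x \<bullet> y) * f y * ?Y x \<partial>?S)"
    by (rule SS.integrable_fst[OF i])
  then show "integrable ?S (\<lambda>x. autoreg_operator k f x * ?Y x)"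
    by (subst Bochner_Integration.integrable_cong[OF refl]) (auto simp: op)
  have "(\<integral>x. autoreg_operator k f x * ?Y x \<partial>?S) = (\<integral>x. (\<integral>y. kc (x \<bullet> y) * f y * ?Y x \<partial>?S) \<partial>?S)"
    by (intro Bochner_Integration.integral_cong) (auto simp: op)
  also have "\<dots> = (\<integral>y. (\<integral>x. kc (x \<bullet> y) * f y * ?Y x \<partial>?S) \<partial>?S)"
    by (rule SS.Fubini_integral[OF i, symmetric])
  also have "\<dots> = (\<integral>y. \<phi> l * (f y * ?Y y) \<partial>?S)"
  proof (rule integral_cong_AE)
    show "AE y in ?S. (\<integral>x. kc (x \<bullet> y) * f y * ?Y x \<partial>?S) = \<phi> l * (f y * ?Y y)"
      using autoreg_kernel_eigenfunction[OF k eig l m]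
    proof (rule AE_mp, intro AE_I2 impI)
      fix y assume y: "y \<in> space ?S" and e: "(\<integral>x. k (x \<bullet> y) * ?Y x \<partial>?S) = \<phi> l * ?Y y"
      have "(\<integral>x. kc (x \<bullet> y) * f y * ?Y x \<partial>?S) = (\<integral>x. f y * (k (x \<bullet> y) * ?Y x) \<partial>?S)"
        using y by (intro Bochner_Integration.integral_cong) (auto simp: kc mult_ac)
      also have "\<dots> = f y * (\<phi> l * ?Y y)" by (simp only: integral_mult_right_zero e)
      finally show "(\<integral>x. kc (x \<bullet> y) * f y * ?Y x \<partial>?S) = \<phi> l * (f y * ?Y y)" by simp
    qed
  qed measurable
  finally show "(\<integral>x. autoreg_operator k f x * ?Y x \<partial>?S) = \<phi> l * (\<integral>x. f x * ?Y x \<partial>?S)" by simp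
qed

text \<open>The model equation holds almost surely at each fixed point, with a null set depending on
  the point. Joint measurability of both sides allows the quantifiers to be exchanged: for almost
  every path the equation holds at almost every point and can be integrated against the
  harmonic.\<close>

lemma coeff_recursion:
  assumes X: "sphere_field M X B1" and X': "sphere_field M X' B2" and Z: "sphere_field M Z B3"
    and k: "continuous_on {-1..1} k" and eig: "autoreg_eigenvalues k \<phi>"
    and l: "l \<ge> 1" and m: "m \<in> {- int l..int l}"
    and eq: "\<And>x. x \<in> S2 \<Longrightarrow> AE \<omega> in M. X x \<omega> = autoreg_operator k (\<lambda>y. X' y \<omega>) x + Z x \<omega>"
  shows "AE \<omega> in M. (\<integral>x. X x \<omega> * real_sph_harm l m x \<partial>sphere_measure)
    = \<phi> l * (\<integral>x. X' x \<omega> * real_sph_harm l m x \<partial>sphere_measure) + (\<integral>x. Z x \<omega> * real_sph_harm l m x \<partial>sphere_measure)"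
proof -
  interpret X: sphere_field M X B1 by fact
  interpret X': sphere_field M X' B2 by fact
  interpret Z: sphere_field M Z B3 by fact
  let ?S = sphere_measure and ?Y = "real_sph_harm l m"
  obtain b where b: "b > 0" "\<And>x. x \<in> S2 \<Longrightarrow> \<bar>?Y x\<bar> \<le> b" using real_sph_harm_bounded by blast
  define kc where "kc t = k (clamp1 t)" for t
  have [measurable]: "kc \<in> borel_measurable borel"
    using kernel_clamp_measurable[OF k] by (simp add: kc_def[abs_def])
  define A where "A x \<omega> = (\<integral>y. kc (x \<bullet> y) * X' y \<omega> \<partial>?S)" for x \<omega>
  have A: "autoreg_operator k (\<lambda>y. X' y \<omega>) x = A x \<omega>" if x: "x \<in> S2" for x \<omega>
    unfolding A_def autoreg_operator_def
  proof (rule Bochner_Integration.integral_cong[OF refl])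
    fix y assume "y \<in> space ?S"
    then show "k (x \<bullet> y) * X' y \<omega> = kc (x \<bullet> y) * X' y \<omega>"
      using inner_S2_bounds[OF x, of y] by (simp add: kc_def)
  qed
  have Am [measurable]: "(\<lambda>z. A (fst z) (snd z)) \<in> borel_measurable (?S \<Otimes>\<^sub>M M)"
    unfolding A_def by measurable
  have "AE x in ?S. AE \<omega> in M. X x \<omega> = A x \<omega> + Z x \<omega>"
    using eq by (intro AE_I2[of ?S "\<lambda>x. AE \<omega> in M. X x \<omega> = A x \<omega> + Z x \<omega>"]) (simp add: A)
  moreover have "{z \<in> space (?S \<Otimes>\<^sub>M M). X (fst z) (snd z) = A (fst z) (snd z) + Z (fst z) (snd z)} \<in> sets (?S \<Otimes>\<^sub>M M)"
    by measurable
  ultimately have "AE \<omega> in M. AE x in ?S. X x \<omega> = A x \<omega> + Z x \<omega>"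
    using X.P.AE_commute[of "\<lambda>x \<omega>. X x \<omega> = A x \<omega> + Z x \<omega>"] by blast
  with X'.AE_path_integrable Z.AE_path_integrable show ?thesis
  proof (rule AE_mp[OF _ AE_mp[OF _ AE_mp]], intro AE_I2 impI)
    fix \<omega> assume \<omega>: "\<omega> \<in> space M" and iX': "integrable ?S (\<lambda>x. X' x \<omega>)" and iZ: "integrable ?S (\<lambda>x. Z x \<omega>)"
      and e: "AE x in ?S. X x \<omega> = A x \<omega> + Z x \<omega>"
    note [measurable] = X.path_measurable[OF \<omega>] X'.path_measurable[OF \<omega>] Z.path_measurable[OF \<omega>]
    have iZY: "integrable ?S (\<lambda>x. Z x \<omega> * ?Y x)"
      by (rule sphere_integrable_mult_bounded[OF iZ _ b(2)]) measurable
    note AY = autoreg_operator_coeff[OF k eig l m iX']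
    have iAY: "integrable ?S (\<lambda>x. A x \<omega> * ?Y x)"
      using AY(1) by (subst Bochner_Integration.integrable_cong[OF refl, of _ _ "\<lambda>x. autoreg_operator k (\<lambda>y. X' y \<omega>) x * ?Y x"]) (auto simp: A)
    have AYeq: "(\<integral>x. A x \<omega> * ?Y x \<partial>?S) = \<phi> l * (\<integral>x. X' x \<omega> * ?Y x \<partial>?S)"
      unfolding AY(2)[symmetric] by (intro Bochner_Integration.integral_cong) (auto simp: A)
    have "(\<integral>x. X x \<omega> * ?Y x \<partial>?S) = (\<integral>x. A x \<omega> * ?Y x + Z x \<omega> * ?Y x \<partial>?S)"
    proof (rule integral_cong_AE)
      show "AE x in ?S. X x \<omega> * ?Y x = A x \<omega> * ?Y x + Z x \<omega> * ?Y x"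
        using e by eventually_elim (simp add: algebra_simps)
      show "(\<lambda>x. A x \<omega> * ?Y x + Z x \<omega> * ?Y x) \<in> borel_measurable ?S"
        using iAY iZY by (intro borel_measurable_add) auto
    qed measurable
    also have "\<dots> = (\<integral>x. A x \<omega> * ?Y x \<partial>?S) + (\<integral>x. Z x \<omega> * ?Y x \<partial>?S)"
      by (rule Bochner_Integration.integral_add[OF iAY iZY])
    finally show "(\<integral>x. X x \<omega> * ?Y x \<partial>?S) = \<phi> l * (\<integral>x. X' x \<omega> * ?Y x \<partial>?S) + (\<integral>x. Z x \<omega> * ?Y x \<partial>?S)"
      by (simp add: AYeq)
  qed
qed

section \<open>Sigma-algebras generated by fields\<close>

definition field_sigma :: "'w measure \<Rightarrow> 'i set \<Rightarrow> ('i \<Rightarrow> 'w \<Rightarrow> real) \<Rightarrow> 'w measure" where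
  "field_sigma M I X = vimage_algebra (space M) (\<lambda>\<omega>. \<lambda>i\<in>I. X i \<omega>) (PiM I (\<lambda>_. borel))"

lemma space_field_sigma [simp]: "space (field_sigma M I X) = space M"
  by (simp add: field_sigma_def)

lemma field_sigma_component:
  assumes "i \<in> I"
  shows "X i \<in> borel_measurable (field_sigma M I X)"
proof -
  have "(\<lambda>\<omega>. \<lambda>i\<in>I. X i \<omega>) \<in> field_sigma M I X \<rightarrow>\<^sub>M PiM I (\<lambda>_. borel)"
    unfolding field_sigma_def by (intro measurable_vimage_algebra1) (auto simp: space_PiM)
  from measurable_compose[OF this measurable_component_singleton[OF assms]]
  show ?thesis using assms by simp
qed

text \<open>Inclusions between sigma-algebras are expressed as measurability of the identity map, so
  that they follow from measurability of the components and are applied by composition.\<close>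

lemma measurable_id_field_sigma:
  assumes "space N = space M" "\<And>i. i \<in> I \<Longrightarrow> X i \<in> borel_measurable N"
  shows "(\<lambda>\<omega>. \<omega>) \<in> N \<rightarrow>\<^sub>M field_sigma M I X"
  unfolding field_sigma_def using assms
  by (intro measurable_vimage_algebra2 measurable_restrict) auto

lemma field_sigma_subalgebra:
  assumes "\<And>i. i \<in> I \<Longrightarrow> X i \<in> borel_measurable M"
  shows "subalgebra M (field_sigma M I X)"
  unfolding subalgebra_def
proof safe
  fix A assume A: "A \<in> sets (field_sigma M I X)"
  have "(\<lambda>\<omega>. \<omega>) -` A \<inter> space M \<in> sets M"
    by (rule measurable_sets[OF measurable_id_field_sigma A]) (use assms in auto)
  moreover have "A \<subseteq> space M" using sets.sets_into_space[OF A] by simp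
  ultimately show "A \<in> sets M" by (simp add: Int_absorb2)
qed simp_all

lemma field_sigma_mono:
  assumes "J \<subseteq> I" "f \<in> borel_measurable (field_sigma M J X)"
  shows "f \<in> borel_measurable (field_sigma M I X)"
  using measurable_compose[OF measurable_id_field_sigma assms(2), of "field_sigma M I X"]
    field_sigma_component[of _ I X M] assms(1) by auto

lemma (in prob_space) indep_var_field_sigma:
  fixes f g :: "'a \<Rightarrow> real" and X W :: "'b \<Rightarrow> 'a \<Rightarrow> real"
  assumes ind: "indep_var (PiM I (\<lambda>_. borel)) (\<lambda>\<omega>. \<lambda>i\<in>I. X i \<omega>) (PiM J (\<lambda>_. borel)) (\<lambda>\<omega>. \<lambda>j\<in>J. W j \<omega>)"
    and f: "f \<in> borel_measurable (field_sigma M I X)" and g: "g \<in> borel_measurable (field_sigma M J W)"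
    and X: "\<And>i. i \<in> I \<Longrightarrow> X i \<in> borel_measurable M" and W: "\<And>j. j \<in> J \<Longrightarrow> W j \<in> borel_measurable M"
  shows "indep_var borel f borel g"
proof -
  have sub: "sigma_sets (space M) {h -` A \<inter> space M | A. A \<in> sets borel} \<subseteq> sets (field_sigma M K V)"
    if h: "h \<in> borel_measurable (field_sigma M K V)" for h :: "'a \<Rightarrow> real" and K :: "'b set" and V
  proof -
    have "{h -` A \<inter> space M | A. A \<in> sets borel} \<subseteq> sets (field_sigma M K V)"
      using measurable_sets[OF h] by auto
    from sets.sigma_sets_subset[OF this] show ?thesis by simp
  qed
  have ss: "sets (field_sigma M K V) = sigma_sets (space M) {(\<lambda>\<omega>. \<lambda>i\<in>K. V i \<omega>) -` A \<inter> space M | A. A \<in> sets (PiM K (\<lambda>_. borel))}"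
    for K :: "'b set" and V :: "'b \<Rightarrow> 'a \<Rightarrow> real"
    by (simp add: field_sigma_def sets_vimage_algebra)
  have i: "indep_set (sets (field_sigma M I X)) (sets (field_sigma M J W))"
    using ind unfolding indep_var_eq ss by blast
  have "indep_set (sigma_sets (space M) {f -` A \<inter> space M | A. A \<in> sets borel}) (sigma_sets (space M) {g -` A \<inter> space M | A. A \<in> sets borel})"
    using i unfolding indep_set_def
    by (rule indep_sets_mono_sets) (use sub[OF f] sub[OF g] in \<open>auto split: bool.split\<close>)
  moreover have "f \<in> borel_measurable M" "g \<in> borel_measurable M"
    using measurable_from_subalg[OF field_sigma_subalgebra f] measurable_from_subalg[OF field_sigma_subalgebra g] X W by auto
  ultimately show ?thesis unfolding indep_var_eq by blast
qed

text \<open>The past is generated by the values of \<open>T\<close> before time t, and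
  \<open>a\<close>, \<open>z\<close> are versions of the coefficients measurable for the values of
  \<open>T\<close> and \<open>Z\<close> at a single time. The hypothesis of independence then
  applies to them literally, while moments and recursion transfer from the original coefficients by
  almost sure equality.\<close>

lemma sphar1_ar1_process:
  fixes M :: "'w measure" and T Z :: "real ^ 3 \<Rightarrow> int \<Rightarrow> 'w \<Rightarrow> real"
  assumes M: "prob_space M" and T: "iso_stat_gaussian_field M T" and sp: "sphar1 M k T Z"
    and eig: "autoreg_eigenvalues k \<phi>" and aps: "angular_power_spectrum M Z Cz"
    and l: "l \<ge> 1" and m: "m \<in> {- int l..int l}" and phi: "\<bar>\<phi> l\<bar> < 1"
  obtains a z P Ba Bz where "ar1_process M (\<phi> l) (Cz l) Ba Bz a z P"
    "\<And>t. AE \<omega> in M. a t \<omega> = harm_coeff T \<omega> l m t" "\<And>t. (\<lambda>\<omega>. harm_coeff T \<omega> l m t) \<in> borel_measurable M"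
proof -
  interpret prob_space M by fact
  let ?Y = "real_sph_harm l m"
  have wn: "gaussian_spherical_white_noise M Z" and k: "continuous_on {-1..1} k" and ind: "independent_of_past M Z T"
    and eq: "\<And>x t. x \<in> S2 \<Longrightarrow> AE \<omega> in M. T x t \<omega> = autoreg_operator k (\<lambda>y. T y (t - 1) \<omega>) x + Z x t \<omega>"
    using sp by (auto simp: sphar1_def)
  obtain BT where BT: "\<And>t. sphere_field M (\<lambda>x. T x t) BT" using iso_stat_sphere_field[OF M T] by blast
  obtain BZ where BZ: "\<And>t. sphere_field M (\<lambda>x. Z x t) BZ" using white_noise_sphere_field[OF M wn] by blast
  obtain b where b: "b > 0" "\<And>x. x \<in> S2 \<Longrightarrow> \<bar>?Y x\<bar> \<le> b" using real_sph_harm_bounded by blast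
  have ax: "sphere_field_coeff_axioms ?Y b"
    by (rule sphere_field_coeff_axioms.intro) (use b in auto)
  have TC: "sphere_field_coeff M (\<lambda>x. T x t) BT ?Y b" for t
    by (rule sphere_field_coeff.intro[OF BT ax])
  have ZC: "sphere_field_coeff M (\<lambda>x. Z x t) BZ ?Y b" for t
    by (rule sphere_field_coeff.intro[OF BZ ax])
  let ?a = "\<lambda>t \<omega>. harm_coeff T \<omega> l m t" and ?z = "\<lambda>t \<omega>. harm_coeff Z \<omega> l m t"
  have a_coeff: "sphere_field_coeff.coeff (\<lambda>x. T x t) ?Y = ?a t" for t
    by (rule ext) (simp add: sphere_field_coeff.coeff_def[OF TC] harm_coeff_def)
  have z_coeff: "sphere_field_coeff.coeff (\<lambda>x. Z x t) ?Y = ?z t" for t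
    by (rule ext) (simp add: sphere_field_coeff.coeff_def[OF ZC] harm_coeff_def)
  note aC = sphere_field_coeff.coeff_measurable[OF TC, unfolded a_coeff]
    sphere_field_coeff.coeff_integrable_4[OF TC, unfolded a_coeff]
    sphere_field_coeff.coeff_fourth_bound[OF TC, unfolded a_coeff]
    sphere_field_coeff.coeff_integrable[OF TC, unfolded a_coeff]
  note zC = sphere_field_coeff.coeff_measurable[OF ZC, unfolded z_coeff]
    sphere_field_coeff.coeff_integrable_4[OF ZC, unfolded z_coeff]
    sphere_field_coeff.coeff_fourth_bound[OF ZC, unfolded z_coeff]
  have Tm: "case_prod T i \<in> borel_measurable M" if "i \<in> S2 \<times> UNIV" for i
    using sphere_field.slice_measurable[OF BT, of "fst i" "snd i"] that by auto
  have Zm: "case_prod Z i \<in> borel_measurable M" if "i \<in> S2 \<times> UNIV" for i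
    using sphere_field.slice_measurable[OF BZ, of "fst i" "snd i"] that by auto
  define FT where "FT t = field_sigma M (S2 \<times> {t}) (case_prod T)" for t
  define FZ where "FZ t = field_sigma M (S2 \<times> {t}) (case_prod Z)" for t
  define P where "P t = field_sigma M (S2 \<times> {..<t}) (case_prod T)" for t
  have subT: "subalgebra M (FT t)" and subZ: "subalgebra M (FZ t)" and subP: "subalgebra M (P t)" for t
    unfolding FT_def FZ_def P_def using Tm Zm by (auto intro!: field_sigma_subalgebra)
  \<comment> \<open>By \<open>coeff_cond_exp\<close> these conditional expectations are almost
    surely the coefficients themselves.\<close>
  define a where "a t = real_cond_exp M (FT t) (?a t)" for t
  define z where "z t = real_cond_exp M (FZ t) (?z t)" for t
  have aF: "a t \<in> borel_measurable (FT t)" and zF: "z t \<in> borel_measurable (FZ t)" for t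
    by (simp_all add: a_def z_def)
  have a_eq: "AE \<omega> in M. a t \<omega> = ?a t \<omega>" for t
  proof -
    have "T x t \<in> borel_measurable (FT t)" if "x \<in> S2" for x
      using field_sigma_component[of "(x, t)" "S2 \<times> {t}" "case_prod T" M] that by (simp add: FT_def)
    from sphere_field_coeff.coeff_cond_exp[OF TC subT this]
    show ?thesis by (simp add: a_coeff a_def)
  qed
  have z_eq: "AE \<omega> in M. z t \<omega> = ?z t \<omega>" for t
  proof -
    have "Z x t \<in> borel_measurable (FZ t)" if "x \<in> S2" for x
      using field_sigma_component[of "(x, t)" "S2 \<times> {t}" "case_prod Z" M] that by (simp add: FZ_def)
    from sphere_field_coeff.coeff_cond_exp[OF ZC subZ this]
    show ?thesis by (simp add: z_coeff z_def)
  qed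
  have am [measurable]: "a t \<in> borel_measurable M" and zm [measurable]: "z t \<in> borel_measurable M" for t
    using measurable_from_subalg[OF subT aF] measurable_from_subalg[OF subZ zF] by auto
  note [measurable] = aC(1) zC(1)
  have a4: "integrable M (\<lambda>\<omega>. (a t \<omega>)\<^sup>2)" "(\<integral>\<omega>. (a t \<omega>)\<^sup>2 \<partial>M) \<le> 1 + sphere_field_coeff.K4 BT b" for t
  proof -
    have e: "AE \<omega> in M. (a t \<omega>)\<^sup>2 = (?a t \<omega>)\<^sup>2" using a_eq[of t] by eventually_elim simp
    show "integrable M (\<lambda>\<omega>. (a t \<omega>)\<^sup>2)"
      by (subst integrable_cong_AE[OF _ _ e]) (use aC(5) in measurable)
    have "(\<integral>\<omega>. (a t \<omega>)\<^sup>2 \<partial>M) = (\<integral>\<omega>. (?a t \<omega>)\<^sup>2 \<partial>M)"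
      by (rule integral_cong_AE[OF _ _ e]) measurable
    also have "\<dots> \<le> (\<integral>\<omega>. 1 + ?a t \<omega> ^ 4 \<partial>M)"
      using aC(2,5) square_le_1_plus_power4 by (intro integral_mono) auto
    also have "\<dots> = 1 + (\<integral>\<omega>. ?a t \<omega> ^ 4 \<partial>M)" using aC(2) by (simp add: prob_space)
    finally show "(\<integral>\<omega>. (a t \<omega>)\<^sup>2 \<partial>M) \<le> 1 + sphere_field_coeff.K4 BT b" using aC(3)[of t] by simp
  qed
  have z4: "integrable M (\<lambda>\<omega>. z t \<omega> ^ 4)" "(\<integral>\<omega>. z t \<omega> ^ 4 \<partial>M) \<le> sphere_field_coeff.K4 BZ b" for t
  proof -
    have e: "AE \<omega> in M. z t \<omega> ^ 4 = ?z t \<omega> ^ 4" using z_eq[of t] by eventually_elim simp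
    show "integrable M (\<lambda>\<omega>. z t \<omega> ^ 4)"
      by (subst integrable_cong_AE[OF _ _ e]) (use zC(2) in measurable)
    have "(\<integral>\<omega>. z t \<omega> ^ 4 \<partial>M) = (\<integral>\<omega>. ?z t \<omega> ^ 4 \<partial>M)"
      by (rule integral_cong_AE[OF _ _ e]) measurable
    then show "(\<integral>\<omega>. z t \<omega> ^ 4 \<partial>M) \<le> sphere_field_coeff.K4 BZ b" using zC(3)[of t] by simp
  qed
  have "ar1_process M (\<phi> l) (Cz l) (1 + sphere_field_coeff.K4 BT b) (sphere_field_coeff.K4 BZ b) a z P"
  proof (intro ar1_process.intro ar1_process_axioms.intro M phi subP zm a4 z4)
    fix s t :: int assume "s < t"
    then show "a s \<in> borel_measurable (P t)"
      unfolding P_def by (intro field_sigma_mono[OF _ aF[unfolded FT_def]]) auto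
  next
    fix g :: "'w \<Rightarrow> real" and t assume g: "g \<in> borel_measurable (P t)"
    have "indep_var (PiM (S2 \<times> {t}) (\<lambda>_. borel)) (\<lambda>\<omega>. \<lambda>i\<in>S2 \<times> {t}. case_prod Z i \<omega>)
        (PiM (S2 \<times> {..<t}) (\<lambda>_. borel)) (\<lambda>\<omega>. \<lambda>i\<in>S2 \<times> {..<t}. case_prod T i \<omega>)"
      using ind by (simp add: independent_of_past_def case_prod_beta')
    then show "indep_var borel (z t) borel g"
      by (rule indep_var_field_sigma[OF _ zF[unfolded FZ_def] g[unfolded P_def]]) (use Tm Zm in auto)
  next
    fix t
    have "AE \<omega> in M. ?a t \<omega> = \<phi> l * ?a (t - 1) \<omega> + ?z t \<omega>"
      unfolding harm_coeff_def by (rule coeff_recursion[OF BT BT BZ k eig l m eq])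
    with a_eq[of t] a_eq[of "t - 1"] z_eq[of t] show "AE \<omega> in M. a t \<omega> = \<phi> l * a (t - 1) \<omega> + z t \<omega>"
      by eventually_elim simp
  next
    fix t
    have "(\<integral>\<omega>. z t \<omega> \<partial>M) = (\<integral>\<omega>. ?z t \<omega> \<partial>M)"
      by (rule integral_cong_AE[OF _ _ z_eq]) measurable
    also have "\<dots> = 0"
      using sphere_field_coeff.coeff_expectation_0[OF ZC, of t] wn
      unfolding z_coeff by (auto simp: gaussian_spherical_white_noise_def centered_field_def)
    finally show "(\<integral>\<omega>. z t \<omega> \<partial>M) = 0" .
    have "AE \<omega> in M. (z t \<omega>)\<^sup>2 = (?z t \<omega>)\<^sup>2" using z_eq[of t] by eventually_elim simp
    then have "(\<integral>\<omega>. (z t \<omega>)\<^sup>2 \<partial>M) = (\<integral>\<omega>. (?z t \<omega>)\<^sup>2 \<partial>M)"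
      by (intro integral_cong_AE) measurable
    then show "(\<integral>\<omega>. (z t \<omega>)\<^sup>2 \<partial>M) = Cz l"
      using aps l m by (simp add: angular_power_spectrum_def)
  qed
  then show ?thesis using that a_eq aC(1) by blast
qed

definition square_avg :: "(int \<Rightarrow> real) \<Rightarrow> nat \<Rightarrow> real" where
  "square_avg x N = 1 / real N * (\<Sum>t=1..N. (x (int t - 1))\<^sup>2)"

definition lag_avg :: "(int \<Rightarrow> real) \<Rightarrow> nat \<Rightarrow> real" where
  "lag_avg x N = 1 / real N * (\<Sum>t=1..N. x (int t) * x (int t - 1))"

text \<open>Time is countable, so the versions and the true coefficients agree at all times outside
  one null set, and the statements about the AR(1) process carry over to the observed
  averages.\<close>

lemma harm_coeff_deviation:
  fixes M :: "'w measure" and T Z :: "real ^ 3 \<Rightarrow> int \<Rightarrow> 'w \<Rightarrow> real"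
  assumes M: "prob_space M" and T: "iso_stat_gaussian_field M T" and sp: "sphar1 M k T Z"
    and eig: "autoreg_eigenvalues k \<phi>" and aps: "angular_power_spectrum M Z Cz"
    and l: "l \<ge> 1" and m: "m \<in> {- int l..int l}" and phi: "\<bar>\<phi> l\<bar> < 1"
  defines "c \<equiv> Cz l / (1 - (\<phi> l)\<^sup>2)"
  defines "d \<equiv> \<lambda>N \<omega>. \<bar>square_avg (harm_coeff T \<omega> l m) N - c\<bar> + \<bar>lag_avg (harm_coeff T \<omega> l m) N - \<phi> l * c\<bar>"
  shows "integrable M (d N)" "N > 0 \<Longrightarrow> (\<integral>\<omega>. d N \<omega> \<partial>M) \<le> 4 * c" "(\<lambda>N. \<integral>\<omega>. d N \<omega> \<partial>M) \<longlonglongrightarrow> 0"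
proof -
  obtain a z P Ba Bz where ar: "ar1_process M (\<phi> l) (Cz l) Ba Bz a z P"
    and eq: "\<And>t. AE \<omega> in M. a t \<omega> = harm_coeff T \<omega> l m t"
    and hm: "\<And>t. (\<lambda>\<omega>. harm_coeff T \<omega> l m t) \<in> borel_measurable M"
    by (rule sphar1_ar1_process[OF M T sp eig aps l m phi]) (rule that)
  interpret A: ar1_process M "\<phi> l" "Cz l" Ba Bz a z P by fact
  have C: "A.C = c" by (simp add: A.C_def c_def)
  note [measurable] = hm
  have dm [measurable]: "d N \<in> borel_measurable M" for N
    unfolding d_def square_avg_def lag_avg_def by measurable
  have "AE \<omega> in M. \<forall>t. a t \<omega> = harm_coeff T \<omega> l m t"
    by (subst AE_all_countable) (use eq in blast)
  then have e: "AE \<omega> in M. A.dev N \<omega> = d N \<omega>" for N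
    by eventually_elim (simp add: A.dev_def A.s_hat_def A.u_hat_def C d_def square_avg_def lag_avg_def)
  have devm: "A.dev N \<in> borel_measurable M" for N using A.dev_integrable by auto
  show "integrable M (d N)"
    using A.dev_integrable integrable_cong_AE[OF devm dm e] by simp
  have int: "(\<integral>\<omega>. d N \<omega> \<partial>M) = (\<integral>\<omega>. A.dev N \<omega> \<partial>M)" for N
    using integral_cong_AE[OF devm dm e] by simp
  show "(\<integral>\<omega>. d N \<omega> \<partial>M) \<le> 4 * c" if "N > 0" using A.dev_bound[OF that] int C by simp
  show "(\<lambda>N. \<integral>\<omega>. d N \<omega> \<partial>M) \<longlonglongrightarrow> 0" using A.dev_tendsto_0 int by simp
qed

section \<open>Identification of the parameters\<close>

text \<open>The risk without its parameter-free term.\<close>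

definition contrast :: "(nat \<Rightarrow> int \<Rightarrow> int \<Rightarrow> real) \<Rightarrow> nat \<Rightarrow> nat \<Rightarrow> real \<Rightarrow> real \<Rightarrow> real" where
  "contrast a L N G \<alpha> = G\<^sup>2 * D_hat a L N \<alpha> - 2 * G * U_hat a L N \<alpha>"

lemma sum_time_inside:
  "1 / real N * (\<Sum>t=1..N. \<Sum>l=1..L. \<Sum>m\<in>A l. f t l m) = (\<Sum>l=1..L. \<Sum>m\<in>A l. 1 / real N * (\<Sum>t=1..N. f t l m))"
proof -
  have "(\<Sum>t=1..N. \<Sum>l=1..L. \<Sum>m\<in>A l. f t l m) = (\<Sum>l=1..L. \<Sum>t=1..N. \<Sum>m\<in>A l. f t l m)"
    by (rule sum.swap)
  also have "\<dots> = (\<Sum>l=1..L. \<Sum>m\<in>A l. \<Sum>t=1..N. f t l m)"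
    by (intro sum.cong refl sum.swap)
  finally show ?thesis by (simp add: sum_distrib_left)
qed

lemma U_hat_eq: "U_hat a L N \<alpha> = (\<Sum>l=1..L. \<Sum>m\<in>{- int l..int l}. lag_avg (a l m) N * real l powr (- \<alpha>))"
  unfolding U_hat_def sum_time_inside lag_avg_def
  by (intro sum.cong refl) (simp add: sum_distrib_right)

lemma powr_neg_twice: "x powr (- 2 * \<alpha>) = (x powr (- \<alpha>))\<^sup>2" for x \<alpha> :: real
proof -
  have "- 2 * \<alpha> = - \<alpha> + - \<alpha>" by simp
  then show ?thesis by (simp only: powr_add power2_eq_square)
qed

lemma D_hat_eq: "D_hat a L N \<alpha> = (\<Sum>l=1..L. \<Sum>m\<in>{- int l..int l}. square_avg (a l m) N * (real l powr (- \<alpha>))\<^sup>2)"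
  unfolding D_hat_def sum_time_inside square_avg_def powr_neg_twice
  by (intro sum.cong refl) (simp add: sum_distrib_right)

lemma lsq_risk_eq:
  "lsq_risk a L N (G, \<alpha>) = 1 / real N * (\<Sum>t=1..N. \<Sum>l=1..L. \<Sum>m\<in>{- int l..int l}. (a l m (int t))\<^sup>2) + contrast a L N G \<alpha>"
proof -
  have "(a l m (int t) - G * real l powr (- \<alpha>) * a l m (int t - 1))\<^sup>2 = (a l m (int t))\<^sup>2
      + (G\<^sup>2 * ((a l m (int t - 1))\<^sup>2 * real l powr (- 2 * \<alpha>)) - 2 * G * (a l m (int t) * a l m (int t - 1) * real l powr (- \<alpha>)))"
    for l m and t :: nat
    unfolding powr_neg_twice by (simp add: power2_eq_square algebra_simps)
  then have "(\<Sum>t=1..N. \<Sum>l=1..L. \<Sum>m\<in>{- int l..int l}. (a l m (int t) - G * real l powr (- \<alpha>) * a l m (int t - 1))\<^sup>2)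
    = (\<Sum>t=1..N. \<Sum>l=1..L. \<Sum>m\<in>{- int l..int l}. (a l m (int t))\<^sup>2
      + (G\<^sup>2 * ((a l m (int t - 1))\<^sup>2 * real l powr (- 2 * \<alpha>)) - 2 * G * (a l m (int t) * a l m (int t - 1) * real l powr (- \<alpha>))))"
    by (intro sum.cong refl) auto
  also have "\<dots> = (\<Sum>t=1..N. \<Sum>l=1..L. \<Sum>m\<in>{- int l..int l}. (a l m (int t))\<^sup>2)
     + (G\<^sup>2 * (\<Sum>t=1..N. \<Sum>l=1..L. \<Sum>m\<in>{- int l..int l}. (a l m (int t - 1))\<^sup>2 * real l powr (- 2 * \<alpha>))
     - 2 * G * (\<Sum>t=1..N. \<Sum>l=1..L. \<Sum>m\<in>{- int l..int l}. a l m (int t) * a l m (int t - 1) * real l powr (- \<alpha>)))"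
    unfolding sum_distrib_left sum.distrib sum_subtractf ..
  finally show ?thesis
    unfolding lsq_risk_def contrast_def U_hat_def D_hat_def prod.case
    by (simp only: distrib_left right_diff_distrib mult.left_commute)
qed

text \<open>The deviation of the empirical moments, weighted so that it dominates the error of the contrast
  uniformly in \<open>\<alpha> \<ge> 0\<close>.\<close>

definition deviation :: "(nat \<Rightarrow> real) \<Rightarrow> (nat \<Rightarrow> real) \<Rightarrow> (nat \<Rightarrow> int \<Rightarrow> int \<Rightarrow> real) \<Rightarrow> nat \<Rightarrow> nat \<Rightarrow> real" where
  "deviation C \<phi> a L N = (\<Sum>l=1..L. \<Sum>m\<in>{- int l..int l}.
     \<bar>square_avg (a l m) N - C l\<bar> + \<bar>lag_avg (a l m) N - \<phi> l * C l\<bar>)"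

lemma powr_neg_le_1: "l \<ge> 1 \<Longrightarrow> \<alpha> \<ge> 0 \<Longrightarrow> real l powr (- \<alpha>) \<le> 1"
  using powr_mono[of "- \<alpha>" 0 "real l"] by simp

lemma contrast_approx:
  fixes C \<phi> :: "nat \<Rightarrow> real"
  assumes \<alpha>: "\<alpha> \<ge> 0"
  shows "\<bar>contrast a L N G \<alpha> - (\<Sum>l=1..L. \<Sum>m\<in>{- int l..int l}.
      C l * ((G * real l powr (- \<alpha>))\<^sup>2 - 2 * (G * real l powr (- \<alpha>)) * \<phi> l))\<bar> \<le> (G\<^sup>2 + 2 * \<bar>G\<bar>) * deviation C \<phi> a L N"
proof -
  let ?p = "\<lambda>l. real l powr (- \<alpha>)"
  have eq: "contrast a L N G \<alpha> - (\<Sum>l=1..L. \<Sum>m\<in>{- int l..int l}. C l * ((G * ?p l)\<^sup>2 - 2 * (G * ?p l) * \<phi> l))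
    = (\<Sum>l=1..L. \<Sum>m\<in>{- int l..int l}. G\<^sup>2 * (square_avg (a l m) N * (?p l)\<^sup>2) - 2 * G * (lag_avg (a l m) N * ?p l)
        - C l * ((G * ?p l)\<^sup>2 - 2 * (G * ?p l) * \<phi> l))"
    unfolding contrast_def U_hat_eq D_hat_eq sum_distrib_left sum_subtractf ..
  have "\<bar>\<Sum>l=1..L. \<Sum>m\<in>{- int l..int l}. G\<^sup>2 * (square_avg (a l m) N * (?p l)\<^sup>2) - 2 * G * (lag_avg (a l m) N * ?p l)
        - C l * ((G * ?p l)\<^sup>2 - 2 * (G * ?p l) * \<phi> l)\<bar> \<le> (\<Sum>l=1..L. \<Sum>m\<in>{- int l..int l}.
      (G\<^sup>2 + 2 * \<bar>G\<bar>) * (\<bar>square_avg (a l m) N - C l\<bar> + \<bar>lag_avg (a l m) N - \<phi> l * C l\<bar>))"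
  proof (rule order.trans[OF sum_abs sum_mono], rule order.trans[OF sum_abs sum_mono])
    fix l m assume l: "l \<in> {1..L}"
    define p x y where "p = ?p l" and "x = square_avg (a l m) N - C l" and "y = lag_avg (a l m) N - \<phi> l * C l"
    have p: "0 \<le> p" "p \<le> 1" using l \<alpha> powr_neg_le_1[of l \<alpha>] by (auto simp: p_def)
    then have p2: "p\<^sup>2 \<le> 1" by (simp add: power_le_one)
    have "G\<^sup>2 * (square_avg (a l m) N * (?p l)\<^sup>2) - 2 * G * (lag_avg (a l m) N * ?p l) - C l * ((G * ?p l)\<^sup>2 - 2 * (G * ?p l) * \<phi> l)
      = G\<^sup>2 * p\<^sup>2 * x - 2 * G * p * y"
      unfolding p_def x_def y_def by (simp add: power_mult_distrib algebra_simps)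
    also have "\<bar>\<dots>\<bar> \<le> G\<^sup>2 * p\<^sup>2 * \<bar>x\<bar> + 2 * \<bar>G\<bar> * p * \<bar>y\<bar>"
      using p by (intro order.trans[OF abs_triangle_ineq4]) (simp add: abs_mult)
    also have "\<dots> \<le> G\<^sup>2 * 1 * \<bar>x\<bar> + 2 * \<bar>G\<bar> * 1 * \<bar>y\<bar>"
      using p p2 by (intro add_mono mult_right_mono mult_left_mono) auto
    also have "\<dots> \<le> (G\<^sup>2 + 2 * \<bar>G\<bar>) * (\<bar>x\<bar> + \<bar>y\<bar>)"
      by (simp add: distrib_left distrib_right)
    finally show "\<bar>G\<^sup>2 * (square_avg (a l m) N * (?p l)\<^sup>2) - 2 * G * (lag_avg (a l m) N * ?p l) - C l * ((G * ?p l)\<^sup>2 - 2 * (G * ?p l) * \<phi> l)\<bar>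
      \<le> (G\<^sup>2 + 2 * \<bar>G\<bar>) * (\<bar>square_avg (a l m) N - C l\<bar> + \<bar>lag_avg (a l m) N - \<phi> l * C l\<bar>)"
      unfolding x_def y_def .
  qed
  then show ?thesis unfolding eq deviation_def sum_distrib_left .
qed

lemma deviation_nonneg: "deviation C \<phi> a L N \<ge> 0"
  unfolding deviation_def by (intro sum_nonneg) auto

text \<open>The multipoles 1 and 2 alone identify the two parameters.\<close>

lemma contrast_separation:
  fixes C :: "nat \<Rightarrow> real" and a :: "nat \<Rightarrow> int \<Rightarrow> int \<Rightarrow> real" and N :: nat
  assumes C: "\<And>l. C l \<ge> 0" "C 1 > 0" and L: "L \<ge> 2" and \<alpha>: "\<alpha> \<ge> 0" "\<alpha>\<^sub>0 \<ge> 0" and G0: "\<bar>G\<^sub>0\<bar> \<le> 1"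
  defines "V \<equiv> deviation C (\<lambda>l. G\<^sub>0 * real l powr (- \<alpha>\<^sub>0)) a L N"
  assumes V: "V \<le> C 1 / 2" and le: "contrast a L N G \<alpha> \<le> contrast a L N G\<^sub>0 \<alpha>\<^sub>0"
  shows "C 1 * (G - G\<^sub>0)\<^sup>2 \<le> 8 * V" "C 2 * (G * 2 powr (- \<alpha>) - G\<^sub>0 * 2 powr (- \<alpha>\<^sub>0))\<^sup>2 \<le> 8 * V"
proof -
  let ?\<phi> = "\<lambda>l. G\<^sub>0 * real l powr (- \<alpha>\<^sub>0)"
  define F where "F G \<alpha> = (\<Sum>l=1..L. \<Sum>m\<in>{- int l..int l}. C l * ((G * real l powr (- \<alpha>))\<^sup>2 - 2 * (G * real l powr (- \<alpha>)) * ?\<phi> l))" for G \<alpha>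
  define f where "f l = C l * (G * real l powr (- \<alpha>) - ?\<phi> l)\<^sup>2" for l
  define x y where "x = G - G\<^sub>0" and "y = G * 2 powr (- \<alpha>) - G\<^sub>0 * 2 powr (- \<alpha>\<^sub>0)"
  \<comment> \<open>Completing the square: with \<open>x = G l^(-\<alpha>)\<close> and
    \<open>p\<close> the true eigenvalue, \<open>x^2 - 2 x p\<close> exceeds its minimum
    \<open>- p^2\<close> by \<open>(x - p)^2\<close>.\<close>
  have "F G \<alpha> - F G\<^sub>0 \<alpha>\<^sub>0 = (\<Sum>l=1..L. \<Sum>m\<in>{- int l..int l}. f l)"
    unfolding F_def sum_subtractf[symmetric] f_def
    by (intro sum.cong refl) (simp add: power2_eq_square algebra_simps)
  also have "\<dots> \<ge> (\<Sum>l\<in>{1,2}. \<Sum>m\<in>{- int l..int l}. f l)"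
    using C(1) L by (intro sum_mono2) (auto intro!: sum_nonneg mult_nonneg_nonneg simp: f_def)
  \<comment> \<open>The weights 3 and 5 count the orders m at the multipoles 1 and 2.\<close>
  finally have sep: "F G \<alpha> - F G\<^sub>0 \<alpha>\<^sub>0 \<ge> 3 * (C 1 * x\<^sup>2) + 5 * (C 2 * y\<^sup>2)"
    by (simp add: f_def x_def y_def)
  have "\<bar>contrast a L N G \<alpha> - F G \<alpha>\<bar> \<le> (G\<^sup>2 + 2 * \<bar>G\<bar>) * V"
    unfolding F_def V_def by (rule contrast_approx[OF \<alpha>(1)])
  moreover have "\<bar>contrast a L N G\<^sub>0 \<alpha>\<^sub>0 - F G\<^sub>0 \<alpha>\<^sub>0\<bar> \<le> (G\<^sub>0\<^sup>2 + 2 * \<bar>G\<^sub>0\<bar>) * V"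
    unfolding F_def V_def by (rule contrast_approx[OF \<alpha>(2)])
  ultimately have "3 * (C 1 * x\<^sup>2) + 5 * (C 2 * y\<^sup>2) \<le> (G\<^sup>2 + 2 * \<bar>G\<bar>) * V + (G\<^sub>0\<^sup>2 + 2 * \<bar>G\<^sub>0\<bar>) * V"
    using le sep by linarith
  \<comment> \<open>No bound on \<open>G\<close> is available for the profile estimate, so the
    prefactors are bounded by the squared error \<open>x\<close> itself.\<close>
  also have "\<dots> \<le> (3 * x\<^sup>2 + 8) * V"
  proof -
    have "\<bar>G\<bar> \<le> \<bar>x\<bar> + 1" using G0 by (simp add: x_def)
    then have "\<bar>G\<bar>\<^sup>2 \<le> (\<bar>x\<bar> + 1)\<^sup>2" by (intro power_mono) auto
    then have "G\<^sup>2 \<le> x\<^sup>2 + 2 * \<bar>x\<bar> + 1" by (simp add: power2_sum)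
    moreover have "2 * \<bar>x\<bar> \<le> x\<^sup>2 + 1" using sum_squares_bound[of "\<bar>x\<bar>" 1] by simp
    moreover have "G\<^sub>0\<^sup>2 \<le> 1" using G0 by (simp add: abs_square_le_1)
    ultimately have "(G\<^sup>2 + 2 * \<bar>G\<bar>) + (G\<^sub>0\<^sup>2 + 2 * \<bar>G\<^sub>0\<bar>) \<le> 3 * x\<^sup>2 + 8"
      using \<open>\<bar>G\<bar> \<le> \<bar>x\<bar> + 1\<close> G0 by linarith
    then have "((G\<^sup>2 + 2 * \<bar>G\<bar>) + (G\<^sub>0\<^sup>2 + 2 * \<bar>G\<^sub>0\<bar>)) * V \<le> (3 * x\<^sup>2 + 8) * V"
      using deviation_nonneg unfolding V_def by (intro mult_right_mono)
    then show ?thesis by (simp add: distrib_right)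
  qed
  \<comment> \<open>The assumption \<open>V \<le> C 1 / 2\<close> makes the quadratic term half of
    \<open>3 * (C 1 * x^2)\<close> on the left, where it is absorbed.\<close>
  also have "\<dots> \<le> 3 * (x\<^sup>2 * (C 1 / 2)) + 8 * V"
    using mult_left_mono[OF V, of "x\<^sup>2"] by (simp add: algebra_simps)
  finally have "3 / 2 * (C 1 * x\<^sup>2) + 5 * (C 2 * y\<^sup>2) \<le> 8 * V" by (simp add: mult.commute)
  moreover have "C 1 * x\<^sup>2 \<ge> 0" "C 2 * y\<^sup>2 \<ge> 0" using C(1) by simp_all
  ultimately show "C 1 * (G - G\<^sub>0)\<^sup>2 \<le> 8 * V" "C 2 * (G * 2 powr (- \<alpha>) - G\<^sub>0 * 2 powr (- \<alpha>\<^sub>0))\<^sup>2 \<le> 8 * V"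
    unfolding x_def y_def by linarith+
qed

text \<open>The slope of \<open>2 powr (- x)\<close> is bounded away from 0 on arguments at most
  \<open>K\<close>. This turns closeness of the second eigenvalues into closeness of the exponents,
  and is where the upper end of the parameter interval enters.\<close>

lemma powr_2_neg_diff_ge:
  fixes x y K :: real
  assumes "x \<le> K" "y \<le> K"
  shows "ln 2 * 2 powr (- K) * \<bar>x - y\<bar> \<le> \<bar>2 powr (- x) - 2 powr (- y)\<bar>"
proof -
  have *: "ln 2 * 2 powr (- K) * (y - x) \<le> 2 powr (- x) - 2 powr (- y)" if "x \<le> y" "y \<le> K" for x y :: real
  proof -
    have "1 + ln 2 * (y - x) \<le> exp (ln 2 * (y - x))" by (rule exp_ge_add_one_self)
    moreover have "2 powr (y - x) = exp (ln 2 * (y - x))" by (simp add: powr_def mult.commute)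
    ultimately have e: "ln 2 * (y - x) \<le> 2 powr (y - x) - 1" by linarith
    have "2 powr (- K) * (ln 2 * (y - x)) \<le> 2 powr (- y) * (ln 2 * (y - x))"
      using that by (intro mult_right_mono) auto
    also have "\<dots> \<le> 2 powr (- y) * (2 powr (y - x) - 1)"
      by (intro mult_left_mono e) auto
    also have "\<dots> = 2 powr (- x) - 2 powr (- y)"
      by (simp add: right_diff_distrib flip: powr_add)
    finally show ?thesis by (simp add: mult_ac)
  qed
  show ?thesis
  proof (cases "x \<le> y")
    case True
    then show ?thesis using *[of x y] assms by simp
  next
    case False
    then show ?thesis using *[of y x] assms by simp
  qed
qed

lemma contrast_identification:
  fixes C :: "nat \<Rightarrow> real"
  assumes C: "\<And>l. C l \<ge> 0" "C 1 > 0" "C 2 > 0" and G0: "0 < \<bar>G\<^sub>0\<bar>" "\<bar>G\<^sub>0\<bar> \<le> 1" and \<alpha>0: "0 \<le> \<alpha>\<^sub>0" "\<alpha>\<^sub>0 \<le> K" and e: "e > 0"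
  obtains \<delta> where "\<delta> > 0" "\<delta> \<le> C 1 / 2"
    "\<And>a L N G \<alpha>. L \<ge> 2 \<Longrightarrow> 0 \<le> \<alpha> \<Longrightarrow> \<alpha> \<le> K \<Longrightarrow> deviation C (\<lambda>l. G\<^sub>0 * real l powr (- \<alpha>\<^sub>0)) a L N \<le> \<delta> \<Longrightarrow>
      contrast a L N G \<alpha> \<le> contrast a L N G\<^sub>0 \<alpha>\<^sub>0 \<Longrightarrow> \<bar>G - G\<^sub>0\<bar> \<le> e \<and> \<bar>\<alpha> - \<alpha>\<^sub>0\<bar> \<le> e"
proof -
  \<comment> \<open>A lower bound for the slope of
    \<open>\<alpha> \<mapsto> G0 * 2 powr (- \<alpha>)\<close> up to \<open>K\<close>; it is
    positive because \<open>G0\<close> is nonzero.\<close>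
  define c where "c = \<bar>G\<^sub>0\<bar> * (ln 2 * 2 powr (- K))"
  have c: "c > 0" using G0 by (simp add: c_def)
  \<comment> \<open>The error of the exponent collects two contributions of size
    \<open>\<eta>\<close>, one from multipole 2 and one from replacing \<open>G\<close> by
    \<open>G0\<close>, and is divided by \<open>c\<close>.\<close>
  define \<eta> where "\<eta> = min e (c * e / 2)"
  have \<eta>: "\<eta> > 0" "\<eta> \<le> e" "2 * \<eta> \<le> c * e" using e c by (auto simp: \<eta>_def)
  \<comment> \<open>The first entry meets the smallness hypothesis of
    \<open>contrast_separation\<close>; the second turns its bounds \<open>8 * V\<close> into
    squared errors at most the square of \<open>\<eta>\<close>.\<close>
  define \<delta> where "\<delta> = min (C 1 / 2) (min (C 1) (C 2) * \<eta>\<^sup>2 / 8)"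
  have \<delta>: "\<delta> > 0" "\<delta> \<le> C 1 / 2" "8 * \<delta> \<le> C 1 * \<eta>\<^sup>2" "8 * \<delta> \<le> C 2 * \<eta>\<^sup>2"
  proof -
    have "min (C 1) (C 2) * \<eta>\<^sup>2 \<le> C 1 * \<eta>\<^sup>2" "min (C 1) (C 2) * \<eta>\<^sup>2 \<le> C 2 * \<eta>\<^sup>2"
      by (intro mult_right_mono; simp)+
    then show "8 * \<delta> \<le> C 1 * \<eta>\<^sup>2" "8 * \<delta> \<le> C 2 * \<eta>\<^sup>2" unfolding \<delta>_def by linarith+
  qed (use C \<eta> in \<open>auto simp: \<delta>_def\<close>)
  have "\<bar>G - G\<^sub>0\<bar> \<le> e \<and> \<bar>\<alpha> - \<alpha>\<^sub>0\<bar> \<le> e"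
    if L: "L \<ge> 2" and \<alpha>: "0 \<le> \<alpha>" "\<alpha> \<le> K" and V: "deviation C (\<lambda>l. G\<^sub>0 * real l powr (- \<alpha>\<^sub>0)) a L N \<le> \<delta>"
      and le: "contrast a L N G \<alpha> \<le> contrast a L N G\<^sub>0 \<alpha>\<^sub>0" for a L N G \<alpha>
  proof -
    define y where "y = G * 2 powr (- \<alpha>) - G\<^sub>0 * 2 powr (- \<alpha>\<^sub>0)"
    note s = contrast_separation[OF C(1,2) L \<alpha>(1) \<alpha>0(1) G0(2) order.trans[OF V \<delta>(2)] le]
    have "C 1 * (G - G\<^sub>0)\<^sup>2 \<le> C 1 * \<eta>\<^sup>2" "C 2 * y\<^sup>2 \<le> C 2 * \<eta>\<^sup>2" using s V \<delta> unfolding y_def by linarith+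
    then have "(G - G\<^sub>0)\<^sup>2 \<le> \<eta>\<^sup>2" "y\<^sup>2 \<le> \<eta>\<^sup>2" using C by simp_all
    then have x: "\<bar>G - G\<^sub>0\<bar> \<le> \<eta>" and y: "\<bar>y\<bar> \<le> \<eta>" using \<eta>(1) by (auto dest!: power2_le_imp_le[of "\<bar>_\<bar>" \<eta>, rotated] simp: abs_le_square_iff[symmetric])
    have "G\<^sub>0 * (2 powr (- \<alpha>) - 2 powr (- \<alpha>\<^sub>0)) = y - (G - G\<^sub>0) * 2 powr (- \<alpha>)"
      by (simp add: y_def algebra_simps)
    also have "\<bar>\<dots>\<bar> \<le> \<bar>y\<bar> + \<bar>G - G\<^sub>0\<bar> * 2 powr (- \<alpha>)"
      by (rule order.trans[OF abs_triangle_ineq4]) (simp add: abs_mult)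
    also have "\<dots> \<le> \<eta> + \<eta> * 1"
      using x y \<alpha> powr_neg_le_1[of 2 \<alpha>] by (intro add_mono mult_mono) auto
    finally have "\<bar>G\<^sub>0\<bar> * \<bar>2 powr (- \<alpha>) - 2 powr (- \<alpha>\<^sub>0)\<bar> \<le> 2 * \<eta>" by (simp add: abs_mult)
    moreover have "c * \<bar>\<alpha> - \<alpha>\<^sub>0\<bar> \<le> \<bar>G\<^sub>0\<bar> * \<bar>2 powr (- \<alpha>) - 2 powr (- \<alpha>\<^sub>0)\<bar>"
      unfolding c_def mult.assoc using powr_2_neg_diff_ge[OF \<alpha>(2) \<alpha>0(2)] by (intro mult_left_mono) (simp_all add: mult.assoc)
    ultimately have "c * \<bar>\<alpha> - \<alpha>\<^sub>0\<bar> \<le> c * e" using \<eta>(3) by linarith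
    then show ?thesis using c x \<eta>(2) by simp
  qed
  then show ?thesis using that \<delta>(1,2) by blast
qed

section \<open>From estimators to inequalities for the contrast\<close>

lemma continuous_contrast: "continuous_on A (\<lambda>p. contrast a L N (fst p) (snd p))"
  unfolding contrast_def U_hat_def D_hat_def
  by (intro continuous_intros) auto

text \<open>Completing the square in G writes the contrast as
  \<open>(G D - U)^2 / D - U^2 / D\<close>; the profile estimate makes the first term zero and the
  second as small as possible. Positivity of \<open>D\<close> also excludes the default value of
  division by zero.\<close>

lemma profile_minimizes_contrast:
  assumes max: "is_arg_max (\<lambda>\<alpha>. (U_hat a L N \<alpha>)\<^sup>2 / D_hat a L N \<alpha>) (\<lambda>\<alpha>. \<alpha> \<in> A) \<alpha>"
    and D: "D_hat a L N \<alpha> > 0" "D_hat a L N \<alpha>\<^sub>0 > 0" and \<alpha>0: "\<alpha>\<^sub>0 \<in> A"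
  shows "contrast a L N (U_hat a L N \<alpha> / D_hat a L N \<alpha>) \<alpha> \<le> contrast a L N G\<^sub>0 \<alpha>\<^sub>0"
proof -
  have q: "G\<^sup>2 * D - 2 * G * U = (G * D - U)\<^sup>2 / D - U\<^sup>2 / D" if "D > 0" for G D U :: real
    using that by (simp add: field_simps power2_eq_square)
  have "contrast a L N (U_hat a L N \<alpha> / D_hat a L N \<alpha>) \<alpha> = - ((U_hat a L N \<alpha>)\<^sup>2 / D_hat a L N \<alpha>)"
    unfolding contrast_def q[OF D(1)] using D(1) by simp
  also have "\<dots> \<le> - ((U_hat a L N \<alpha>\<^sub>0)\<^sup>2 / D_hat a L N \<alpha>\<^sub>0)"
    using max \<alpha>0 by (auto simp: is_arg_max_def not_less)
  also have "\<dots> \<le> contrast a L N G\<^sub>0 \<alpha>\<^sub>0"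
    unfolding contrast_def q[OF D(2)] using D(2) by simp
  finally show ?thesis .
qed

text \<open>Since \<open>1 powr (- \<alpha>) = 1\<close>, the coefficient with l = 1 and m = 0
  bounds \<open>D_hat\<close> from below uniformly in the exponent. So \<open>D_hat\<close> is
  positive once the deviation is less than \<open>C 1\<close>.\<close>

lemma D_hat_ge:
  assumes L: "L \<ge> 1"
  shows "D_hat a L N \<alpha> \<ge> C 1 - deviation C \<phi> a L N"
proof -
  have nn: "square_avg x N \<ge> 0" for x by (simp add: square_avg_def sum_nonneg)
  have "square_avg (a 1 0) N * (real 1 powr (- \<alpha>))\<^sup>2 \<le> (\<Sum>m\<in>{- int 1..int 1}. square_avg (a 1 m) N * (real 1 powr (- \<alpha>))\<^sup>2)"
    by (rule member_le_sum) (auto simp: nn)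
  also have "\<dots> \<le> D_hat a L N \<alpha>"
    unfolding D_hat_eq using L by (intro member_le_sum[of 1 "{1..L}" "\<lambda>l. \<Sum>m\<in>{- int l..int l}. square_avg (a l m) N * (real l powr (- \<alpha>))\<^sup>2"])
      (auto intro!: sum_nonneg mult_nonneg_nonneg nn)
  finally have 1: "square_avg (a 1 0) N \<le> D_hat a L N \<alpha>" by simp
  let ?d = "\<lambda>l m. \<bar>square_avg (a l m) N - C l\<bar> + \<bar>lag_avg (a l m) N - \<phi> l * C l\<bar>"
  have "?d 1 0 \<le> (\<Sum>m\<in>{- int 1..int 1}. ?d 1 m)"
    by (rule member_le_sum) auto
  also have "\<dots> \<le> deviation C \<phi> a L N"
    unfolding deviation_def using L by (intro member_le_sum[of 1 "{1..L}" "\<lambda>l. \<Sum>m\<in>{- int l..int l}. ?d l m"]) (auto intro!: sum_nonneg)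
  finally show ?thesis using 1 by linarith
qed

text \<open>Both notions of estimator at one sample point, so that identification becomes a
  deterministic statement about arrays.\<close>

definition nlls_estimate ::
  "(nat \<Rightarrow> int \<Rightarrow> int \<Rightarrow> real) \<Rightarrow> nat \<Rightarrow> nat \<Rightarrow> real set \<Rightarrow> real \<Rightarrow> real \<Rightarrow> bool" where
  "nlls_estimate a L N A G \<alpha> \<longleftrightarrow>
     ((\<exists>p. is_arg_min (lsq_risk a L N) (\<lambda>p. p \<in> param_space A) p) \<longrightarrow>
        is_arg_min (lsq_risk a L N) (\<lambda>p. p \<in> param_space A) (G, \<alpha>)) \<or>
     (is_arg_max (\<lambda>\<alpha>. (U_hat a L N \<alpha>)\<^sup>2 / D_hat a L N \<alpha>) (\<lambda>\<alpha>. \<alpha> \<in> A) \<alpha> \<and>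
        G = U_hat a L N \<alpha> / D_hat a L N \<alpha>)"

text \<open>For the profile estimate the contrast inequality is direct. For the constrained one a
  minimizer must first be found: the contrast attains its minimum over the compact closure of the
  parameter set, identification places that point close to the truth, hence inside the parameter
  set, and so the estimate has to be a minimizer too.\<close>

lemma nlls_identification:
  fixes C :: "nat \<Rightarrow> real"
  assumes C: "\<And>l. C l \<ge> 0" "C 1 > 0" "C 2 > 0" and G0: "0 < \<bar>G\<^sub>0\<bar>" "\<bar>G\<^sub>0\<bar> < 1"
    and a1: "0 \<le> a\<^sub>1" "a\<^sub>1 \<le> \<alpha>\<^sub>0" "\<alpha>\<^sub>0 \<le> a\<^sub>2" and e: "e > 0"
  obtains \<delta> where "\<delta> > 0"
    "\<And>a L N G \<alpha>. L \<ge> 2 \<Longrightarrow> deviation C (\<lambda>l. G\<^sub>0 * real l powr (- \<alpha>\<^sub>0)) a L N \<le> \<delta> \<Longrightarrow>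
      nlls_estimate a L N {a\<^sub>1..a\<^sub>2} G \<alpha> \<Longrightarrow>
      \<bar>G - G\<^sub>0\<bar> \<le> e \<and> \<bar>\<alpha> - \<alpha>\<^sub>0\<bar> \<le> e"
proof -
  let ?\<phi> = "\<lambda>l. G\<^sub>0 * real l powr (- \<alpha>\<^sub>0)"
  \<comment> \<open>Half the distance from |G0| to 0 and to 1, so that a value within
    \<open>e'\<close> of the truth is nonzero and lies in the open interval.\<close>
  define e' where "e' = min e (min \<bar>G\<^sub>0\<bar> (1 - \<bar>G\<^sub>0\<bar>) / 2)"
  have e': "e' > 0" "e' \<le> e" "e' < \<bar>G\<^sub>0\<bar>" "e' < 1 - \<bar>G\<^sub>0\<bar>" using e G0 by (auto simp: e'_def min_def)
  have \<alpha>00: "0 \<le> \<alpha>\<^sub>0" using a1 by linarith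
  obtain \<delta> where \<delta>: "\<delta> > 0" "\<delta> \<le> C 1 / 2"
    and near: "\<And>a L N G \<alpha>. L \<ge> 2 \<Longrightarrow> 0 \<le> \<alpha> \<Longrightarrow> \<alpha> \<le> a\<^sub>2 \<Longrightarrow> deviation C ?\<phi> a L N \<le> \<delta> \<Longrightarrow>
      contrast a L N G \<alpha> \<le> contrast a L N G\<^sub>0 \<alpha>\<^sub>0 \<Longrightarrow> \<bar>G - G\<^sub>0\<bar> \<le> e' \<and> \<bar>\<alpha> - \<alpha>\<^sub>0\<bar> \<le> e'"
    using contrast_identification[OF C G0(1) less_imp_le[OF G0(2)] \<alpha>00 a1(3) e'(1)] by blast
  have "\<bar>G - G\<^sub>0\<bar> \<le> e \<and> \<bar>\<alpha> - \<alpha>\<^sub>0\<bar> \<le> e"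
    if L: "L \<ge> 2" and V: "deviation C ?\<phi> a L N \<le> \<delta>"
      and est: "nlls_estimate a L N {a\<^sub>1..a\<^sub>2} G \<alpha>" for a L N G \<alpha>
  proof -
    have "\<alpha> \<in> {a\<^sub>1..a\<^sub>2} \<and> contrast a L N G \<alpha> \<le> contrast a L N G\<^sub>0 \<alpha>\<^sub>0"
      using est unfolding nlls_estimate_def
    proof
      assume max: "is_arg_max (\<lambda>\<alpha>. (U_hat a L N \<alpha>)\<^sup>2 / D_hat a L N \<alpha>) (\<lambda>\<alpha>. \<alpha> \<in> {a\<^sub>1..a\<^sub>2}) \<alpha> \<and>
         G = U_hat a L N \<alpha> / D_hat a L N \<alpha>"
      have D: "D_hat a L N \<beta> > 0" for \<beta>
        using D_hat_ge[of L C ?\<phi> a N \<beta>] L V \<delta> C(2) by linarith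
      have "contrast a L N G \<alpha> \<le> contrast a L N G\<^sub>0 \<alpha>\<^sub>0"
        using profile_minimizes_contrast[of a L N "{a\<^sub>1..a\<^sub>2}" \<alpha> \<alpha>\<^sub>0 G\<^sub>0] max D a1 by simp
      then show ?thesis using max by (simp add: is_arg_max_def)
    next
      assume imp: "(\<exists>p. is_arg_min (lsq_risk a L N) (\<lambda>p. p \<in> param_space {a\<^sub>1..a\<^sub>2}) p) \<longrightarrow>
         is_arg_min (lsq_risk a L N) (\<lambda>p. p \<in> param_space {a\<^sub>1..a\<^sub>2}) (G, \<alpha>)"
      let ?K = "{-1..1} \<times> {a\<^sub>1..a\<^sub>2} :: (real \<times> real) set"
      have less: "lsq_risk a L N (G', \<alpha>') < lsq_risk a L N (G'', \<alpha>'') \<longleftrightarrow> contrast a L N G' \<alpha>' < contrast a L N G'' \<alpha>''" for G' \<alpha>' G'' \<alpha>''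
        by (simp add: lsq_risk_eq)
      have p0: "(G\<^sub>0, \<alpha>\<^sub>0) \<in> ?K" "(G\<^sub>0, \<alpha>\<^sub>0) \<in> param_space {a\<^sub>1..a\<^sub>2}" using G0 a1 by (auto simp: param_space_def)
      have K: "compact ?K" "?K \<noteq> {}" using p0(1) by (auto intro!: compact_Times)
      from continuous_attains_inf[OF K continuous_contrast[of ?K a L N]]
      obtain q where q: "q \<in> ?K" and qmin: "\<forall>p\<in>?K. contrast a L N (fst q) (snd q) \<le> contrast a L N (fst p) (snd p)"
        by blast
      \<comment> \<open>The true parameter belongs to the compact set, so \<open>q\<close> satisfies
        the contrast inequality that identification requires.\<close>
      have "\<bar>fst q - G\<^sub>0\<bar> \<le> e' \<and> \<bar>snd q - \<alpha>\<^sub>0\<bar> \<le> e'"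
        using q qmin[rule_format, OF p0(1)] a1 by (intro near[OF L _ _ V]) auto
      then have "fst q \<noteq> 0" "\<bar>fst q\<bar> < 1" using e' by auto
      then have "q \<in> param_space {a\<^sub>1..a\<^sub>2}" using q by (auto simp: param_space_def)
      moreover have "\<not> lsq_risk a L N p < lsq_risk a L N q" if "p \<in> param_space {a\<^sub>1..a\<^sub>2}" for p
        using qmin[rule_format, of p] that less[of "fst p" "snd p" "fst q" "snd q"] by (auto simp: param_space_def not_less)
      ultimately have "is_arg_min (lsq_risk a L N) (\<lambda>p. p \<in> param_space {a\<^sub>1..a\<^sub>2}) q"
        by (auto simp: is_arg_min_def)
      then have "is_arg_min (lsq_risk a L N) (\<lambda>p. p \<in> param_space {a\<^sub>1..a\<^sub>2}) (G, \<alpha>)" using imp by blast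
      then have "(G, \<alpha>) \<in> param_space {a\<^sub>1..a\<^sub>2}" "\<not> lsq_risk a L N (G\<^sub>0, \<alpha>\<^sub>0) < lsq_risk a L N (G, \<alpha>)"
        using p0(2) unfolding is_arg_min_def by blast+
      then show ?thesis using less by (auto simp: param_space_def)
    qed
    then have "\<bar>G - G\<^sub>0\<bar> \<le> e' \<and> \<bar>\<alpha> - \<alpha>\<^sub>0\<bar> \<le> e'" using a1 by (intro near[OF L _ _ V]) auto
    then show ?thesis using e'(2) by auto
  qed
  then show ?thesis using that \<delta>(1) by blast
qed

section \<open>Consistency\<close>

text \<open>Each multipole tends to 0 separately while the number of multipoles grows, so the
  exchange of limit and sum needs a majorant free of N: \<open>2 l + 1\<close> orders, each
  contributing at most four times the variance, decay like
  \<open>l powr (1 - \<gamma>)\<close>.\<close>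

lemma expected_deviation_tendsto_0:
  fixes M :: "'w measure" and T Z :: "real ^ 3 \<Rightarrow> int \<Rightarrow> 'w \<Rightarrow> real" and L :: "nat \<Rightarrow> nat"
  assumes M: "prob_space M" and T: "iso_stat_gaussian_field M T" and sp: "sphar1 M k T Z"
    and eig: "autoreg_eigenvalues k \<phi>" and aps: "angular_power_spectrum M Z (\<lambda>l. H * real l powr (- \<gamma>))"
    and phi: "\<And>l. l \<ge> 1 \<Longrightarrow> \<bar>\<phi> l\<bar> \<le> q" and q: "q < 1" and H: "H > 0" and \<gamma>: "\<gamma> > 2"
    and L: "filterlim L at_top sequentially"
  defines "C \<equiv> \<lambda>l. H * real l powr (- \<gamma>) / (1 - (\<phi> l)\<^sup>2)"
  defines "V \<equiv> \<lambda>N \<omega>. deviation C \<phi> (harm_coeff T \<omega>) (L N) N"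
  shows "integrable M (V N)" "(\<lambda>N. \<integral>\<omega>. V N \<omega> \<partial>M) \<longlonglongrightarrow> 0"
proof -
  define d where "d l m N \<omega> = \<bar>square_avg (harm_coeff T \<omega> l m) N - C l\<bar> + \<bar>lag_avg (harm_coeff T \<omega> l m) N - \<phi> l * C l\<bar>" for l m N \<omega>
  have phi1: "\<bar>\<phi> l\<bar> < 1" if "l \<ge> 1" for l using phi[OF that] q by simp
  have d: "integrable M (d l m N)" "N > 0 \<Longrightarrow> (\<integral>\<omega>. d l m N \<omega> \<partial>M) \<le> 4 * C l" "(\<lambda>N. \<integral>\<omega>. d l m N \<omega> \<partial>M) \<longlonglongrightarrow> 0"
    if "l \<ge> 1" "m \<in> {- int l..int l}" for l m N
    using harm_coeff_deviation[OF M T sp eig aps that phi1[OF that(1)]] unfolding d_def[abs_def] C_def by blast+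
  have V: "V N \<omega> = (\<Sum>l=1..L N. \<Sum>m\<in>{- int l..int l}. d l m N \<omega>)" for N \<omega>
    by (simp add: V_def deviation_def d_def)
  show "integrable M (V N)" for N
    unfolding V[abs_def] by (intro Bochner_Integration.integrable_sum d) auto
  \<comment> \<open>Extension by zero beyond \<open>L N\<close> turns the growing finite sums into
    series over a fixed index set; \<open>N = 0\<close> is excluded because the uniform bound holds
    for positive sample sizes.\<close>
  define f where "f l N = (if l \<in> {1..L N} \<and> N > 0 then \<Sum>m\<in>{- int l..int l}. \<integral>\<omega>. d l m N \<omega> \<partial>M else 0)" for l N
  have EV: "(\<integral>\<omega>. V N \<omega> \<partial>M) = (\<Sum>l. f l N)" if N: "N > 0" for N
  proof -
    have "(\<integral>\<omega>. V N \<omega> \<partial>M) = (\<Sum>l=1..L N. \<Sum>m\<in>{- int l..int l}. \<integral>\<omega>. d l m N \<omega> \<partial>M)"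
      unfolding V using d(1) by (subst Bochner_Integration.integral_sum) (auto intro!: Bochner_Integration.integrable_sum sum.cong Bochner_Integration.integral_sum)
    also have "\<dots> = (\<Sum>l=1..L N. f l N)" using N by (intro sum.cong refl) (simp add: f_def)
    also have "\<dots> = (\<Sum>l. f l N)" by (intro suminf_finite[symmetric]) (auto simp: f_def)
    finally show ?thesis .
  qed
  \<comment> \<open>The instance at 1 shows that \<open>q\<close> is nonnegative.\<close>
  have q2: "1 - q\<^sup>2 > 0" using q phi[of 1] by (simp add: abs_square_less_1)
  \<comment> \<open>The 12 is 3 times 4: \<open>2 l + 1 \<le> 3 l\<close> orders, each with expected
    deviation at most \<open>4 * C l\<close>.\<close>
  define B where "B l = 12 * (H / (1 - q\<^sup>2)) * real l powr (1 - \<gamma>)" for l :: nat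
  have "summable B"
    unfolding B_def using \<gamma> by (intro summable_mult) (simp add: summable_real_powr_iff)
  moreover have fB: "norm (f l N) \<le> B l" for l N
  proof (cases "l \<in> {1..L N} \<and> N > 0")
    case False
    then show ?thesis using q2 H by (auto simp: f_def B_def)
  next
    case True
    then have l: "l \<ge> 1" and N: "N > 0" by auto
    have "(\<phi> l)\<^sup>2 \<le> q\<^sup>2" using phi[OF l] by (intro power2_le_iff_abs_le[THEN iffD2]) auto
    then have Cl: "C l \<le> H * real l powr (- \<gamma>) / (1 - q\<^sup>2)"
      unfolding C_def using q2 H by (intro divide_left_mono mult_pos_pos) auto
    have C0: "C l \<ge> 0"
      unfolding C_def using q2 H \<open>(\<phi> l)\<^sup>2 \<le> q\<^sup>2\<close> by (intro divide_nonneg_nonneg mult_nonneg_nonneg) auto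
    have dn: "(\<integral>\<omega>. d l m N \<omega> \<partial>M) \<ge> 0" for m by (simp add: d_def)
    have "norm (f l N) = (\<Sum>m\<in>{- int l..int l}. \<integral>\<omega>. d l m N \<omega> \<partial>M)"
      using True sum_nonneg[of "{- int l..int l}" "\<lambda>m. \<integral>\<omega>. d l m N \<omega> \<partial>M"] dn by (simp add: f_def)
    also have "\<dots> \<le> (\<Sum>m\<in>{- int l..int l}. 4 * C l)"
      using d(2)[OF l _ N] by (intro sum_mono) auto
    also have "\<dots> = (2 * real l + 1) * (4 * C l)" by simp
    also have "\<dots> \<le> (3 * real l) * (4 * (H * real l powr (- \<gamma>) / (1 - q\<^sup>2)))"
      using Cl C0 l H q2 by (intro mult_mono) auto
    also have "\<dots> = B l"
    proof -
      have "real l powr (1 - \<gamma>) = real l * real l powr (- \<gamma>)"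
        using l powr_add[of "real l" 1 "- \<gamma>"] by simp
      then show ?thesis by (simp add: B_def)
    qed
    finally show ?thesis .
  qed
  moreover have "f l \<longlonglongrightarrow> 0" for l
  proof (cases "l \<ge> 1")
    case False
    then show ?thesis by (simp add: f_def[abs_def])
  next
    case True
    have "(\<lambda>N. \<Sum>m\<in>{- int l..int l}. \<integral>\<omega>. d l m N \<omega> \<partial>M) \<longlonglongrightarrow> (\<Sum>m\<in>{- int l..int l}. 0)"
      using d(3)[OF True] by (intro tendsto_sum) auto
    moreover have "eventually (\<lambda>N. (\<Sum>m\<in>{- int l..int l}. \<integral>\<omega>. d l m N \<omega> \<partial>M) = f l N) sequentially"
      using filterlim_at_top[THEN iffD1, OF L, rule_format, of l] eventually_gt_at_top[of 0]
      by eventually_elim (use True in \<open>simp add: f_def\<close>)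
    ultimately show ?thesis by (simp add: tendsto_cong)
  qed
  ultimately have "(\<lambda>N. \<Sum>l. f l N) \<longlonglongrightarrow> (\<Sum>l. 0)"
    using tannerys_theorem[of f "\<lambda>_. 0" sequentially B] by (simp add: always_eventually case_prod_beta')
  moreover have "eventually (\<lambda>N. (\<Sum>l. f l N) = (\<integral>\<omega>. V N \<omega> \<partial>M)) sequentially"
    using eventually_gt_at_top[of 0] by eventually_elim (simp add: EV)
  ultimately show "(\<lambda>N. \<integral>\<omega>. V N \<omega> \<partial>M) \<longlonglongrightarrow> 0"
    by (simp add: tendsto_cong)
qed

theorem theorem3p2:
  fixes M :: "'w measure"
    and T Z :: "real ^ 3 \<Rightarrow> int \<Rightarrow> 'w \<Rightarrow> real"
    and k :: "real \<Rightarrow> real"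
    and G\<^sub>0 \<alpha>\<^sub>0 a\<^sub>1 a\<^sub>2 H \<gamma> :: real
    and L :: "nat \<Rightarrow> nat"
    and Gh \<alpha>h :: "nat \<Rightarrow> 'w \<Rightarrow> real"
  assumes "prob_space M"
    and "iso_stat_gaussian_field M T"
    and "sphar1 M k T Z"
    and "autoreg_eigenvalues k (\<lambda>l. G\<^sub>0 * real l powr (- \<alpha>\<^sub>0))"
    and "0 < \<bar>G\<^sub>0\<bar>" and "\<bar>G\<^sub>0\<bar> < 1"
    and "a\<^sub>1 \<le> \<alpha>\<^sub>0" and "\<alpha>\<^sub>0 \<le> a\<^sub>2" and "1 < a\<^sub>1" and "a\<^sub>1 < a\<^sub>2"
    and "angular_power_spectrum M Z (\<lambda>l. H * real l powr (- \<gamma>))"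
    and "H > 0" and "\<gamma> > 2"
    and "filterlim L at_top sequentially"
    and "(\<lambda>N. (ln (real (L N)))\<^sup>2 / sqrt (real N)) \<longlonglongrightarrow> 0"
    and "\<And>N. N > 1 \<Longrightarrow> Gh N \<in> borel_measurable M"
    and "\<And>N. N > 1 \<Longrightarrow> \<alpha>h N \<in> borel_measurable M"
    and "\<And>N. N > 1 \<Longrightarrow>
           nlls_estimator M (harm_coeff T) {a\<^sub>1..a\<^sub>2} (L N) N (Gh N) (\<alpha>h N) \<or>
           profile_nlls_estimator M (harm_coeff T) {a\<^sub>1..a\<^sub>2} (L N) N (Gh N) (\<alpha>h N)"
  shows "converges_in_prob M \<alpha>h \<alpha>\<^sub>0 \<and> converges_in_prob M Gh G\<^sub>0"
proof -
  interpret prob_space M by fact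
  let ?\<phi> = "\<lambda>l. G\<^sub>0 * real l powr (- \<alpha>\<^sub>0)"
  define C where "C l = H * real l powr (- \<gamma>) / (1 - (?\<phi> l)\<^sup>2)" for l :: nat
  define V where "V N \<omega> = deviation C ?\<phi> (harm_coeff T \<omega>) (L N) N" for N \<omega>
  have phi: "\<bar>?\<phi> l\<bar> \<le> \<bar>G\<^sub>0\<bar>" if "l \<ge> 1" for l
    using powr_neg_le_1[OF that, of \<alpha>\<^sub>0] assms(7,9) by (simp add: abs_mult mult_left_le)
  have V: "integrable M (V N)" "(\<lambda>N. \<integral>\<omega>. V N \<omega> \<partial>M) \<longlonglongrightarrow> 0" for N
    using expected_deviation_tendsto_0[OF assms(1-4) assms(11) phi assms(6,12,13,14)]
    unfolding V_def[abs_def] C_def[abs_def] by blast+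
  \<comment> \<open>At \<open>l = 0\<close> the value \<open>0 powr _ = 0\<close> applies, so
    \<open>C\<close> is nonnegative at every index.\<close>
  have phi_sq: "(?\<phi> l)\<^sup>2 < 1" for l
  proof (cases "l = 0")
    case False
    then show ?thesis using phi[of l] assms(6) by (subst abs_square_less_1) auto
  qed simp
  have C: "C l \<ge> 0" "l \<ge> 1 \<Longrightarrow> C l > 0" for l
    using phi_sq[of l] assms(12) by (auto simp: C_def)
  have main: "(\<lambda>N. measure M {\<omega> \<in> space M. \<bar>E N \<omega> - x\<bar> > e}) \<longlonglongrightarrow> 0"
    if e: "e > 0" and E: "(E = Gh \<and> x = G\<^sub>0) \<or> (E = \<alpha>h \<and> x = \<alpha>\<^sub>0)" for e E x
  proof -
    obtain \<delta> where \<delta>: "\<delta> > 0"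
      and near: "\<And>a L N G \<alpha>. L \<ge> 2 \<Longrightarrow> deviation C ?\<phi> a L N \<le> \<delta> \<Longrightarrow>
      nlls_estimate a L N {a\<^sub>1..a\<^sub>2} G \<alpha> \<Longrightarrow>
      \<bar>G - G\<^sub>0\<bar> \<le> e \<and> \<bar>\<alpha> - \<alpha>\<^sub>0\<bar> \<le> e"
      by (rule nlls_identification[of C G\<^sub>0 a\<^sub>1 \<alpha>\<^sub>0 a\<^sub>2 e]) (use C assms e in auto)
    have bound: "measure M {\<omega> \<in> space M. \<bar>E N \<omega> - x\<bar> > e} \<le> (\<integral>\<omega>. V N \<omega> \<partial>M) / \<delta>" if N: "N > 1" and LN: "L N \<ge> 2" for N
    proof -
      have [measurable]: "V N \<in> borel_measurable M" "E N \<in> borel_measurable M"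
        using V(1)[of N] assms(16,17)[OF N] E by auto
      have "AE \<omega> in M. V N \<omega> \<le> \<delta> \<longrightarrow> \<bar>Gh N \<omega> - G\<^sub>0\<bar> \<le> e \<and> \<bar>\<alpha>h N \<omega> - \<alpha>\<^sub>0\<bar> \<le> e"
        using assms(18)[OF N]
      proof
        assume "nlls_estimator M (harm_coeff T) {a\<^sub>1..a\<^sub>2} (L N) N (Gh N) (\<alpha>h N)"
        then show ?thesis unfolding nlls_estimator_def
          by eventually_elim (intro impI near[OF LN], auto simp: V_def nlls_estimate_def)
      next
        assume "profile_nlls_estimator M (harm_coeff T) {a\<^sub>1..a\<^sub>2} (L N) N (Gh N) (\<alpha>h N)"
        then show ?thesis unfolding profile_nlls_estimator_def
          by eventually_elim (intro impI near[OF LN], auto simp: V_def nlls_estimate_def)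
      qed
      \<comment> \<open>Outside a null set an error above \<open>e\<close> forces
        \<open>V N > \<delta>\<close>, so Markov's inequality bounds its probability by the expected
        deviation.\<close>
      then have "measure M {\<omega> \<in> space M. \<bar>E N \<omega> - x\<bar> > e} \<le> measure M {\<omega> \<in> space M. V N \<omega> \<ge> \<delta>}"
        by (intro finite_measure_mono_AE) (use E in \<open>auto elim!: eventually_mono\<close>)
      also have "\<dots> \<le> (\<integral>\<omega>. V N \<omega> \<partial>M) / \<delta>"
        using integral_Markov_inequality_measure[OF V(1)[of N], of "{}" \<delta>] \<delta> deviation_nonneg by (simp add: V_def)
      finally show ?thesis .
    qed
    show ?thesis
    proof (rule tendsto_sandwich[OF _ _ tendsto_const])
      show "(\<lambda>N. (\<integral>\<omega>. V N \<omega> \<partial>M) / \<delta>) \<longlonglongrightarrow> 0" using V(2) by (rule tendsto_divide_zero)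
      show "eventually (\<lambda>N. measure M {\<omega> \<in> space M. \<bar>E N \<omega> - x\<bar> > e} \<le> (\<integral>\<omega>. V N \<omega> \<partial>M) / \<delta>) sequentially"
        using eventually_gt_at_top[of 1] filterlim_at_top[THEN iffD1, OF assms(14), rule_format, of 2]
        by eventually_elim (rule bound)
    qed simp
  qed
  show ?thesis unfolding converges_in_prob_def using main by blast
qed

end
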